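(* Let $\Omega\subset\mathbb{C}^n$, $n\ge2$, be a bounded domain. Suppose that $U$ is a neighborhood of a point $\xi\in\partial\Omega$ such that $\Omega\cap U$ is $m$-convex and $\partial\Omega\cap U$ is Dini-smooth. Then there exist a neighborhood $V$ of $\xi$ with $V\subset\subset U$ and a constant $C>0$ such that, for any $x,y\in\Omega\cap V$, $$d_{K_\Omega}(x,y)\le d_{K_{\Omega\cap U}}(x,y)\le d_{K_\Omega}(x,y)+C|x-y|^{1/m},$$ and, for any $x\ne y$ in $\Omega\cap V$, $$1\le\frac{d_{K_{\Omega\cap U}}(x,y)}{d_{K_\Omega}(x,y)}\le1+C\left(\delta_\Omega(x)\wedge\delta_\Omega(y)+|x-y|^{1/m}\right).$$
   Context: $a\wedge b=\min\{a,b\}$. For a domain $D\subset\mathbb{C}^n$, $\delta_D(x)=\inf\{|x-\xi|:\xi\in\partial D\}$ and, for $v\in\mathbb{C}^n\setminus\{0\}$, $\delta_D(x;v)=\inf\{|x-\xi|:\xi\in\partial D\cap(x+\mathbb{C}v)\}$. $V\subset\subset U$ means that $V$ is relatively compact in $U$. A bounded convex domain $D\subset\mathbb{C}^n$, $n\ge2$, is $m$-convex ($m>1$) if for some $C>0$, $\delta_D(z;v)\le C\,\delta_D(z)^{1/m}$ for all $z\in D$ and all nonzero $v\in\mathbb{C}^n$. A $C^1$-smooth boundary point $p$ of $\Omega$ is Dini-smooth if there is a neighborhood $W$ of $p$ with $\int_0^1\frac{\omega(t)}{t}dt<+\infty$, where $\omega(t)=\sup\{|\vec n(x)-\vec n(y)|:|x-y|<t,\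 x,y\in\partial\Omega\cap W\}$ and $\vec n$ is the outer unit normal to $\partial\Omega$. $\partial\Omega\cap U$ is Dini-smooth if each of its points is a Dini-smooth boundary point of $\Omega$. Kobayashi metric of a domain $D$: $K_D(x;v)=\inf\{|\xi|: f:\mathbb{D}\to D \text{ holomorphic}, f(0)=x, df_0(\xi)=v\}$, with $\mathbb{D}$ the unit disc; the Kobayashi distance $d_{K_D}(x,y)$ is the infimum of $\int_0^1K_D(\gamma(t);\dot\gamma(t))\,dt$ over piecewise $C^1$ curves $\gamma:[0,1]\to D$ from $x$ to $y$. *)

theory Defs
  imports "HOL-Analysis.Analysis"
begin

text \<open>
  The space \<open>\<complex>^n\<close> is \<^typ>\<open>complex ^ 'n\<close>, whose norm is the Euclidean one; as a real inner product
  space it carries the real part of the Hermitian product, so \<^const>\<open>gderiv\<close> on it is the real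
  gradient.
\<close>

definition is_domain :: "'a::topological_space set \<Rightarrow> bool" where
  "is_domain D \<longleftrightarrow> open D \<and> connected D \<and> D \<noteq> {}"

definition boundary_dist :: "(complex ^ 'n) set \<Rightarrow> complex ^ 'n \<Rightarrow> real" where
  "boundary_dist D x = infdist x (frontier D)"

definition boundary_dist_dir :: "(complex ^ 'n) set \<Rightarrow> complex ^ 'n \<Rightarrow> complex ^ 'n \<Rightarrow> real" where
  "boundary_dist_dir D x v = infdist x (frontier D \<inter> {x + c *s v | c. True})"

text \<open>
  In a bounded domain \<open>D\<close>, for \<open>x \<in> D\<close> and \<open>v \<noteq> 0\<close>, both boundary sets above are nonempty, so the
  convention that \<^const>\<open>infdist\<close> to the empty set is \<open>0\<close> plays no role.
\<close>

definition m_convex :: "real \<Rightarrow> (complex ^ 'n) set \<Rightarrow> bool" where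
  "m_convex m D \<longleftrightarrow> m > 1 \<and> is_domain D \<and> bounded D \<and> convex D \<and>
     (\<exists>C>0. \<forall>z\<in>D. \<forall>v. v \<noteq> 0 \<longrightarrow> boundary_dist_dir D z v \<le> C * boundary_dist D z powr (1 / m))"


definition C1_defining_function ::
    "'a::euclidean_space set \<Rightarrow> 'a set \<Rightarrow> ('a \<Rightarrow> real) \<Rightarrow> ('a \<Rightarrow> 'a) \<Rightarrow> bool" where
  "C1_defining_function \<Omega> W r g \<longleftrightarrow> open W \<and>
     (\<forall>x\<in>W. GDERIV r x :> g x \<and> g x \<noteq> 0) \<and> continuous_on W g \<and>
     \<Omega> \<inter> W = {x\<in>W. r x < 0}"

definition C1_smooth_boundary_point :: "'a::euclidean_space set \<Rightarrow> 'a \<Rightarrow> bool" where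
  "C1_smooth_boundary_point \<Omega> p \<longleftrightarrow> p \<in> frontier \<Omega> \<and>
     (\<exists>W r g. p \<in> W \<and> C1_defining_function \<Omega> W r g)"

text \<open>Meaningful at the \<open>C\<^sup>1\<close>-smooth boundary points; see \<open>outer_unit_normal_eq\<close>.\<close>

definition outer_unit_normal :: "'a::euclidean_space set \<Rightarrow> 'a \<Rightarrow> 'a" where
  "outer_unit_normal \<Omega> x =
     (THE \<nu>. \<exists>W r g. x \<in> W \<and> C1_defining_function \<Omega> W r g \<and> \<nu> = g x /\<^sub>R norm (g x))"

lemma C1_defining_function_frontier:
  assumes "C1_defining_function \<Omega> W r g" "x \<in> W" "x \<in> frontier \<Omega>"
  shows "r x = 0"
proof -
  have W: "open W" and cont: "\<And>y. y \<in> W \<Longrightarrow> isCont r y"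
    and eq: "\<Omega> \<inter> W = {x\<in>W. r x < 0}"
    using assms(1) unfolding C1_defining_function_def gderiv_def
    by (auto dest: has_derivative_continuous)
  have c: "continuous_on W r"
    using cont by (simp add: continuous_at_imp_continuous_on)
  have o1: "open {x\<in>W. r x < 0}"
  proof -
    have "open (W \<inter> r -` {..<0})"
      using c W by (rule continuous_open_preimage) simp
    also have "W \<inter> r -` {..<0} = {x\<in>W. r x < 0}" by auto
    finally show ?thesis .
  qed
  have o2: "open {x\<in>W. r x > 0}"
  proof -
    have "open (W \<inter> r -` {0<..})"
      using c W by (rule continuous_open_preimage) simp
    also have "W \<inter> r -` {0<..} = {x\<in>W. r x > 0}" by auto
    finally show ?thesis .
  qed
  have "\<not> r x < 0"
  proof
    assume "r x < 0"
    then have "x \<in> {x\<in>W. r x < 0}" using assms(2) by simp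
    moreover have "{x\<in>W. r x < 0} \<subseteq> \<Omega>" using eq by blast
    ultimately have "x \<in> interior \<Omega>" using o1 by (rule_tac interiorI)
    then show False using assms(3) by (simp add: frontier_def)
  qed
  moreover have "\<not> r x > 0"
  proof
    assume "r x > 0"
    then have "x \<in> {x\<in>W. r x > 0}" using assms(2) by simp
    moreover have "{x\<in>W. r x > 0} \<inter> \<Omega> = {}" using eq by force
    ultimately have "x \<notin> closure \<Omega>"
      using o2 by (metis disjoint_iff open_Int_closure_eq_empty)
    then show False using assms(3) by (simp add: frontier_def)
  qed
  ultimately show ?thesis by linarith
qed

lemma outer_unit_normal_unique:
  assumes "C1_defining_function \<Omega> W r g" "x \<in> W" "x \<in> frontier \<Omega>"
    and "C1_defining_function \<Omega> W' r' g'" "x \<in> W'"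
  shows "g x /\<^sub>R norm (g x) = g' x /\<^sub>R norm (g' x)"
proof (rule ccontr)
  define a b where "a = g x /\<^sub>R norm (g x)" and "b = g' x /\<^sub>R norm (g' x)"
  assume "\<not> ?thesis"
  then have "a \<noteq> b" by (simp add: a_def b_def)
  have nz: "g x \<noteq> 0" "g' x \<noteq> 0"
    using assms unfolding C1_defining_function_def by auto
  then have na: "norm a = 1" and nb: "norm b = 1" by (simp_all add: a_def b_def)
  have lt: "a \<bullet> b < 1"
    using norm_cauchy_schwarz[of a b] norm_cauchy_schwarz_eq[of a b] na nb \<open>a \<noteq> b\<close>
    by (metis less_eq_real_def mult_1 scaleR_one)
  define h where "h = b - a"
  have h1: "h \<bullet> g x < 0"
  proof -
    have "h \<bullet> g x = norm (g x) * (h \<bullet> a)" using nz by (simp add: a_def)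
    moreover have "h \<bullet> a = a \<bullet> b - 1"
      using na by (simp add: h_def inner_diff_left inner_diff_right inner_commute norm_eq_1)
    ultimately show ?thesis using lt nz by (simp add: mult_less_0_iff)
  qed
  have h2: "h \<bullet> g' x > 0"
  proof -
    have "h \<bullet> g' x = norm (g' x) * (h \<bullet> b)" using nz by (simp add: b_def)
    moreover have "h \<bullet> b = 1 - a \<bullet> b"
      using nb by (simp add: h_def inner_diff_left norm_eq_1)
    ultimately show ?thesis using lt nz by simp
  qed
  have line: "((\<lambda>t. s (x + t *\<^sub>R h)) has_real_derivative h \<bullet> k) (at 0)"
    if "GDERIV s x :> k" for s k
  proof -
    have "((\<lambda>t. x + t *\<^sub>R h) has_derivative (\<lambda>t. t *\<^sub>R h)) (at (0::real))"
      by (auto intro!: derivative_eq_intros)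
    moreover have "(s has_derivative (\<lambda>h. h \<bullet> k)) (at (x + 0 *\<^sub>R h))"
      using that by (simp add: gderiv_def)
    ultimately have "((\<lambda>t. s (x + t *\<^sub>R h)) has_derivative (\<lambda>t. (t *\<^sub>R h) \<bullet> k)) (at (0::real))"
      using has_derivative_compose by blast
    then show ?thesis by (simp add: has_field_derivative_def mult.commute[of _ "h \<bullet> k"])
  qed
  have r0: "r x = 0" "r' x = 0"
    using C1_defining_function_frontier assms by blast+
  have "GDERIV r x :> g x" "GDERIV r' x :> g' x"
    using assms unfolding C1_defining_function_def by auto
  then obtain d1 d2 where d: "d1 > 0" "\<And>t. 0 < t \<Longrightarrow> t < d1 \<Longrightarrow> r (x + t *\<^sub>R h) < 0"
      "d2 > 0" "\<And>t. 0 < t \<Longrightarrow> t < d2 \<Longrightarrow> r' (x + t *\<^sub>R h) > 0"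
    using DERIV_neg_dec_right[OF line h1] DERIV_pos_inc_right[OF line h2] r0
    by (metis add.right_neutral add_0 scaleR_zero_left)
  have "open (W \<inter> W')" "x \<in> W \<inter> W'"
    using assms unfolding C1_defining_function_def by auto
  moreover have "((\<lambda>t. x + t *\<^sub>R h) \<longlongrightarrow> x + 0 *\<^sub>R h) (at_right (0::real))"
    by (intro tendsto_intros)
  ultimately have "eventually (\<lambda>t. x + t *\<^sub>R h \<in> W \<inter> W') (at_right (0::real))"
    by (intro topological_tendstoD) auto
  moreover have "eventually (\<lambda>t. t \<in> {0<..<min d1 d2}) (at_right (0::real))"
    using d by (intro eventually_at_right_real) auto
  ultimately have "eventually (\<lambda>t. x + t *\<^sub>R h \<in> W \<inter> W' \<and> t \<in> {0<..<min d1 d2}) (at_right (0::real))"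
    by (rule eventually_conj)
  then obtain t where t: "x + t *\<^sub>R h \<in> W \<inter> W'" "t \<in> {0<..<min d1 d2}"
    using eventually_happens trivial_limit_at_right_real by blast
  have "r (x + t *\<^sub>R h) < 0" "r' (x + t *\<^sub>R h) > 0"
    using d(2)[of t] d(4)[of t] t(2) by auto
  moreover have "\<Omega> \<inter> W = {x\<in>W. r x < 0}" "\<Omega> \<inter> W' = {x\<in>W'. r' x < 0}"
    using assms unfolding C1_defining_function_def by auto
  ultimately show False using t(1) by (smt (verit) IntD1 IntD2 IntI mem_Collect_eq)
qed

lemma outer_unit_normal_eq:
  assumes "C1_defining_function \<Omega> W r g" "x \<in> W" "x \<in> frontier \<Omega>"
  shows "outer_unit_normal \<Omega> x = g x /\<^sub>R norm (g x)"
  unfolding outer_unit_normal_def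
  by (rule the_equality) (use assms outer_unit_normal_unique[OF assms] in \<open>blast, metis\<close>)

definition normal_modulus :: "'a::euclidean_space set \<Rightarrow> 'a set \<Rightarrow> real \<Rightarrow> real" where
  "normal_modulus \<Omega> W t =
     Sup {norm (outer_unit_normal \<Omega> x - outer_unit_normal \<Omega> y) | x y.
            norm (x - y) < t \<and> x \<in> frontier \<Omega> \<inter> W \<and> y \<in> frontier \<Omega> \<inter> W}"

text \<open>
  The requirement that all points of \<open>\<partial>\<Omega> \<inter> W\<close> be \<open>C\<^sup>1\<close>-smooth makes the normal meaningful there.
\<close>

definition Dini_smooth_boundary_point :: "'a::euclidean_space set \<Rightarrow> 'a \<Rightarrow> bool" where
  "Dini_smooth_boundary_point \<Omega> p \<longleftrightarrow> C1_smooth_boundary_point \<Omega> p \<and>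
     (\<exists>W. open W \<and> p \<in> W \<and> (\<forall>x \<in> frontier \<Omega> \<inter> W. C1_smooth_boundary_point \<Omega> x) \<and>
        (\<integral>\<^sup>+ t \<in> {0<..<1}. ennreal (normal_modulus \<Omega> W t / t) \<partial>lborel) < \<infinity>)"


definition holomorphic_disc :: "(complex ^ 'n) set \<Rightarrow> (complex \<Rightarrow> complex ^ 'n) \<Rightarrow> bool" where
  "holomorphic_disc D f \<longleftrightarrow>
     (\<forall>i. (\<lambda>z. f z $ i) holomorphic_on ball 0 1) \<and> f ` ball 0 1 \<subseteq> D"

definition kobayashi_metric :: "(complex ^ 'n) set \<Rightarrow> complex ^ 'n \<Rightarrow> complex ^ 'n \<Rightarrow> real" where
  "kobayashi_metric D x v =
     Inf {norm \<zeta> | \<zeta> f. holomorphic_disc D f \<and> f 0 = x \<and> frechet_derivative f (at 0) \<zeta> = v}"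

text \<open>
  Using the nonnegative integral, a curve of infinite length just does not contribute to the infimum
  defining the distance; that infimum is finite for points of a domain. \<^const>\<open>valid_path\<close> is the
  library's notion of a piecewise \<open>C\<^sup>1\<close> curve on \<open>[0,1]\<close>. It does not ask for one-sided derivatives
  at the finitely many exceptional parameters. In a bounded domain this does not affect the infimum:
  a curve of finite length can be replaced by a short segment near each exceptional parameter.
\<close>

definition kobayashi_length :: "(complex ^ 'n) set \<Rightarrow> (real \<Rightarrow> complex ^ 'n) \<Rightarrow> ennreal" where
  "kobayashi_length D \<gamma> =
     (\<integral>\<^sup>+ t \<in> {0..1}. ennreal (kobayashi_metric D (\<gamma> t) (vector_derivative \<gamma> (at t))) \<partial>lborel)"

definition kobayashi_dist :: "(complex ^ 'n) set \<Rightarrow> complex ^ 'n \<Rightarrow> complex ^ 'n \<Rightarrow> real" where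
  "kobayashi_dist D x y =
     enn2real (INF \<gamma> \<in> {\<gamma>. valid_path \<gamma> \<and> path_image \<gamma> \<subseteq> D \<and> pathstart \<gamma> = x \<and> pathfinish \<gamma> = y}.
       kobayashi_length D \<gamma>)"

end

theory Submission
  imports Defs "HOL-Complex_Analysis.Complex_Analysis"
begin

text \<open>
  Let \<open>D = \<Omega> \<inter> U\<close> and let \<open>\<delta>\<close> be the distance to \<open>\<partial>D\<close>. In the convex domain \<open>D\<close>, Schwarz--Pick in a
  supporting half-space shows that the height \<open>l\<close> over a supporting hyperplane satisfies \<open>\<bar>dl\<bar> \<le> 2 l K_D\<close>, and
  \<open>m\<close>-convexity gives \<open>\<bar>v\<bar> \<le> C \<delta> powr (1/m) K_D\<close>. Together they force a curve from \<open>z\<close> near \<open>\<xi>\<close> that leaves a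
  fixed ball to have length at least \<open>ln (1 / \<delta> z) / 2 - C\<close>. Applied to the radial paths of an analytic disc in
  \<open>\<Omega>\<close> centred at \<open>z\<close>, this keeps the concentric disc of radius \<open>1 - C \<delta> z\<close> inside \<open>D\<close>, so that
  \<open>K_D \<le> (1 + C \<delta>) K_\<Omega>\<close> near \<open>\<xi>\<close>; since the exit estimate presupposes a comparison of the metrics, one starts from
  the crude bound \<open>K_D \<le> A K_\<Omega>\<close> and improves it twice.

  Dini smoothness yields discs in the complex normal lines that give, with \<open>h = \<bar>x - y\<bar>\<close>,
  \<open>d_D(x, y) \<le> ln (max h (\<delta> x) / \<delta> x) / 2 + ln (max h (\<delta> y) / \<delta> y) / 2 + C\<close>. Comparison with the lower bounds shows
  that a near-geodesic of \<open>\<Omega>\<close> from \<open>x\<close> to \<open>y\<close> stays near \<open>\<xi>\<close> and has depth \<open>\<delta> \<le> H = C (h + min (\<delta> x) (\<delta> y))\<close>.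
  Integrating \<open>K_D \<le> (1 + C H) K_\<Omega>\<close> along it gives the quotient estimate. For the additive one, the part of the
  near-geodesic in \<open>2 powr (- k - 1) H < \<delta> \<le> 2 powr (- k) H\<close> has length \<open>O(1 + k + ln (1 / H))\<close>, and summing the errors
  \<open>2 powr (- k) H\<close> times these lengths yields \<open>O(H powr (1/m))\<close> because \<open>m > 1\<close>.
\<close>

section \<open>Lower integrals\<close>

text \<open>What shapes the proof is an exact cancellation. A curve from \<open>x\<close> to
  \<open>y\<close> that leaves a fixed ball costs at least
  \<open>- ln (\<delta> x) / 2 - ln (\<delta> y) / 2\<close> up to a constant, and the upper bound
  for the distance has the same terms with the same coefficient. A factor \<open>A > 1\<close> in
  the lower bound, or an unbounded error in the upper one, would drown what remains; so the
  comparison of the metrics must be sharp at the boundary, and the discs in the normal lines must be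
  optimal up to an integrable error. The exponents explain the two rounds. A factor \<open>A\<close>
  turns the exit cost into \<open>- ln (\<delta> z) / (2 * A)\<close>, which yields the factor
  \<open>1 + O(\<delta> powr (1/A))\<close>. This error is integrable against \<open>dl / l\<close>,
  so the next exit cost has the coefficient 1/2 itself and the error drops to
  \<open>O(\<delta>)\<close>. The dyadic sum gives a power of \<open>H\<close>, which is of the
  order of \<open>|x - y|\<close> only if \<open>|x - y|\<close> dominates the smaller depth. For
  deeper pairs the additive estimate is read off from the quotient estimate instead.\<close>

text \<open>The Kobayashi metric along a curve is not known here to be measurable, so its \<^const>\<open>nn_integral\<close> is only a
  lower integral; additivity over disjoint sets and the affine substitution survive.\<close>

lemma nn_integral_measurable_minorant:
  fixes f :: "'a \<Rightarrow> ennreal"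
  obtains g where "g \<in> borel_measurable M" "\<And>x. g x \<le> f x" "integral\<^sup>N M g = integral\<^sup>N M f"
proof -
  let ?A = "{g. simple_function M g \<and> g \<le> f}"
  have ne: "?A \<noteq> {}" by (auto intro!: exI[of _ "\<lambda>_. 0"] simp: le_fun_def)
  obtain F :: "nat \<Rightarrow> _" where F: "range F \<subseteq> integral\<^sup>S M ` ?A" "Sup (integral\<^sup>S M ` ?A) = Sup (range F)"
    using ennreal_Sup_countable_SUP[of "integral\<^sup>S M ` ?A"] ne by auto
  have "\<forall>n. \<exists>g. g \<in> ?A \<and> F n = integral\<^sup>S M g" using F(1) by blast
  then obtain G where G: "\<And>n. G n \<in> ?A" "\<And>n. F n = integral\<^sup>S M (G n)" by metis
  have Gs: "simple_function M (G n)" for n using G(1) by auto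
  note [measurable] = borel_measurable_simple_function[OF Gs]
  define g where "g x = (SUP n. G n x)" for x
  have [measurable]: "g \<in> borel_measurable M" unfolding g_def by measurable
  have le: "g x \<le> f x" for x
    unfolding g_def using G(1) by (auto intro!: SUP_least simp: le_fun_def)
  have "integral\<^sup>N M f = (SUP n. integral\<^sup>S M (G n))"
    unfolding nn_integral_def using F(2) G(2) by simp
  also have "\<dots> \<le> integral\<^sup>N M g"
  proof (rule SUP_least)
    fix n
    have "integral\<^sup>S M (G n) = integral\<^sup>N M (G n)" using Gs by (simp add: nn_integral_eq_simple_integral)
    also have "\<dots> \<le> integral\<^sup>N M g"
      by (rule nn_integral_mono) (auto simp: g_def intro: SUP_upper)
    finally show "integral\<^sup>S M (G n) \<le> integral\<^sup>N M g" .
  qed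
  finally have "integral\<^sup>N M g = integral\<^sup>N M f"
    using nn_integral_mono[of M g f] le by (intro antisym) auto
  then show ?thesis using that[of g] le by auto
qed

text \<open>Additivity needs a measurable integrand, so each inequality passes to a measurable
  minorant with the same integral: on the union for one direction, on each piece for the
  other.\<close>

lemma set_nn_integral_Un_nonmeasurable:
  fixes f :: "'a \<Rightarrow> ennreal"
  assumes [measurable]: "A \<in> sets M" "B \<in> sets M" and "A \<inter> B = {}"
  shows "(\<integral>\<^sup>+x\<in>A \<union> B. f x \<partial>M) = (\<integral>\<^sup>+x\<in>A. f x \<partial>M) + (\<integral>\<^sup>+x\<in>B. f x \<partial>M)"
proof (rule antisym)
  obtain g where g[measurable]: "g \<in> borel_measurable M" and gf: "\<And>x. g x \<le> f x * indicator (A \<union> B) x"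
    and gi: "integral\<^sup>N M g = (\<integral>\<^sup>+x\<in>A \<union> B. f x \<partial>M)"
    by (rule nn_integral_measurable_minorant[where f="\<lambda>x. f x * indicator (A \<union> B) x" and M = M]) blast
  have g0: "g x = 0" if "x \<notin> A \<union> B" for x using gf[of x] that by simp
  have "g x = g x * indicator A x + g x * indicator B x" for x
    using g0[of x] assms(3) by (cases "x \<in> A"; cases "x \<in> B") auto
  then have "integral\<^sup>N M g = (\<integral>\<^sup>+x. g x * indicator A x + g x * indicator B x \<partial>M)" by simp
  also have "\<dots> = (\<integral>\<^sup>+x\<in>A. g x \<partial>M) + (\<integral>\<^sup>+x\<in>B. g x \<partial>M)"
    by (rule nn_integral_add) measurable
  also have "\<dots> \<le> (\<integral>\<^sup>+x\<in>A. f x \<partial>M) + (\<integral>\<^sup>+x\<in>B. f x \<partial>M)"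
  proof (intro add_mono nn_integral_mono)
    show "g x * indicator A x \<le> f x * indicator A x" for x using gf[of x] by (auto split: split_indicator)
    show "g x * indicator B x \<le> f x * indicator B x" for x using gf[of x] by (auto split: split_indicator)
  qed
  finally show "(\<integral>\<^sup>+x\<in>A \<union> B. f x \<partial>M) \<le> (\<integral>\<^sup>+x\<in>A. f x \<partial>M) + (\<integral>\<^sup>+x\<in>B. f x \<partial>M)"
    using gi by simp
next
  obtain g where g[measurable]: "g \<in> borel_measurable M" and gf: "\<And>x. g x \<le> f x * indicator A x"
    and gi: "integral\<^sup>N M g = (\<integral>\<^sup>+x\<in>A. f x \<partial>M)"
    by (rule nn_integral_measurable_minorant[where f="\<lambda>x. f x * indicator A x" and M = M]) blast
  obtain h where h[measurable]: "h \<in> borel_measurable M" and hf: "\<And>x. h x \<le> f x * indicator B x"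
    and hi: "integral\<^sup>N M h = (\<integral>\<^sup>+x\<in>B. f x \<partial>M)"
    by (rule nn_integral_measurable_minorant[where f="\<lambda>x. f x * indicator B x" and M = M]) blast
  have "(\<integral>\<^sup>+x\<in>A. f x \<partial>M) + (\<integral>\<^sup>+x\<in>B. f x \<partial>M) = (\<integral>\<^sup>+x. g x + h x \<partial>M)"
    unfolding gi[symmetric] hi[symmetric] by (rule nn_integral_add[symmetric]) measurable
  also have "\<dots> \<le> (\<integral>\<^sup>+x\<in>A \<union> B. f x \<partial>M)"
  proof (rule nn_integral_mono)
    fix x
    show "g x + h x \<le> f x * indicator (A \<union> B) x"
      using gf[of x] hf[of x] assms(3) by (cases "x \<in> A"; cases "x \<in> B") auto
  qed
  finally show "(\<integral>\<^sup>+x\<in>A. f x \<partial>M) + (\<integral>\<^sup>+x\<in>B. f x \<partial>M) \<le> (\<integral>\<^sup>+x\<in>A \<union> B. f x \<partial>M)" .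
qed

lemma set_nn_integral_UN_nonmeasurable:
  fixes f :: "'a \<Rightarrow> ennreal"
  assumes "finite I" "\<And>i. i \<in> I \<Longrightarrow> A i \<in> sets M" "disjoint_family_on A I"
  shows "(\<integral>\<^sup>+x\<in>(\<Union>i\<in>I. A i). f x \<partial>M) = (\<Sum>i\<in>I. \<integral>\<^sup>+x\<in>A i. f x \<partial>M)"
  using assms
proof (induction I rule: finite_induct)
  case (insert j I)
  have "A j \<inter> (\<Union>i\<in>I. A i) = {}"
    using insert.prems(2) insert.hyps unfolding disjoint_family_on_def by fastforce
  moreover have "(\<integral>\<^sup>+x\<in>(\<Union>i\<in>I. A i). f x \<partial>M) = (\<Sum>i\<in>I. \<integral>\<^sup>+x\<in>A i. f x \<partial>M)"
    using insert by (auto simp: disjoint_family_on_def)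
  moreover have "(\<Union>i\<in>I. A i) \<in> sets M"
    using insert.prems(1) insert.hyps(1) by (intro sets.finite_UN) auto
  ultimately show ?case
    using set_nn_integral_Un_nonmeasurable[of "A j" M "\<Union>i\<in>I. A i" f] insert by simp
qed auto

text \<open>A measurable minorant of \<open>c * f\<close>, divided by \<open>c\<close>, is a
  minorant of \<open>f\<close>.\<close>

lemma nn_integral_cmult_le_nonmeasurable:
  fixes f :: "'a \<Rightarrow> ennreal"
  assumes "0 < c" "c < \<infinity>"
  shows "(\<integral>\<^sup>+x. c * f x \<partial>M) \<le> c * integral\<^sup>N M f"
proof -
  obtain g where g[measurable]: "g \<in> borel_measurable M" and gf: "\<And>x. g x \<le> c * f x"
    and gi: "integral\<^sup>N M g = (\<integral>\<^sup>+x. c * f x \<partial>M)"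
    by (rule nn_integral_measurable_minorant[where f="\<lambda>x. c * f x" and M = M]) blast
  obtain r where r: "c = ennreal r" "0 < r" using assms by (cases c) (auto simp: less_top)
  have inv: "ennreal (1 / r) * c = 1" using r by (simp add: ennreal_mult[symmetric])
  have inv': "c * (ennreal (1 / r) * u) = u" for u
    using inv by (simp add: mult.assoc[symmetric] mult.commute[of c])
  have "ennreal (1 / r) * g x \<le> f x" for x
  proof -
    have "ennreal (1 / r) * g x \<le> ennreal (1 / r) * (c * f x)" using gf by (rule mult_left_mono) auto
    then show ?thesis by (simp add: mult.assoc[symmetric] inv)
  qed
  then have "(\<integral>\<^sup>+x. ennreal (1 / r) * g x \<partial>M) \<le> integral\<^sup>N M f" by (intro nn_integral_mono)
  then have "c * (ennreal (1 / r) * integral\<^sup>N M g) \<le> c * integral\<^sup>N M f"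
    by (intro mult_left_mono) (auto simp: nn_integral_cmult)
  then show ?thesis using gi by (simp add: inv')
qed

text \<open>The substitution carries measurable minorants of either side to minorants of the other,
  so the formula for measurable functions gives both inequalities.\<close>

lemma nn_integral_real_affine_nonmeasurable:
  fixes f :: "real \<Rightarrow> ennreal"
  assumes "c \<noteq> 0"
  shows "(\<integral>\<^sup>+x. f x \<partial>lborel) = ennreal \<bar>c\<bar> * (\<integral>\<^sup>+x. f (t + c * x) \<partial>lborel)"
proof (rule antisym)
  obtain g where g[measurable]: "g \<in> borel_measurable lborel" and gf: "\<And>x. g x \<le> f x"
    and gi: "integral\<^sup>N lborel g = integral\<^sup>N lborel f"
    by (rule nn_integral_measurable_minorant[where f=f and M = lborel]) blast
  have "integral\<^sup>N lborel g = ennreal \<bar>c\<bar> * (\<integral>\<^sup>+x. g (t + c * x) \<partial>lborel)"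
    by (rule nn_integral_real_affine) (use assms g in simp_all)
  also have "\<dots> \<le> ennreal \<bar>c\<bar> * (\<integral>\<^sup>+x. f (t + c * x) \<partial>lborel)"
    by (intro mult_left_mono nn_integral_mono gf) auto
  finally show "(\<integral>\<^sup>+x. f x \<partial>lborel) \<le> ennreal \<bar>c\<bar> * (\<integral>\<^sup>+x. f (t + c * x) \<partial>lborel)" by (simp add: gi)
next
  obtain g where g[measurable]: "g \<in> borel_measurable lborel" and gf: "\<And>x. g x \<le> f (t + c * x)"
    and gi: "integral\<^sup>N lborel g = (\<integral>\<^sup>+x. f (t + c * x) \<partial>lborel)"
    by (rule nn_integral_measurable_minorant[where f="\<lambda>x. f (t + c * x)" and M = lborel]) blast
  have [measurable]: "g \<in> borel_measurable borel" using g by simp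
  have "ennreal \<bar>c\<bar> * integral\<^sup>N lborel g = ennreal \<bar>c\<bar> * (\<integral>\<^sup>+x. g ((t + c * x - t) / c) \<partial>lborel)"
    using assms by simp
  also have "\<dots> = (\<integral>\<^sup>+x. g ((x - t) / c) \<partial>lborel)"
    by (subst nn_integral_real_affine[where c=c and t=t and f="\<lambda>x. g ((x - t) / c)"]) (use assms in simp_all)
  also have "\<dots> \<le> (\<integral>\<^sup>+x. f x \<partial>lborel)"
    using gf[of "(x - t) / c" for x] assms by (intro nn_integral_mono) simp
  finally show "ennreal \<bar>c\<bar> * (\<integral>\<^sup>+x. f (t + c * x) \<partial>lborel) \<le> (\<integral>\<^sup>+x. f x \<partial>lborel)" by (simp add: gi)
qed

lemma nn_integral_cong_off_finite:
  fixes f g :: "real \<Rightarrow> ennreal"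
  assumes "finite S" "\<And>t. t \<notin> S \<Longrightarrow> f t = g t"
  shows "integral\<^sup>N lborel f = integral\<^sup>N lborel g"
proof (rule nn_integral_cong_AE)
  have "AE t in lborel. t \<notin> S"
    using assms(1) by (intro AE_not_in) (auto simp: finite_imp_null_set_lborel)
  then show "AE t in lborel. f t = g t" by eventually_elim (rule assms(2))
qed

lemma set_nn_integral_Icc_split:
  fixes f :: "real \<Rightarrow> ennreal"
  assumes "a \<le> b" "b \<le> c"
  shows "(\<integral>\<^sup>+t\<in>{a..c}. f t \<partial>lborel) = (\<integral>\<^sup>+t\<in>{a..b}. f t \<partial>lborel) + (\<integral>\<^sup>+t\<in>{b..c}. f t \<partial>lborel)"
proof -
  have "{a..c} = {a..b} \<union> {b<..c}" "{a..b} \<inter> {b<..c} = {}" using assms by auto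
  then have "(\<integral>\<^sup>+t\<in>{a..c}. f t \<partial>lborel) = (\<integral>\<^sup>+t\<in>{a..b}. f t \<partial>lborel) + (\<integral>\<^sup>+t\<in>{b<..c}. f t \<partial>lborel)"
    by (simp add: set_nn_integral_Un_nonmeasurable)
  moreover have "(\<integral>\<^sup>+t\<in>{b<..c}. f t \<partial>lborel) = (\<integral>\<^sup>+t\<in>{b..c}. f t \<partial>lborel)"
    by (rule nn_integral_cong_off_finite[of "{b}"]) (auto split: split_indicator)
  ultimately show ?thesis by simp
qed

text \<open>Only \<open>k\<close> may fail to be measurable: \<open>u'\<close>, cut off outside the
  regular times, is measurable. If its absolute integral is infinite, so is the right-hand side;
  otherwise its integral is the increment, by the fundamental theorem of calculus.\<close>

lemma increment_le_nn_integral: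
  fixes u u' :: "real \<Rightarrow> real" and k :: "real \<Rightarrow> ennreal"
  assumes ab: "a \<le> b" and S: "finite S" and cu: "continuous_on {a..b} u"
    and du: "\<And>t. t \<in> {a<..<b} - S \<Longrightarrow> (u has_real_derivative u' t) (at t)"
    and cu': "continuous_on ({a<..<b} - S) u'"
    and le: "\<And>t. t \<in> {a<..<b} - S \<Longrightarrow> ennreal \<bar>u' t\<bar> \<le> k t"
  shows "ennreal \<bar>u b - u a\<bar> \<le> (\<integral>\<^sup>+t\<in>{a..b}. k t \<partial>lborel)"
proof -
  define N where "N = {a<..<b} - S"
  have oN: "open N" unfolding N_def using S by (simp add: open_Diff finite_imp_closed)
  define g where "g t = indicator N t *\<^sub>R u' t" for t
  have [measurable]: "g \<in> borel_measurable borel"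
    unfolding g_def using cu' oN by (intro borel_measurable_continuous_on_indicator) (auto simp: N_def)
  have le': "(\<integral>\<^sup>+t. ennreal (norm (g t)) \<partial>lborel) \<le> (\<integral>\<^sup>+t\<in>{a..b}. k t \<partial>lborel)"
    by (rule nn_integral_mono) (use le in \<open>auto simp: g_def N_def split: split_indicator\<close>)
  show ?thesis
  proof (cases "(\<integral>\<^sup>+t. ennreal (norm (g t)) \<partial>lborel) = \<infinity>")
    case True
    then show ?thesis using le' by (simp add: top_unique)
  next
    case False
    then have ig: "integrable lborel g"
      by (intro integrableI_bounded) (auto simp: less_top)
    have g0: "\<And>t. t \<notin> {a..b} \<Longrightarrow> g t = 0" by (auto simp: g_def N_def)
    then have "(g has_integral integral\<^sup>L lborel g) {a..b}"
    proof -
      have "g = (\<lambda>t. if t \<in> {a..b} then g t else 0)" using g0 by auto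
      then show ?thesis
        using has_integral_integral_real[OF ig] has_integral_restrict_UNIV[of "{a..b}" g] by metis
    qed
    moreover have "(g has_integral (u b - u a)) {a..b}"
    proof (rule fundamental_theorem_of_calculus_interior_strong[OF S ab _ cu])
      show "(u has_vector_derivative g t) (at t)" if "t \<in> {a<..<b} - S" for t
        using du[OF that] that by (simp add: g_def N_def has_real_derivative_iff_has_vector_derivative)
    qed
    ultimately have "u b - u a = integral\<^sup>L lborel g" using has_integral_unique by blast
    then have "ennreal \<bar>u b - u a\<bar> \<le> ennreal (\<integral>t. norm (g t) \<partial>lborel)"
      using integral_norm_bound[of lborel g] by (simp add: ennreal_leI)
    also have "\<dots> = (\<integral>\<^sup>+t. ennreal (norm (g t)) \<partial>lborel)"
      using ig by (intro nn_integral_eq_integral[symmetric]) auto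
    finally show ?thesis using le' by (rule order_trans)
  qed
qed

section \<open>The Kobayashi metric\<close>

text \<open>The Hermitian product, complex linear in \<open>v\<close>: along a holomorphic disc
  \<open>hprod (f z) w\<close> is holomorphic, and its real part is the real inner product.\<close>

definition hprod :: "complex ^ 'n \<Rightarrow> complex ^ 'n \<Rightarrow> complex" where
  "hprod v w = (\<Sum>i\<in>UNIV. v $ i * cnj (w $ i))"

lemma norm_vector_scalar_mult_complex: "norm (c *s v) = norm c * norm (v :: complex ^ 'n)"
proof -
  have "(\<Sum>i\<in>UNIV. (norm (c * v $ i))\<^sup>2) = (norm c)\<^sup>2 * (\<Sum>i\<in>UNIV. (norm (v $ i))\<^sup>2)"
    by (simp add: norm_mult power_mult_distrib sum_distrib_left)
  then show ?thesis by (simp add: norm_vec_def L2_set_def real_sqrt_mult)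
qed

lemma of_real_vector_scalar_mult: "complex_of_real r *s v = r *\<^sub>R v"
proof -
  have "complex_of_real r * v $ i = r *\<^sub>R (v $ i)" for i by (simp add: scaleR_conv_of_real)
  then show ?thesis by (simp add: vec_eq_iff)
qed

lemma Re_hprod: "Re (hprod v w) = v \<bullet> w"
  by (simp add: hprod_def inner_vec_def inner_complex_def)

lemma hprod_smult: "hprod (c *s v) w = c * hprod v w"
  by (simp add: hprod_def sum_distrib_left mult.assoc)

lemma hprod_self: "hprod v v = of_real ((norm v)\<^sup>2)"
proof -
  have "Im (hprod v v) = 0" by (simp add: hprod_def)
  then show ?thesis using Re_hprod[of v v] by (simp add: complex_eq_iff power2_norm_eq_inner)
qed

text \<open>A unit factor turns \<open>hprod v w\<close> into a nonnegative real, where the real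
  Cauchy--Schwarz inequality applies.\<close>

lemma norm_hprod_le: "norm (hprod v w) \<le> norm v * norm w"
proof (cases "hprod v w = 0")
  case False
  define c where "c = cnj (hprod v w) / of_real (norm (hprod v w))"
  have c1: "norm c = 1" using False by (simp add: c_def norm_divide)
  have "c * hprod v w = of_real (norm (hprod v w))"
    using False complex_norm_square[of "hprod v w"]
    by (simp add: c_def power2_eq_square divide_eq_eq mult.commute)
  then have "norm (hprod v w) = (c *s v) \<bullet> w"
    using Re_hprod[of "c *s v" w] by (simp add: hprod_smult)
  also have "\<dots> \<le> norm v * norm w"
    using norm_cauchy_schwarz[of "c *s v" w] c1 by (simp add: norm_vector_scalar_mult_complex)
  finally show ?thesis .
qed auto

definition disc_deriv :: "(complex \<Rightarrow> complex ^ 'n) \<Rightarrow> complex \<Rightarrow> complex ^ 'n" where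
  "disc_deriv f z = (\<chi> i. deriv (\<lambda>w. f w $ i) z)"

lemma holomorphic_disc_has_derivative:
  assumes "holomorphic_disc D f" "z \<in> ball 0 1"
  shows "(f has_derivative (\<lambda>h. h *s disc_deriv f z)) (at z)"
proof -
  have eq: "v = (\<Sum>i\<in>UNIV. axis i (v $ i))" for v :: "complex ^ 'n"
    by (simp add: vec_eq_iff axis_def)
  have bl: "bounded_linear (axis i :: complex \<Rightarrow> complex ^ 'n)" for i
    unfolding linear_conv_bounded_linear[symmetric]
    by (rule linearI) (auto simp: vec_eq_iff axis_def)
  have "((\<lambda>w. axis i (f w $ i)) has_derivative (\<lambda>h. axis i (h * deriv (\<lambda>w. f w $ i) z))) (at z)" for i
  proof -
    have "(\<lambda>w. f w $ i) holomorphic_on ball 0 1" using assms(1) by (simp add: holomorphic_disc_def)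
    then have "((\<lambda>w. f w $ i) has_field_derivative deriv (\<lambda>w. f w $ i) z) (at z)"
      using assms(2) by (intro holomorphic_derivI[of _ "ball 0 1"]) auto
    then have "((\<lambda>w. f w $ i) has_derivative (\<lambda>h. h * deriv (\<lambda>w. f w $ i) z)) (at z)"
      by (rule has_field_derivative_imp_has_derivative[THEN has_derivative_eq_rhs]) (simp add: fun_eq_iff mult.commute)
    then show ?thesis by (rule bounded_linear.has_derivative[OF bl])
  qed
  then have "((\<lambda>w. \<Sum>i\<in>UNIV. axis i (f w $ i)) has_derivative
      (\<lambda>h. \<Sum>i\<in>UNIV. axis i (h * deriv (\<lambda>w. f w $ i) z))) (at z)"
    by (intro has_derivative_sum)
  moreover have "(\<lambda>w. \<Sum>i\<in>UNIV. axis i (f w $ i)) = f" by (rule ext) (rule eq[symmetric])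
  moreover have "(\<Sum>i\<in>UNIV. axis i (h * deriv (\<lambda>w. f w $ i) z)) = h *s disc_deriv f z" for h
    using eq[of "h *s disc_deriv f z", symmetric] by (simp add: disc_deriv_def)
  ultimately show ?thesis by simp
qed

lemma frechet_derivative_holomorphic_disc:
  assumes "holomorphic_disc D f"
  shows "frechet_derivative f (at 0) \<zeta> = \<zeta> *s disc_deriv f 0"
  using frechet_derivative_at[OF holomorphic_disc_has_derivative[OF assms, of 0]] by (simp add: fun_eq_iff)

section \<open>Competitors for the infimum and changes of centre\<close>

lemma kobayashi_metric_eq:
  "kobayashi_metric D x v = Inf {norm \<zeta> | \<zeta> f. holomorphic_disc D f \<and> f 0 = x \<and> \<zeta> *s disc_deriv f 0 = v}"
proof -
  have "{norm \<zeta> | \<zeta> f. holomorphic_disc D f \<and> f 0 = x \<and> frechet_derivative f (at 0) \<zeta> = v} =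
    {norm \<zeta> | \<zeta> f. holomorphic_disc D f \<and> f 0 = x \<and> \<zeta> *s disc_deriv f 0 = v}"
    by (intro Collect_cong ex_cong1) (auto simp: frechet_derivative_holomorphic_disc)
  then show ?thesis by (simp only: kobayashi_metric_def)
qed

lemma kobayashi_metric_le:
  assumes "holomorphic_disc D f" "f 0 = x" "\<zeta> *s disc_deriv f 0 = v"
  shows "kobayashi_metric D x v \<le> norm \<zeta>"
  unfolding kobayashi_metric_eq using assms by (intro cInf_lower) (auto intro!: bdd_belowI[of _ 0])

lemma holomorphic_disc_compose:
  assumes f: "holomorphic_disc D f" and g: "g holomorphic_on ball 0 1" "g ` ball 0 1 \<subseteq> ball 0 1"
  shows "holomorphic_disc D (f \<circ> g)"
    and "z \<in> ball 0 1 \<Longrightarrow> disc_deriv (f \<circ> g) z = deriv g z *s disc_deriv f (g z)"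
proof -
  have h: "(\<lambda>w. f w $ i) holomorphic_on ball 0 1" for i using f by (simp add: holomorphic_disc_def)
  have "(\<lambda>w. f w $ i) \<circ> g holomorphic_on ball 0 1" for i
    by (rule holomorphic_on_compose_gen[OF g(1) h g(2)])
  then show "holomorphic_disc D (f \<circ> g)"
    using f g(2) by (auto simp: holomorphic_disc_def o_def image_subset_iff)
  assume z: "z \<in> ball 0 1"
  have "deriv ((\<lambda>w. f w $ i) \<circ> g) z = deriv (\<lambda>w. f w $ i) (g z) * deriv g z" for i
  proof (rule deriv_chain)
    show "g field_differentiable at z"
      using g(1) z holomorphic_on_imp_differentiable_at by blast
    show "(\<lambda>w. f w $ i) field_differentiable at (g z)"
      using h[of i] g(2) z holomorphic_on_imp_differentiable_at by blast
  qed
  then show "disc_deriv (f \<circ> g) z = deriv g z *s disc_deriv f (g z)"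
    by (simp add: vec_eq_iff disc_deriv_def o_def mult.commute)
qed

lemma holomorphic_disc_affine:
  assumes "\<And>w. norm w < 1 \<Longrightarrow> a + w *s u \<in> D"
  shows "holomorphic_disc D (\<lambda>w. a + w *s u)" "disc_deriv (\<lambda>w. a + w *s u) z = u"
proof -
  show "holomorphic_disc D (\<lambda>w. a + w *s u)"
    using assms by (auto simp: holomorphic_disc_def intro!: holomorphic_intros)
  have "((\<lambda>w. a $ i + w * u $ i) has_field_derivative u $ i) (at z)" for i
    by (auto intro!: derivative_eq_intros)
  then show "disc_deriv (\<lambda>w. a + w *s u) z = u"
    by (simp add: vec_eq_iff disc_deriv_def DERIV_imp_deriv)
qed

text \<open>The infimum of the empty set is a default value, so lower bounds for the metric need at
  least one competitor; a small affine disc provides it. The summand 1 in the denominator of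
  \<open>r\<close> admits \<open>v = 0\<close>.\<close>

lemma kobayashi_metric_competitors_nonempty:
  assumes "open D" "x \<in> D"
  shows "{norm \<zeta> | \<zeta> f. holomorphic_disc D f \<and> f 0 = x \<and> \<zeta> *s disc_deriv f 0 = v} \<noteq> {}"
proof -
  obtain e where e: "e > 0" "ball x e \<subseteq> D" using assms by (auto simp: open_contains_ball)
  define r where "r = e / (norm v + 1)"
  have pos: "norm v + 1 > 0" by (simp add: add_nonneg_pos)
  have r: "r > 0" using e pos by (simp add: r_def)
  have "x + w *s (r *\<^sub>R v) \<in> D" if "norm w < 1" for w
  proof -
    have "norm (w *s (r *\<^sub>R v)) \<le> 1 * (r * norm v)"
      using that r by (simp add: norm_vector_scalar_mult_complex mult_right_le_one_le mult_left_le_one_le)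
    also have "\<dots> < e" using e pos by (simp add: r_def field_simps)
    finally show ?thesis using e by (auto simp: dist_norm)
  qed
  note h = holomorphic_disc_affine[of x "r *\<^sub>R v" D, OF this]
  have "of_real (1 / r) *s disc_deriv (\<lambda>w. x + w *s (r *\<^sub>R v)) 0 = v"
    using r h(2)[of 0] by (simp add: of_real_vector_scalar_mult del: of_real_divide)
  then have "norm (complex_of_real (1 / r)) \<in> {norm \<zeta> | \<zeta> f. holomorphic_disc D f \<and> f 0 = x \<and> \<zeta> *s disc_deriv f 0 = v}"
    using h(1) by (intro CollectI exI conjI refl) auto
  then show ?thesis by blast
qed

lemma kobayashi_metric_ge:
  assumes "open D" "x \<in> D"
    and "\<And>f \<zeta>. holomorphic_disc D f \<Longrightarrow> f 0 = x \<Longrightarrow> \<zeta> *s disc_deriv f 0 = v \<Longrightarrow> c \<le> norm \<zeta>"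
  shows "c \<le> kobayashi_metric D x v"
  unfolding kobayashi_metric_eq
  by (rule cInf_greatest[OF kobayashi_metric_competitors_nonempty[OF assms(1,2)]]) (use assms(3) in auto)

lemma kobayashi_metric_nonneg: "open D \<Longrightarrow> x \<in> D \<Longrightarrow> 0 \<le> kobayashi_metric D x v"
  by (rule kobayashi_metric_ge) auto

lemma kobayashi_metric_mono:
  assumes "open D" "D \<subseteq> D'" "x \<in> D"
  shows "kobayashi_metric D' x v \<le> kobayashi_metric D x v"
proof (rule kobayashi_metric_ge[OF assms(1,3)])
  fix f \<zeta> assume "holomorphic_disc D f" "f 0 = x" "\<zeta> *s disc_deriv f 0 = v"
  then show "kobayashi_metric D' x v \<le> norm \<zeta>"
    using assms(2) by (intro kobayashi_metric_le[of D' f]) (auto simp: holomorphic_disc_def)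
qed

lemma kobayashi_metric_scale_le:
  assumes "open D" "x \<in> D"
  shows "kobayashi_metric D x (c *\<^sub>R v) \<le> \<bar>c\<bar> * kobayashi_metric D x v"
proof (cases "c = 0")
  case True
  obtain f where "holomorphic_disc D f" "f 0 = x"
    using kobayashi_metric_competitors_nonempty[OF assms, of 0] by blast
  then have "kobayashi_metric D x 0 \<le> norm (0::complex)" by (rule kobayashi_metric_le) auto
  then show ?thesis using True by simp
next
  case False
  have "kobayashi_metric D x (c *\<^sub>R v) / \<bar>c\<bar> \<le> kobayashi_metric D x v"
  proof (rule kobayashi_metric_ge[OF assms])
    fix f \<zeta> assume f: "holomorphic_disc D f" "f 0 = x" "\<zeta> *s disc_deriv f 0 = v"
    have "(of_real c * \<zeta>) *s disc_deriv f 0 = c *\<^sub>R v"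
      using f(3) by (simp add: of_real_vector_scalar_mult flip: vector_smult_assoc)
    then have "kobayashi_metric D x (c *\<^sub>R v) \<le> norm (of_real c * \<zeta>)"
      by (rule kobayashi_metric_le[OF f(1,2)])
    then show "kobayashi_metric D x (c *\<^sub>R v) / \<bar>c\<bar> \<le> norm \<zeta>"
      using False by (simp add: norm_mult field_simps)
  qed
  then show ?thesis using False by (simp add: field_simps)
qed

text \<open>The automorphism of the disc that carries 0 to \<open>a\<close>, which is
  \<open>Moebius_function 0 (- a)\<close>; precomposition with it moves the centre of a disc from
  \<open>f 0\<close> to \<open>f a\<close>.\<close>

definition disc_moebius :: "complex \<Rightarrow> complex \<Rightarrow> complex" where
  "disc_moebius a z = (z + a) / (1 + cnj a * z)"

lemma disc_moebius:
  assumes "norm a < 1"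
  shows "disc_moebius a holomorphic_on ball 0 1" "disc_moebius a ` ball 0 1 \<subseteq> ball 0 1"
    "disc_moebius a 0 = a" "deriv (disc_moebius a) 0 = of_real (1 - (norm a)\<^sup>2)"
proof -
  have nz: "1 + cnj a * z \<noteq> 0" if "norm z < 1" for z
  proof
    assume "1 + cnj a * z = 0"
    then have "cnj a * z = -1" by (simp add: add_eq_0_iff)
    then have "norm (cnj a * z) = 1" by simp
    then have "norm a * norm z = 1" by (simp add: norm_mult)
    moreover have "norm a * norm z < 1"
      using assms that mult_strict_mono'[of "norm a" 1 "norm z" 1] by simp
    ultimately show False by simp
  qed
  show "disc_moebius a holomorphic_on ball 0 1"
    unfolding disc_moebius_def using nz by (intro holomorphic_intros) auto
  show "disc_moebius a ` ball 0 1 \<subseteq> ball 0 1"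
    using Moebius_function_norm_lt_1[of "- a" _ 0] assms
    by (auto simp: disc_moebius_def Moebius_function_def)
  show "disc_moebius a 0 = a" by (simp add: disc_moebius_def)
  have "(disc_moebius a has_field_derivative 1 - a * cnj a) (at 0)"
    unfolding disc_moebius_def using nz[of 0] by (auto intro!: derivative_eq_intros)
  then show "deriv (disc_moebius a) 0 = of_real (1 - (norm a)\<^sup>2)"
    by (simp add: DERIV_imp_deriv complex_norm_square del: of_real_power)
qed

text \<open>Discs do not increase lengths measured in the Poincare metric
  \<open>norm w / (1 - (norm a)\<^sup>2)\<close>: moving the centre to \<open>a\<close> multiplies
  the derivative by \<open>1 - (norm a)\<^sup>2\<close>.\<close>

lemma kobayashi_metric_disc_le:
  assumes f: "holomorphic_disc D f" and a: "norm a < 1"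
  shows "kobayashi_metric D (f a) (w *s disc_deriv f a) \<le> norm w / (1 - (norm a)\<^sup>2)"
proof -
  note M = disc_moebius[OF a]
  note C = holomorphic_disc_compose[OF f M(1,2)]
  have pos: "1 - (norm a)\<^sup>2 > 0" using a by (simp add: power_less_one_iff abs_square_less_1)
  have "disc_deriv (f \<circ> disc_moebius a) 0 = of_real (1 - (norm a)\<^sup>2) *s disc_deriv f a"
    using C(2)[of 0] M(3,4) by simp
  then have "(w / of_real (1 - (norm a)\<^sup>2)) *s disc_deriv (f \<circ> disc_moebius a) 0 = w *s disc_deriv f a"
    using pos by (simp add: of_real_power[symmetric] del: of_real_power of_real_diff)
  then have "kobayashi_metric D (f a) (w *s disc_deriv f a) \<le> norm (w / of_real (1 - (norm a)\<^sup>2))"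
    using M(3) by (intro kobayashi_metric_le[OF C(1)]) auto
  also have "\<dots> = norm w / (1 - (norm a)\<^sup>2)"
    using pos by (simp only: norm_divide norm_of_real)
  finally show ?thesis .
qed

lemma kobayashi_metric_le_ball:
  assumes "r > 0" "ball z r \<subseteq> D"
  shows "kobayashi_metric D z v \<le> norm v / r"
proof (cases "v = 0")
  case False
  define u where "u = (r / norm v) *\<^sub>R v"
  have "norm u = r" using False assms by (simp add: u_def)
  then have "z + w *s u \<in> D" if "norm w < 1" for w
    using assms that by (intro subsetD[OF assms(2)]) (simp add: dist_norm norm_vector_scalar_mult_complex)
  note h = holomorphic_disc_affine[of z u D, OF this]
  have "of_real (norm v / r) *s u = v" using False assms
    by (simp only: of_real_vector_scalar_mult u_def) simp
  then have "kobayashi_metric D z v \<le> norm (complex_of_real (norm v / r))"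
    by (intro kobayashi_metric_le[OF h(1)]) (simp_all add: h(2))
  then show ?thesis using assms by (simp only: norm_of_real) simp
next
  case True
  have "z \<in> D" using assms by (simp add: subset_iff)
  then have h: "holomorphic_disc D (\<lambda>w. z + w *s 0)"
    by (intro holomorphic_disc_affine(1)) simp
  have "kobayashi_metric D z v \<le> norm (0::complex)"
    by (rule kobayashi_metric_le[OF h]) (use True in auto)
  then show ?thesis using assms True by simp
qed

lemma holomorphic_hprod:
  assumes "holomorphic_disc D f"
  shows "(\<lambda>z. hprod (f z - p) w) holomorphic_on ball 0 1"
    and "deriv (\<lambda>z. hprod (f z - p) w) 0 = hprod (disc_deriv f 0) w"
proof -
  have h: "(\<lambda>z. f z $ i) holomorphic_on ball 0 1" for i using assms by (simp add: holomorphic_disc_def)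
  show "(\<lambda>z. hprod (f z - p) w) holomorphic_on ball 0 1"
    unfolding hprod_def using h by (auto intro!: holomorphic_intros)
  have "((\<lambda>z. f z $ i) has_field_derivative disc_deriv f 0 $ i) (at 0)" for i
    using h[of i] by (auto simp: disc_deriv_def intro!: holomorphic_derivI)
  then have "((\<lambda>z. hprod (f z - p) w) has_field_derivative (\<Sum>i\<in>UNIV. disc_deriv f 0 $ i * cnj (w $ i))) (at 0)"
    unfolding hprod_def by (auto intro!: derivative_eq_intros)
  then show "deriv (\<lambda>z. hprod (f z - p) w) 0 = hprod (disc_deriv f 0) w"
    by (simp add: DERIV_imp_deriv hprod_def)
qed

section \<open>Lower bounds from the Schwarz lemma\<close>

lemma half_plane_deriv_le:
  assumes g: "g holomorphic_on ball 0 1" and neg: "\<And>z. norm z < 1 \<Longrightarrow> Re (g z) < 0"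
  shows "norm (deriv g 0) \<le> 2 * - Re (g 0)"
proof -
  \<comment> \<open>\<open>h\<close> is \<open>g\<close> followed by the Cayley transform of the
    left half-plane that sends \<open>g 0\<close> to 0.\<close>
  define h where "h z = (g z - g 0) / (g z + cnj (g 0))" for z
  have nz: "g z + cnj (g 0) \<noteq> 0" if "norm z < 1" for z
    using neg[OF that] neg[of 0] by (auto simp: complex_eq_iff)
  have hol: "h holomorphic_on ball 0 1"
    unfolding h_def using g nz by (intro holomorphic_intros) auto
  have lt: "norm (h z) < 1" if "norm z < 1" for z
  proof -
    have "(norm (g z + cnj (g 0)))\<^sup>2 - (norm (g z - g 0))\<^sup>2 = 4 * Re (g z) * Re (g 0)"
      unfolding cmod_power2 by (simp add: power2_eq_square algebra_simps)
    moreover have "Re (g z) * Re (g 0) > 0"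
      using neg[OF that] neg[of 0] by (simp add: mult_neg_neg)
    ultimately have "(norm (g z - g 0))\<^sup>2 < (norm (g z + cnj (g 0)))\<^sup>2" by simp
    then have "norm (g z - g 0) < norm (g z + cnj (g 0))" by (rule power2_less_imp_less) simp
    then show ?thesis using nz[OF that] by (simp add: h_def norm_divide)
  qed
  have s: "norm (deriv h 0) \<le> 1"
    by (rule Schwarz_Lemma(2)[OF hol _ lt, of 0]) (simp_all add: h_def)
  have "(h has_field_derivative deriv g 0 / (g 0 + cnj (g 0))) (at 0)"
  proof -
    have d: "(g has_field_derivative deriv g 0) (at 0)" by (rule holomorphic_derivI[OF g]) auto
    have "((\<lambda>z. (g z - g 0) / (g z + cnj (g 0))) has_field_derivative
        ((deriv g 0 - 0) * (g 0 + cnj (g 0)) - (g 0 - g 0) * (deriv g 0 + 0)) /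
        ((g 0 + cnj (g 0)) * (g 0 + cnj (g 0)))) (at 0)"
      using nz[of 0] by (intro DERIV_divide DERIV_diff DERIV_add d DERIV_const) simp
    then show ?thesis unfolding h_def using nz[of 0] by simp
  qed
  then have e: "deriv h 0 = deriv g 0 / (g 0 + cnj (g 0))" by (rule DERIV_imp_deriv)
  have n: "norm (g 0 + cnj (g 0)) = 2 * - Re (g 0)"
    using neg[of 0] by (simp add: complex_add_cnj norm_mult)
  have "2 * - Re (g 0) > 0" using neg[of 0] by simp
  moreover have "norm (deriv g 0) / (2 * - Re (g 0)) \<le> 1"
    using s unfolding e norm_divide n .
  ultimately show ?thesis by (metis divide_le_eq_1_pos)
qed

text \<open>Composing a disc with \<open>hprod (_ - p) \<nu>\<close> gives a map into the left
  half-plane. The whole complex component of \<open>v\<close> along \<open>\<nu>\<close> is bounded,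
  not only its real part, which permits rotating \<open>v\<close> within its complex line.\<close>

lemma half_space_kobayashi_metric:
  assumes "open D" "z \<in> D" and neg: "\<And>w. w \<in> D \<Longrightarrow> (w - p) \<bullet> \<nu> < 0"
  shows "norm (hprod v \<nu>) \<le> 2 * ((p - z) \<bullet> \<nu>) * kobayashi_metric D z v"
proof -
  have l: "(p - z) \<bullet> \<nu> > 0" using neg[OF assms(2)] by (simp add: inner_diff_left)
  have "norm (hprod v \<nu>) / (2 * ((p - z) \<bullet> \<nu>)) \<le> kobayashi_metric D z v"
  proof (rule kobayashi_metric_ge[OF assms(1,2)])
    fix f \<zeta> assume f: "holomorphic_disc D f" "f 0 = z" "\<zeta> *s disc_deriv f 0 = v"
    note H = holomorphic_hprod[OF f(1), of p \<nu>]
    have "norm (deriv (\<lambda>z. hprod (f z - p) \<nu>) 0) \<le> 2 * - Re (hprod (f 0 - p) \<nu>)"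
    proof (rule half_plane_deriv_le[OF H(1)])
      fix y :: complex assume "norm y < 1"
      then show "Re (hprod (f y - p) \<nu>) < 0"
        using f(1) neg by (auto simp: Re_hprod holomorphic_disc_def image_subset_iff)
    qed
    then have "norm (hprod (disc_deriv f 0) \<nu>) \<le> 2 * ((p - z) \<bullet> \<nu>)"
      unfolding H(2) Re_hprod by (simp add: f(2) inner_diff_left)
    then have "norm \<zeta> * norm (hprod (disc_deriv f 0) \<nu>) \<le> norm \<zeta> * (2 * ((p - z) \<bullet> \<nu>))"
      by (rule mult_left_mono) simp
    then show "norm (hprod v \<nu>) / (2 * ((p - z) \<bullet> \<nu>)) \<le> norm \<zeta>"
      using l by (simp add: divide_le_eq norm_mult hprod_smult flip: f(3))
  qed
  then show ?thesis using l by (simp add: divide_le_eq mult.commute)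
qed

text \<open>The Schwarz lemma is applied to the component of a disc along \<open>v\<close>, divided
  by \<open>M * norm v\<close>; it maps into the unit disc because \<open>D\<close> lies in
  \<open>ball z M\<close>.\<close>

lemma kobayashi_metric_ge_norm:
  assumes "open D" "z \<in> D" "D \<subseteq> ball z M"
  shows "norm v \<le> M * kobayashi_metric D z v"
proof -
  have M: "M > 0" using assms(2,3) by (auto simp: subset_iff intro: le_less_trans[OF zero_le_dist])
  show ?thesis
  proof (cases "v = 0")
    case True
    then show ?thesis using kobayashi_metric_nonneg[OF assms(1,2), of v] M by simp
  next
    case False
    have "norm v / M \<le> kobayashi_metric D z v"
    proof (rule kobayashi_metric_ge[OF assms(1,2)])
      fix f \<zeta> assume f: "holomorphic_disc D f" "f 0 = z" "\<zeta> *s disc_deriv f 0 = v"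
      note H = holomorphic_hprod[OF f(1), of z v]
      define c where "c = complex_of_real (M * norm v)"
      have c: "norm c = M * norm v" "c \<noteq> 0" using M False by (simp_all add: c_def norm_mult)
      define h where "h y = hprod (f y - z) v / c" for y
      have "norm (deriv h 0) \<le> 1"
      proof (rule Schwarz_Lemma(2)[of h 0])
        show "h holomorphic_on ball 0 1" unfolding h_def using H(1) c by (intro holomorphic_intros) auto
        show "h 0 = 0" by (simp add: h_def f(2) hprod_def)
        fix y :: complex assume y: "norm y < 1"
        then have "norm (f y - z) < M"
          using f(1) assms(3) by (auto simp: holomorphic_disc_def image_subset_iff subset_iff dist_norm norm_minus_commute[of z])
        then have "norm (hprod (f y - z) v) < M * norm v"
          using norm_hprod_le[of "f y - z" v] False
          by (meson le_less_trans mult_strict_right_mono zero_less_norm_iff)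
        then show "norm (h y) < 1" using c M False by (simp add: h_def norm_divide)
      qed simp
      moreover have "deriv h 0 = hprod (disc_deriv f 0) v / c"
        unfolding h_def H(2)[symmetric]
        using H(1) by (intro deriv_cdivide_right holomorphic_on_imp_differentiable_at[of _ "ball 0 1"]) auto
      ultimately have "norm (hprod (disc_deriv f 0) v) \<le> M * norm v"
        using c M False by (simp add: norm_divide divide_le_eq)
      then have "norm \<zeta> * norm (hprod (disc_deriv f 0) v) \<le> norm \<zeta> * (M * norm v)"
        by (rule mult_left_mono) simp
      then have "norm (hprod v v) \<le> norm \<zeta> * (M * norm v)"
        by (metis f(3) hprod_smult norm_mult)
      then have "norm v * norm v \<le> (norm \<zeta> * M) * norm v"
        by (simp add: hprod_self power2_eq_square norm_mult mult.assoc)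
      then show "norm v / M \<le> norm \<zeta>" using M False by (simp add: divide_le_eq)
    qed
    then show ?thesis using M by (simp add: divide_le_eq mult.commute)
  qed
qed

lemma open_half_space_strict:
  fixes D :: "'a::real_inner set"
  assumes D: "open D" "w \<in> D" and \<nu>: "norm \<nu> = 1" "\<And>w. w \<in> D \<Longrightarrow> (w - q) \<bullet> \<nu> \<le> 0"
  shows "(w - q) \<bullet> \<nu> < 0"
proof -
  obtain e where e: "e > 0" "cball w e \<subseteq> D" using D by (auto simp: open_contains_cball)
  then have "w + e *\<^sub>R \<nu> \<in> D" using \<nu>(1) by (auto simp: subset_iff dist_norm)
  from \<nu>(2)[OF this] have "(w - q) \<bullet> \<nu> + e \<le> 0"
    using \<nu>(1) by (simp add: inner_diff_left inner_add_left norm_eq_1)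
  then show ?thesis using e by simp
qed

lemma convex_open_support:
  fixes D :: "'a::euclidean_space set"
  assumes "convex D" "open D" "q \<notin> D" "D \<noteq> {}"
  obtains \<nu> where "norm \<nu> = 1" "\<And>w. w \<in> D \<Longrightarrow> (w - q) \<bullet> \<nu> < 0"
proof -
  obtain a b where a: "a \<noteq> 0" "a \<bullet> q \<le> b" "\<And>x. x \<in> D \<Longrightarrow> a \<bullet> x \<ge> b"
    using separating_hyperplane_set_point_inaff[OF assms(1,4,3)] by metis
  define \<nu> where "\<nu> = - (a /\<^sub>R norm a)"
  have n: "norm \<nu> = 1" using a by (simp add: \<nu>_def)
  have le: "(w - q) \<bullet> \<nu> \<le> 0" if "w \<in> D" for w
    using a(2) a(3)[OF that] a(1) by (simp add: \<nu>_def inner_diff_left inner_diff_right inner_commute field_simps)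
  have "(w - q) \<bullet> \<nu> < 0" if "w \<in> D" for w
    by (rule open_half_space_strict[OF assms(2) that n]) (rule le)
  then show ?thesis using that n by blast
qed

text \<open>At a boundary point \<open>q\<close> on the complex line through \<open>z\<close> in direction \<open>v\<close>, comparison with a
  supporting half-space bounds the metric in terms of \<open>dist z q\<close>, whatever the normal is.\<close>

lemma kobayashi_metric_ge_complex_line:
  assumes D: "open D" "convex D" "z \<in> D" and q: "q \<notin> D" "q = z + c *s v"
  shows "norm v \<le> 2 * dist z q * kobayashi_metric D z v"
proof -
  have "D \<noteq> {}" using D(3) by blast
  then obtain \<nu> where \<nu>: "norm \<nu> = 1" "\<And>w. w \<in> D \<Longrightarrow> (w - q) \<bullet> \<nu> < 0"
    using convex_open_support[OF D(2,1) q(1)] by metis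
  let ?K = "kobayashi_metric D z v"
  have K: "?K \<ge> 0" by (rule kobayashi_metric_nonneg[OF D(1,3)])
  have h: "norm (hprod v \<nu>) \<le> 2 * ((q - z) \<bullet> \<nu>) * ?K"
    by (rule half_space_kobayashi_metric[OF D(1,3)]) (rule \<nu>(2))
  have pos: "(q - z) \<bullet> \<nu> > 0" using \<nu>(2)[OF D(3)] by (simp add: inner_diff_left)
  have eq: "(q - z) \<bullet> \<nu> = Re (c * hprod v \<nu>)" by (simp add: q(2) Re_hprod flip: hprod_smult)
  then have le: "(q - z) \<bullet> \<nu> \<le> norm c * norm (hprod v \<nu>)"
    using complex_Re_le_cmod[of "c * hprod v \<nu>"] by (simp add: norm_mult)
  have hp: "norm (hprod v \<nu>) > 0" using pos eq by auto
  have "norm (hprod v \<nu>) \<le> 2 * (norm c * norm (hprod v \<nu>)) * ?K"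
    using h mult_right_mono[OF le K] by linarith
  \<comment> \<open>The factor \<open>norm (hprod v \<nu>)\<close> stands on both sides and cancels,
    so the angle between \<open>v\<close> and \<open>\<nu>\<close> leaves no trace.\<close>
  then have "1 \<le> 2 * norm c * ?K" using hp by (simp add: field_simps)
  then have "norm v * 1 \<le> norm v * (2 * norm c * ?K)" by (rule mult_left_mono) simp
  then show ?thesis by (simp add: q(2) dist_norm norm_vector_scalar_mult_complex mult_ac)
qed

section \<open>Curves and the Kobayashi distance\<close>

text \<open>The derivative, its exceptional set and the parameter interval are explicit, so that
  arcs can be restricted, joined and reparametrized without recomputing
  \<open>vector_derivative\<close>. No derivative is required at the end points.\<close>

definition pw_curve :: "'a::real_normed_vector set \<Rightarrow> (real \<Rightarrow> 'a) \<Rightarrow> (real \<Rightarrow> 'a) \<Rightarrow> real set \<Rightarrow> real \<Rightarrow> real \<Rightarrow> bool" where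
  "pw_curve D \<gamma> \<gamma>' S a b \<longleftrightarrow> a \<le> b \<and> finite S \<and> continuous_on {a..b} \<gamma> \<and> \<gamma> ` {a..b} \<subseteq> D \<and>
     (\<forall>t\<in>{a<..<b} - S. (\<gamma> has_vector_derivative \<gamma>' t) (at t)) \<and> continuous_on ({a<..<b} - S) \<gamma>'"

definition klen :: "(complex ^ 'n) set \<Rightarrow> (real \<Rightarrow> complex ^ 'n) \<Rightarrow> (real \<Rightarrow> complex ^ 'n) \<Rightarrow> real \<Rightarrow> real \<Rightarrow> ennreal" where
  "klen D \<gamma> \<gamma>' a b = (\<integral>\<^sup>+t\<in>{a..b}. ennreal (kobayashi_metric D (\<gamma> t) (\<gamma>' t)) \<partial>lborel)"

text \<open>The infimum before \<open>enn2real\<close>: in \<open>ennreal\<close> an infinite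
  distance is not confused with 0, and the triangle inequality needs no finiteness.\<close>

definition kdist :: "(complex ^ 'n) set \<Rightarrow> complex ^ 'n \<Rightarrow> complex ^ 'n \<Rightarrow> ennreal" where
  "kdist D x y = (INF \<gamma> \<in> {\<gamma>. valid_path \<gamma> \<and> path_image \<gamma> \<subseteq> D \<and> pathstart \<gamma> = x \<and> pathfinish \<gamma> = y}.
     kobayashi_length D \<gamma>)"

lemma pw_curve_mem: "pw_curve D \<gamma> \<gamma>' S a b \<Longrightarrow> a \<le> t \<Longrightarrow> t \<le> b \<Longrightarrow> \<gamma> t \<in> D"
  by (auto simp: pw_curve_def)

lemma pw_curve_subinterval:
  assumes "pw_curve D \<gamma> \<gamma>' S a b" "a \<le> c" "c \<le> d" "d \<le> b"
  shows "pw_curve D \<gamma> \<gamma>' S c d"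
  using assms unfolding pw_curve_def
  by (auto intro: continuous_on_subset)

lemma pw_curve_subset:
  assumes "pw_curve D \<gamma> \<gamma>' S a b" "\<And>t. a \<le> t \<Longrightarrow> t \<le> b \<Longrightarrow> \<gamma> t \<in> D'"
  shows "pw_curve D' \<gamma> \<gamma>' S a b"
  using assms unfolding pw_curve_def by auto

lemma pw_curve_affine:
  assumes \<gamma>: "pw_curve D \<gamma> \<gamma>' S a b" and c: "c \<noteq> 0" and ab': "a' \<le> b'"
    and cl: "\<And>t. t \<in> {a'..b'} \<longleftrightarrow> s + c * t \<in> {a..b}"
    and op: "\<And>t. t \<in> {a'<..<b'} \<longleftrightarrow> s + c * t \<in> {a<..<b}"
  shows "pw_curve D (\<lambda>t. \<gamma> (s + c * t)) (\<lambda>t. c *\<^sub>R \<gamma>' (s + c * t)) ((\<lambda>u. (u - s) / c) ` S) a' b'"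
  unfolding pw_curve_def
proof (intro conjI ballI)
  let ?S = "(\<lambda>u. (u - s) / c) ` S"
  have S: "s + c * t \<notin> S" if "t \<notin> ?S" for t
  proof
    assume "s + c * t \<in> S"
    then have "(s + c * t - s) / c \<in> ?S" by (rule imageI)
    then show False using that c by simp
  qed
  show "a' \<le> b'" "finite ?S" using assms by (auto simp: pw_curve_def)
  have cg: "continuous_on {a..b} \<gamma>" and cg': "continuous_on ({a<..<b} - S) \<gamma>'"
    using \<gamma> by (auto simp: pw_curve_def)
  show "continuous_on {a'..b'} (\<lambda>t. \<gamma> (s + c * t))"
    by (rule continuous_on_compose2[OF cg]) (use cl in \<open>auto intro!: continuous_intros\<close>)
  show "(\<lambda>t. \<gamma> (s + c * t)) ` {a'..b'} \<subseteq> D"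
    using \<gamma> cl unfolding pw_curve_def by blast
  have "continuous_on ({a'<..<b'} - ?S) (\<lambda>t. \<gamma>' (s + c * t))"
    by (rule continuous_on_compose2[OF cg']) (use op S in \<open>auto intro!: continuous_intros\<close>)
  then show "continuous_on ({a'<..<b'} - ?S) (\<lambda>t. c *\<^sub>R \<gamma>' (s + c * t))"
    by (intro continuous_intros)
  fix t assume t: "t \<in> {a'<..<b'} - ?S"
  have "(\<gamma> has_vector_derivative \<gamma>' (s + c * t)) (at (s + c * t))"
    using \<gamma> t op S unfolding pw_curve_def by blast
  moreover have "((\<lambda>t. s + c * t) has_vector_derivative c) (at t)"
    by (auto intro!: derivative_eq_intros)
  ultimately have "((\<gamma> \<circ> (\<lambda>t. s + c * t)) has_vector_derivative (c *\<^sub>R \<gamma>' (s + c * t))) (at t)"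
    by (intro vector_diff_chain_at)
  then show "((\<lambda>t. \<gamma> (s + c * t)) has_vector_derivative c *\<^sub>R \<gamma>' (s + c * t)) (at t)"
    by (simp add: o_def)
qed

lemma klen_affine_le:
  assumes D: "open D" and \<gamma>: "pw_curve D \<gamma> \<gamma>' S a b" and c: "c \<noteq> 0"
    and cl: "\<And>t. t \<in> {a'..b'} \<longleftrightarrow> s + c * t \<in> {a..b}"
  shows "klen D (\<lambda>t. \<gamma> (s + c * t)) (\<lambda>t. c *\<^sub>R \<gamma>' (s + c * t)) a' b' \<le> klen D \<gamma> \<gamma>' a b"
proof -
  let ?f = "\<lambda>t. ennreal (kobayashi_metric D (\<gamma> t) (\<gamma>' t)) * indicator {a..b} t"
  have "klen D (\<lambda>t. \<gamma> (s + c * t)) (\<lambda>t. c *\<^sub>R \<gamma>' (s + c * t)) a' b' \<le>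
      (\<integral>\<^sup>+t. ennreal \<bar>c\<bar> * ?f (s + c * t) \<partial>lborel)"
    unfolding klen_def
  proof (rule nn_integral_mono)
    fix t
    show "ennreal (kobayashi_metric D (\<gamma> (s + c * t)) (c *\<^sub>R \<gamma>' (s + c * t))) * indicator {a'..b'} t
      \<le> ennreal \<bar>c\<bar> * ?f (s + c * t)"
    proof (cases "t \<in> {a'..b'}")
      case True
      then have st: "s + c * t \<in> {a..b}" using cl by blast
      then have "\<gamma> (s + c * t) \<in> D" using \<gamma> by (auto simp: pw_curve_def)
      then show ?thesis using st True
        by (simp add: ennreal_mult[symmetric] kobayashi_metric_scale_le[OF D] kobayashi_metric_nonneg[OF D] ennreal_leI
            del: atLeastAtMost_iff)
    qed simp
  qed
  also have "\<dots> \<le> ennreal \<bar>c\<bar> * (\<integral>\<^sup>+t. ?f (s + c * t) \<partial>lborel)"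
    by (rule nn_integral_cmult_le_nonmeasurable) (use c in auto)
  also have "\<dots> = klen D \<gamma> \<gamma>' a b"
    unfolding klen_def by (rule nn_integral_real_affine_nonmeasurable[OF c, symmetric])
  finally show ?thesis .
qed

lemma klen_split:
  "a \<le> b \<Longrightarrow> b \<le> c \<Longrightarrow> klen D \<gamma> \<gamma>' a c = klen D \<gamma> \<gamma>' a b + klen D \<gamma> \<gamma>' b c"
  unfolding klen_def by (rule set_nn_integral_Icc_split)

lemma klen_mono_interval:
  "a \<le> c \<Longrightarrow> d \<le> b \<Longrightarrow> klen D \<gamma> \<gamma>' c d \<le> klen D \<gamma> \<gamma>' a b"
  unfolding klen_def by (intro nn_integral_mono) (auto split: split_indicator)

lemma pw_curve_join:
  assumes 1: "pw_curve D \<gamma>1 \<gamma>1' S1 a b" and 2: "pw_curve D \<gamma>2 \<gamma>2' S2 b c" and eq: "\<gamma>1 b = \<gamma>2 b"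
  defines "\<gamma> \<equiv> \<lambda>t. if t \<le> b then \<gamma>1 t else \<gamma>2 t" and "\<gamma>' \<equiv> \<lambda>t. if t \<le> b then \<gamma>1' t else \<gamma>2' t"
  shows "pw_curve D \<gamma> \<gamma>' (insert b (S1 \<union> S2)) a c"
    and "klen E \<gamma> \<gamma>' a c = klen E \<gamma>1 \<gamma>1' a b + klen E \<gamma>2 \<gamma>2' b c"
proof -
  let ?S = "insert b (S1 \<union> S2)"
  have ab: "a \<le> b" "b \<le> c" using 1 2 by (auto simp: pw_curve_def)
  have U: "{a..c} = {a..b} \<union> {b..c}" using ab by auto
  have "continuous_on ({a..b} \<union> {b..c}) \<gamma>"
    unfolding \<gamma>_def
    by (rule continuous_on_If) (use 1 2 eq in \<open>auto simp: pw_curve_def\<close>)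
  moreover have "\<gamma> ` {a..c} \<subseteq> D"
    using 1 2 unfolding U by (auto simp: pw_curve_def \<gamma>_def)
  moreover have "(\<gamma> has_vector_derivative \<gamma>' t) (at t)" if t: "t \<in> {a<..<c} - ?S" for t
  proof (cases "t < b")
    case True
    then have "(\<gamma>1 has_vector_derivative \<gamma>1' t) (at t)" using 1 t by (auto simp: pw_curve_def)
    then have "(\<gamma> has_vector_derivative \<gamma>1' t) (at t)"
      by (rule has_vector_derivative_transform_within_open[of _ _ _ "{..<b}"]) (use True in \<open>auto simp: \<gamma>_def\<close>)
    then show ?thesis using True by (simp add: \<gamma>'_def)
  next
    case False
    then have gt: "b < t" using t by auto
    then have "(\<gamma>2 has_vector_derivative \<gamma>2' t) (at t)" using 2 t by (auto simp: pw_curve_def)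
    then have "(\<gamma> has_vector_derivative \<gamma>2' t) (at t)"
      by (rule has_vector_derivative_transform_within_open[of _ _ _ "{b<..}"]) (use gt in \<open>auto simp: \<gamma>_def\<close>)
    then show ?thesis using gt by (simp add: \<gamma>'_def)
  qed
  moreover have "continuous_on ({a<..<c} - ?S) \<gamma>'"
  proof -
    have e: "{a<..<c} - ?S = ({a<..<b} - ?S) \<union> ({b<..<c} - ?S)" using ab by auto
    have fin: "finite ?S" using 1 2 by (auto simp: pw_curve_def)
    have "continuous_on ({a<..<b} - ?S) \<gamma>1'" "continuous_on ({b<..<c} - ?S) \<gamma>2'"
      using 1 2 unfolding pw_curve_def by (auto intro: continuous_on_subset)
    note c12 = this
    have "continuous_on ({a<..<b} - ?S) \<gamma>'"
      by (rule continuous_on_eq[OF c12(1)]) (simp add: \<gamma>'_def)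
    moreover have "continuous_on ({b<..<c} - ?S) \<gamma>'"
      by (rule continuous_on_eq[OF c12(2)]) (simp add: \<gamma>'_def)
    ultimately show ?thesis unfolding e
      using fin by (intro continuous_on_open_Un open_Diff finite_imp_closed) auto
  qed
  ultimately show "pw_curve D \<gamma> \<gamma>' ?S a c"
    using 1 2 ab unfolding U[symmetric] by (auto simp: pw_curve_def)
  have "klen E \<gamma> \<gamma>' a b = klen E \<gamma>1 \<gamma>1' a b"
    unfolding klen_def \<gamma>_def \<gamma>'_def by (rule nn_integral_cong) (auto split: split_indicator)
  moreover have "klen E \<gamma> \<gamma>' b c = klen E \<gamma>2 \<gamma>2' b c"
    unfolding klen_def \<gamma>_def \<gamma>'_def
    by (rule nn_integral_cong_off_finite[of "{b}"]) (auto split: split_indicator)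
  ultimately show "klen E \<gamma> \<gamma>' a c = klen E \<gamma>1 \<gamma>1' a b + klen E \<gamma>2 \<gamma>2' b c"
    using klen_split[OF ab] by metis
qed

lemma kdist_le_klen_01:
  assumes \<gamma>: "pw_curve D \<gamma> \<gamma>' S 0 1"
  shows "kdist D (\<gamma> 0) (\<gamma> 1) \<le> klen D \<gamma> \<gamma>' 0 1"
proof -
  \<comment> \<open>The end points become exceptional, since \<open>valid_path\<close> works on the
    closed interval and \<open>pw_curve\<close> gives derivatives inside only.\<close>
  let ?T = "insert 0 (insert 1 S)"
  have sub: "{0..1} - ?T = {0<..<1} - S" by auto
  have d: "(\<gamma> has_vector_derivative \<gamma>' t) (at t)" if "t \<in> {0..1} - ?T" for t
    using \<gamma> that unfolding sub pw_curve_def by blast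
  have "continuous_on ({0..1} - ?T) \<gamma>'" using \<gamma> unfolding sub pw_curve_def by blast
  then have "\<gamma> C1_differentiable_on ({0..1} - ?T)"
    unfolding C1_differentiable_on_def using d by blast
  moreover have "finite ?T" "continuous_on {0..1} \<gamma>" using \<gamma> by (auto simp: pw_curve_def)
  ultimately have "valid_path \<gamma>"
    unfolding valid_path_def piecewise_C1_differentiable_on_def by blast
  then have "kdist D (\<gamma> 0) (\<gamma> 1) \<le> kobayashi_length D \<gamma>"
    unfolding kdist_def using \<gamma>
    by (intro INF_lower) (auto simp: path_image_def pathstart_def pathfinish_def pw_curve_def)
  also have "\<dots> = klen D \<gamma> \<gamma>' 0 1"
    unfolding kobayashi_length_def klen_def
  proof (rule nn_integral_cong_off_finite[OF \<open>finite ?T\<close>])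
    fix t assume "t \<notin> ?T"
    then show "ennreal (kobayashi_metric D (\<gamma> t) (vector_derivative \<gamma> (at t))) * indicator {0..1} t =
        ennreal (kobayashi_metric D (\<gamma> t) (\<gamma>' t)) * indicator {0..1} t"
      using vector_derivative_at[OF d[of t]] by (auto split: split_indicator)
  qed
  finally show ?thesis .
qed

lemma kdist_self:
  assumes "open D" "x \<in> D"
  shows "kdist D x x = 0"
proof -
  have "pw_curve D (\<lambda>_. x) (\<lambda>_. 0) {} 0 1"
    using assms by (auto simp: pw_curve_def intro!: derivative_eq_intros)
  then have "kdist D x x \<le> klen D (\<lambda>_. x) (\<lambda>_. 0) 0 1" by (rule kdist_le_klen_01)
  also have "\<dots> = 0"
    using kobayashi_metric_scale_le[OF assms, of 0 0] kobayashi_metric_nonneg[OF assms, of 0]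
    by (simp add: klen_def)
  finally show ?thesis by simp
qed

lemma kdist_le_klen:
  assumes D: "open D" and \<gamma>: "pw_curve D \<gamma> \<gamma>' S a b"
  shows "kdist D (\<gamma> a) (\<gamma> b) \<le> klen D \<gamma> \<gamma>' a b"
proof (cases "a = b")
  case True
  then show ?thesis using kdist_self[OF D, of "\<gamma> a"] pw_curve_mem[OF \<gamma>, of a] by simp
next
  case False
  then have ab: "a < b" using \<gamma> by (simp add: pw_curve_def)
  then have cl: "t \<in> {0..1} \<longleftrightarrow> a + (b - a) * t \<in> {a..b}" and op: "t \<in> {0<..<1} \<longleftrightarrow> a + (b - a) * t \<in> {a<..<b}" for t
  proof -
    have "(b - a) * t \<le> b - a \<longleftrightarrow> t \<le> 1" "(b - a) * t < b - a \<longleftrightarrow> t < 1"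
      using mult_le_cancel_left_pos[of "b - a" t 1] mult_less_cancel_left_pos[of "b - a" t 1] ab by auto
    moreover have "0 \<le> (b - a) * t \<longleftrightarrow> 0 \<le> t" "0 < (b - a) * t \<longleftrightarrow> 0 < t"
      using ab by (auto simp: zero_le_mult_iff zero_less_mult_iff)
    moreover have "a + (b - a) * t \<le> b \<longleftrightarrow> (b - a) * t \<le> b - a" "a + (b - a) * t < b \<longleftrightarrow> (b - a) * t < b - a"
      by linarith+
    ultimately show "t \<in> {0..1} \<longleftrightarrow> a + (b - a) * t \<in> {a..b}" "t \<in> {0<..<1} \<longleftrightarrow> a + (b - a) * t \<in> {a<..<b}"
      by simp_all
  qed
  have "pw_curve D (\<lambda>t. \<gamma> (a + (b - a) * t)) (\<lambda>t. (b - a) *\<^sub>R \<gamma>' (a + (b - a) * t)) ((\<lambda>u. (u - a) / (b - a)) ` S) 0 1"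
    by (rule pw_curve_affine[OF \<gamma>]) (use ab cl op in simp_all)
  from kdist_le_klen_01[OF this] show ?thesis
    using klen_affine_le[OF D \<gamma>, of "b - a" 0 1 a, OF _ cl] ab by simp
qed

lemma kdist_less_curve:
  assumes "kdist D x y < c"
  obtains \<gamma> \<gamma>' S where "pw_curve D \<gamma> \<gamma>' S 0 1" "\<gamma> 0 = x" "\<gamma> 1 = y" "klen D \<gamma> \<gamma>' 0 1 < c"
proof -
  obtain \<gamma> where \<gamma>: "valid_path \<gamma>" "path_image \<gamma> \<subseteq> D" "pathstart \<gamma> = x" "pathfinish \<gamma> = y" "kobayashi_length D \<gamma> < c"
    using assms unfolding kdist_def INF_less_iff by blast
  obtain S where S: "finite S" "\<gamma> C1_differentiable_on {0..1} - S" "continuous_on {0..1} \<gamma>"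
    using \<gamma>(1) by (auto simp: valid_path_def piecewise_C1_differentiable_on_def)
  then have d: "\<And>t. t \<in> {0..1} - S \<Longrightarrow> \<gamma> differentiable at t"
    and c': "continuous_on ({0..1} - S) (\<lambda>t. vector_derivative \<gamma> (at t))"
    by (auto simp: C1_differentiable_on_eq)
  have "pw_curve D \<gamma> (\<lambda>t. vector_derivative \<gamma> (at t)) S 0 1"
    unfolding pw_curve_def using S \<gamma>(2) d
    by (auto simp: path_image_def vector_derivative_works[symmetric] intro: continuous_on_subset[OF c'])
  then show ?thesis
    using that \<gamma> by (auto simp: klen_def kobayashi_length_def pathstart_def pathfinish_def)
qed

lemma kdist_triangle:
  assumes D: "open D"
  shows "kdist D x z \<le> kdist D x y + kdist D y z"
proof (rule ennreal_le_epsilon)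
  fix e :: real assume fin: "kdist D x y + kdist D y z < top" and e: "0 < e"
  have "kdist D x y < kdist D x y + ennreal (e / 2)" "kdist D y z < kdist D y z + ennreal (e / 2)"
    using fin e by (cases "kdist D x y"; cases "kdist D y z"; simp add: ennreal_less_iff flip: ennreal_plus)+
  note lt = this
  obtain \<gamma>1 \<gamma>1' S1 where
    1: "pw_curve D \<gamma>1 \<gamma>1' S1 0 1" "\<gamma>1 0 = x" "\<gamma>1 1 = y" "klen D \<gamma>1 \<gamma>1' 0 1 < kdist D x y + ennreal (e / 2)"
    by (rule kdist_less_curve[OF lt(1)])
  obtain \<gamma>2 \<gamma>2' S2 where
    2: "pw_curve D \<gamma>2 \<gamma>2' S2 0 1" "\<gamma>2 0 = y" "\<gamma>2 1 = z" "klen D \<gamma>2 \<gamma>2' 0 1 < kdist D y z + ennreal (e / 2)"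
    by (rule kdist_less_curve[OF lt(2)])
  let ?g = "\<lambda>t. \<gamma>2 (- 1 + 1 * t)" let ?g' = "\<lambda>t. 1 *\<^sub>R \<gamma>2' (- 1 + 1 * t)"
  have 3: "pw_curve D ?g ?g' ((\<lambda>u. (u - - 1) / 1) ` S2) 1 2"
    by (rule pw_curve_affine[OF 2(1)]) auto
  have 4: "klen D ?g ?g' 1 2 \<le> klen D \<gamma>2 \<gamma>2' 0 1"
    by (rule klen_affine_le[OF D 2(1)]) auto
  have eq: "\<gamma>1 1 = ?g 1" using 1 2 by simp
  have "kdist D x z \<le> klen D \<gamma>1 \<gamma>1' 0 1 + klen D ?g ?g' 1 2"
    using kdist_le_klen[OF D pw_curve_join(1)[OF 1(1) 3 eq]] 1(2) 2(3)
    unfolding pw_curve_join(2)[OF 1(1) 3 eq, of D] by simp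
  also have "\<dots> \<le> (kdist D x y + ennreal (e / 2)) + (kdist D y z + ennreal (e / 2))"
    using 1(4) 2(4) 4 by (intro add_mono) auto
  also have "\<dots> = kdist D x y + kdist D y z + (ennreal (e / 2) + ennreal (e / 2))"
    by (simp add: ac_simps)
  also have "ennreal (e / 2) + ennreal (e / 2) = ennreal e"
    using e by (simp flip: ennreal_plus)
  finally show "kdist D x z \<le> kdist D x y + kdist D y z + ennreal e" .
qed

lemma klen_mono_domain:
  assumes "open D" "D \<subseteq> D'" "pw_curve D \<gamma> \<gamma>' S a b"
  shows "klen D' \<gamma> \<gamma>' a b \<le> klen D \<gamma> \<gamma>' a b"
  unfolding klen_def
  by (intro nn_integral_mono)
    (use assms in \<open>auto split: split_indicator intro!: ennreal_leI kobayashi_metric_mono simp: pw_curve_def\<close>)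

lemma kdist_mono:
  assumes D: "open D" "open D'" "D \<subseteq> D'"
  shows "kdist D' x y \<le> kdist D x y"
proof (rule dense_ge)
  fix c assume "kdist D x y < c"
  then obtain \<gamma> \<gamma>' S where *: "pw_curve D \<gamma> \<gamma>' S 0 1" "\<gamma> 0 = x" "\<gamma> 1 = y" "klen D \<gamma> \<gamma>' 0 1 < c"
    by (rule kdist_less_curve)
  have "pw_curve D' \<gamma> \<gamma>' S 0 1" by (rule pw_curve_subset[OF *(1)]) (use pw_curve_mem[OF *(1)] D(3) in auto)
  then have "kdist D' x y \<le> klen D' \<gamma> \<gamma>' 0 1" using kdist_le_klen[OF D(2)] * by metis
  then show "kdist D' x y \<le> c" using klen_mono_domain[OF D(1,3) *(1)] * by auto
qed

lemma ball_subset_on_segment: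
  fixes D :: "'a::real_normed_vector set"
  assumes D: "convex D" and "ball x r \<subseteq> D" "ball y r \<subseteq> D" "p \<in> closed_segment x y"
  shows "ball p r \<subseteq> D"
proof
  fix q assume "q \<in> ball p r"
  then have q: "norm (q - p) < r" by (simp add: dist_norm norm_minus_commute)
  obtain u where u: "0 \<le> u" "u \<le> 1" "p = (1 - u) *\<^sub>R x + u *\<^sub>R y" using assms(4) by (auto simp: in_segment)
  have "x + (q - p) \<in> D" "y + (q - p) \<in> D" using assms(2,3) q by (auto simp: subset_iff dist_norm norm_minus_commute)
  then have "(1 - u) *\<^sub>R (x + (q - p)) + u *\<^sub>R (y + (q - p)) \<in> D"
    using D u by (intro convexD) auto
  also have "(1 - u) *\<^sub>R (x + (q - p)) + u *\<^sub>R (y + (q - p)) = q"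
    unfolding u(3) by (simp add: algebra_simps)
  finally show "q \<in> D" .
qed

lemma kdist_le_segment:
  assumes D: "open D" and r: "r > 0" and b: "\<And>p. p \<in> closed_segment x y \<Longrightarrow> ball p r \<subseteq> D"
  shows "kdist D x y \<le> ennreal (norm (x - y) / r)"
proof -
  define \<gamma> where "\<gamma> t = x + t *\<^sub>R (y - x)" for t
  have seg: "\<gamma> t \<in> closed_segment x y" if "0 \<le> t" "t \<le> 1" for t
    using that by (auto simp: \<gamma>_def in_segment algebra_simps intro!: exI[of _ t])
  have "pw_curve D \<gamma> (\<lambda>_. y - x) {} 0 1"
    unfolding pw_curve_def
  proof (intro conjI ballI)
    show "\<gamma> ` {0..1} \<subseteq> D" using b seg r by fastforce
    show "(\<gamma> has_vector_derivative y - x) (at t)" for t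
      unfolding \<gamma>_def by (auto intro!: derivative_eq_intros)
  qed (auto simp: \<gamma>_def intro!: continuous_intros)
  from kdist_le_klen[OF D this] have "kdist D x y \<le> klen D \<gamma> (\<lambda>_. y - x) 0 1" by (simp add: \<gamma>_def)
  also have "\<dots> \<le> (\<integral>\<^sup>+t. ennreal (norm (y - x) / r) * indicator {0..1::real} t \<partial>lborel)"
    unfolding klen_def
    by (intro nn_integral_mono)
      (use r b seg in \<open>auto split: split_indicator intro!: ennreal_leI kobayashi_metric_le_ball\<close>)
  also have "\<dots> = ennreal (norm (x - y) / r)"
    by (simp add: nn_integral_cmult_indicator norm_minus_commute)
  finally show ?thesis .
qed

lemma kdist_convex_le:
  assumes "open D" "convex D" "r > 0" "ball x r \<subseteq> D" "ball y r \<subseteq> D"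
  shows "kdist D x y \<le> ennreal (norm (x - y) / r)"
  by (rule kdist_le_segment[OF assms(1,3)]) (rule ball_subset_on_segment[OF assms(2,4,5)])

lemma kdist_convex_finite:
  assumes "open D" "convex D" "x \<in> D" "y \<in> D"
  shows "kdist D x y < \<infinity>"
proof -
  obtain r s where "r > 0" "ball x r \<subseteq> D" "s > 0" "ball y s \<subseteq> D"
    using assms by (metis open_contains_ball)
  then have "ball x (min r s) \<subseteq> D" "ball y (min r s) \<subseteq> D" "min r s > 0" by auto
  from kdist_convex_le[OF assms(1,2) this(3,1,2)] show ?thesis
    by (auto intro: le_less_trans)
qed

text \<open>Along any curve the coordinate in the direction of \<open>y - x\<close> has derivative
  at most \<open>M\<close> times the metric.\<close>

lemma kdist_ge_norm:
  assumes \<Omega>: "open \<Omega>" and M: "M > 0" "\<And>z. z \<in> \<Omega> \<Longrightarrow> \<Omega> \<subseteq> ball z M"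
  shows "ennreal (norm (x - y) / M) \<le> kdist \<Omega> x y"
proof (rule dense_ge)
  fix c assume "kdist \<Omega> x y < c"
  then obtain \<gamma> \<gamma>' S where *: "pw_curve \<Omega> \<gamma> \<gamma>' S 0 1" "\<gamma> 0 = x" "\<gamma> 1 = y" "klen \<Omega> \<gamma> \<gamma>' 0 1 < c"
    by (rule kdist_less_curve)
  define e where "e = sgn (y - x)"
  have e: "norm e \<le> 1" "(y - x) \<bullet> e = norm (x - y)"
    by (cases "x = y"; simp add: e_def norm_sgn sgn_div_norm power2_norm_eq_inner[symmetric]
        power2_eq_square norm_minus_commute)+
  have "ennreal \<bar>(\<gamma> 1 \<bullet> e) / M - (\<gamma> 0 \<bullet> e) / M\<bar> \<le> klen \<Omega> \<gamma> \<gamma>' 0 1"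
    unfolding klen_def
  proof (rule increment_le_nn_integral[of 0 1 S _ "\<lambda>t. (\<gamma>' t \<bullet> e) / M"])
    show "continuous_on {0..1} (\<lambda>t. \<gamma> t \<bullet> e / M)" "continuous_on ({0<..<1} - S) (\<lambda>t. \<gamma>' t \<bullet> e / M)"
      using * M by (auto simp: pw_curve_def intro!: continuous_intros)
    fix t assume t: "t \<in> {0<..<1} - S"
    then have "(\<gamma> has_vector_derivative \<gamma>' t) (at t)" using * by (auto simp: pw_curve_def)
    then have "((\<lambda>t. \<gamma> t \<bullet> e / M) has_vector_derivative (\<gamma>' t \<bullet> e / M)) (at t)"
      by (rule bounded_linear.has_vector_derivative[OF bounded_linear_compose[OF bounded_linear_divide bounded_linear_inner_left]])
    then show "((\<lambda>t. \<gamma> t \<bullet> e / M) has_real_derivative \<gamma>' t \<bullet> e / M) (at t)"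
      by (simp add: has_real_derivative_iff_has_vector_derivative)
    have g: "\<gamma> t \<in> \<Omega>" using t pw_curve_mem[OF *(1), of t] by auto
    have "\<bar>\<gamma>' t \<bullet> e\<bar> \<le> norm (\<gamma>' t) * norm e" by (rule Cauchy_Schwarz_ineq2)
    also have "\<dots> \<le> norm (\<gamma>' t)" using e by (simp add: mult_left_le)
    also have "\<dots> \<le> M * kobayashi_metric \<Omega> (\<gamma> t) (\<gamma>' t)"
      by (rule kobayashi_metric_ge_norm[OF \<Omega> g M(2)[OF g]])
    finally show "ennreal \<bar>\<gamma>' t \<bullet> e / M\<bar> \<le> ennreal (kobayashi_metric \<Omega> (\<gamma> t) (\<gamma>' t))"
      using M by (intro ennreal_leI) (simp add: divide_le_eq mult.commute)
  qed (use * in \<open>auto simp: pw_curve_def\<close>)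
  also have "(\<gamma> 1 \<bullet> e) / M - (\<gamma> 0 \<bullet> e) / M = norm (x - y) / M"
    using e(2) * by (simp add: inner_diff_left flip: diff_divide_distrib)
  finally show "ennreal (norm (x - y) / M) \<le> c" using * M by simp
qed

lemma kobayashi_dist_eq: "kobayashi_dist D x y = enn2real (kdist D x y)"
  by (simp add: kobayashi_dist_def kdist_def)

section \<open>Localization of the metric\<close>

lemma first_exit:
  fixes \<gamma> :: "real \<Rightarrow> 'a::real_normed_vector"
  assumes "a \<le> b" and c: "continuous_on {a..b} \<gamma>" and \<rho>: "\<rho> > 0" "norm (\<gamma> b - \<gamma> a) \<ge> \<rho>"
  obtains s where "a \<le> s" "s \<le> b" "norm (\<gamma> s - \<gamma> a) = \<rho>" "\<And>t. a \<le> t \<Longrightarrow> t \<le> s \<Longrightarrow> norm (\<gamma> t - \<gamma> a) \<le> \<rho>"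
proof -
  define f where "f t = norm (\<gamma> t - \<gamma> a)" for t
  have cf: "continuous_on {a..b} f" unfolding f_def using c by (intro continuous_intros)
  define Z where "Z = {t \<in> {a..b}. f t = \<rho>}"
  have "\<exists>t\<ge>a. t \<le> b \<and> f t = \<rho>"
    by (rule IVT') (use cf assms in \<open>auto simp: f_def\<close>)
  then have ne: "Z \<noteq> {}" by (auto simp: Z_def)
  have "closed Z" unfolding Z_def by (rule continuous_closed_preimage_constant[OF cf closed_atLeastAtMost])
  moreover have bb: "bdd_below Z" by (auto simp: Z_def intro: bdd_belowI[of _ a])
  ultimately have I: "Inf Z \<in> Z" using ne closed_contains_Inf by blast
  have "f t \<le> \<rho>" if t: "a \<le> t" "t \<le> Inf Z" for t
  proof (rule ccontr)
    assume "\<not> f t \<le> \<rho>"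
    then have gt: "f t > \<rho>" by simp
    have "\<exists>s\<ge>a. s \<le> t \<and> f s = \<rho>"
      by (rule IVT') (use gt t I \<rho> in \<open>auto simp: f_def Z_def intro: continuous_on_subset[OF cf[unfolded f_def]]\<close>)
    then obtain s where s: "a \<le> s" "s \<le> t" "f s = \<rho>" by blast
    then have "s \<in> Z" using t I by (auto simp: Z_def)
    then have "Inf Z \<le> s" using bb by (rule cInf_lower)
    then have "s = t" using s t by simp
    then show False using s gt by simp
  qed
  then show ?thesis using that[of "Inf Z"] I by (auto simp: Z_def f_def)
qed

lemma nn_integral_derivative:
  fixes f F :: "real \<Rightarrow> real"
  assumes "a \<le> b" "\<And>t. a \<le> t \<Longrightarrow> t \<le> b \<Longrightarrow> 0 \<le> f t"
    and "\<And>t. a \<le> t \<Longrightarrow> t \<le> b \<Longrightarrow> (F has_real_derivative f t) (at t)"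
  shows "(\<integral>\<^sup>+t. ennreal (f t) * indicator {a..b} t \<partial>lborel) = ennreal (F b - F a)"
proof (rule nn_integral_has_integral_lebesgue')
  show "(f has_integral (F b - F a)) {a..b}"
    by (rule fundamental_theorem_of_calculus[OF assms(1)])
      (use assms(3) in \<open>auto simp: has_real_derivative_iff_has_vector_derivative intro: has_vector_derivative_at_within\<close>)
qed (use assms in auto)

lemma has_real_derivative_inner:
  assumes "(\<gamma> has_vector_derivative \<gamma>') (at t)"
  shows "((\<lambda>t. (p - \<gamma> t) \<bullet> \<nu>) has_real_derivative - (\<gamma>' \<bullet> \<nu>)) (at t)"
    and "((\<lambda>t. (\<gamma> t - p) \<bullet> (\<gamma> t - p)) has_real_derivative 2 * (\<gamma>' \<bullet> (\<gamma> t - p))) (at t)"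
proof -
  have d: "(\<gamma> has_derivative (\<lambda>h. h *\<^sub>R \<gamma>')) (at t)"
    using assms by (simp add: has_vector_derivative_def)
  show "((\<lambda>t. (p - \<gamma> t) \<bullet> \<nu>) has_real_derivative - (\<gamma>' \<bullet> \<nu>)) (at t)"
    unfolding has_field_derivative_def
    by (rule has_derivative_eq_rhs, rule has_derivative_inner_left, rule has_derivative_diff[OF has_derivative_const d])
      (simp add: fun_eq_iff inner_diff_left)
  show "((\<lambda>t. (\<gamma> t - p) \<bullet> (\<gamma> t - p)) has_real_derivative 2 * (\<gamma>' \<bullet> (\<gamma> t - p))) (at t)"
    unfolding has_field_derivative_def
    by (rule has_derivative_eq_rhs, rule has_derivative_inner[OF has_derivative_diff[OF d has_derivative_const] has_derivative_diff[OF d has_derivative_const]])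
      (simp add: fun_eq_iff inner_diff_left inner_diff_right inner_commute algebra_simps)
qed

text \<open>\<open>enn2real\<close> sends an infinite length to 0, so lower bounds for
  \<open>rlen\<close> come with the finiteness of \<open>klen\<close>.\<close>

definition rlen :: "(complex ^ 'n) set \<Rightarrow> (real \<Rightarrow> complex ^ 'n) \<Rightarrow> (real \<Rightarrow> complex ^ 'n) \<Rightarrow> real \<Rightarrow> real \<Rightarrow> real" where
  "rlen D \<gamma> \<gamma>' a b = enn2real (klen D \<gamma> \<gamma>' a b)"

lemma rlen_nonneg: "0 \<le> rlen D \<gamma> \<gamma>' a b"
  by (simp add: rlen_def)

lemma klen_finite_subinterval:
  "klen D \<gamma> \<gamma>' a b < \<infinity> \<Longrightarrow> a \<le> c \<Longrightarrow> d \<le> b \<Longrightarrow> klen D \<gamma> \<gamma>' c d < \<infinity>"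
  using klen_mono_interval[of a c d b D \<gamma> \<gamma>'] by (rule le_less_trans)

lemma rlen_split:
  assumes "klen D \<gamma> \<gamma>' a c < \<infinity>" "a \<le> b" "b \<le> c"
  shows "rlen D \<gamma> \<gamma>' a c = rlen D \<gamma> \<gamma>' a b + rlen D \<gamma> \<gamma>' b c"
  using klen_finite_subinterval[OF assms(1), of a b] klen_finite_subinterval[OF assms(1), of b c] assms
  by (simp add: rlen_def klen_split[of a b c] enn2real_plus)

lemma rlen_mono_interval:
  assumes "klen D \<gamma> \<gamma>' a b < \<infinity>" "a \<le> c" "d \<le> b"
  shows "rlen D \<gamma> \<gamma>' c d \<le> rlen D \<gamma> \<gamma>' a b"
  unfolding rlen_def by (rule enn2real_mono[OF klen_mono_interval]) (use assms in auto)

text \<open>The common device for bounding lengths from below: a potential whose derivative is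
  controlled by the metric is Lipschitz with respect to length.\<close>

lemma curve_increment:
  assumes \<gamma>: "pw_curve \<Omega> \<gamma> \<gamma>' S a b" and fin: "klen \<Omega> \<gamma> \<gamma>' a b < \<infinity>" and A: "A > 0"
    and cu: "continuous_on {a..b} u"
    and du: "\<And>t. t \<in> {a<..<b} - S \<Longrightarrow> (u has_real_derivative u' t) (at t)"
    and cu': "continuous_on ({a<..<b} - S) u'"
    and le: "\<And>t. t \<in> {a<..<b} - S \<Longrightarrow> \<bar>u' t\<bar> \<le> A * kobayashi_metric \<Omega> (\<gamma> t) (\<gamma>' t)"
  shows "\<bar>u b - u a\<bar> \<le> A * rlen \<Omega> \<gamma> \<gamma>' a b"
proof -
  let ?K = "\<lambda>t. kobayashi_metric \<Omega> (\<gamma> t) (\<gamma>' t)"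
  have "a \<le> b" "finite S" using \<gamma> by (auto simp: pw_curve_def)
  then have "ennreal \<bar>u b - u a\<bar> \<le> (\<integral>\<^sup>+t\<in>{a..b}. ennreal A * ennreal (?K t) \<partial>lborel)"
  proof (rule increment_le_nn_integral[OF _ _ cu du cu'])
    fix t assume t: "t \<in> {a<..<b} - S"
    have "A * ?K t \<ge> 0" using le[OF t] by linarith
    then have "?K t \<ge> 0" using A by (simp add: zero_le_mult_iff)
    then show "ennreal \<bar>u' t\<bar> \<le> ennreal A * ennreal (?K t)"
      using le[OF t] A by (simp add: ennreal_leI flip: ennreal_mult)
  qed
  also have "\<dots> = (\<integral>\<^sup>+t. ennreal A * (ennreal (?K t) * indicator {a..b} t) \<partial>lborel)"
    by (simp add: mult.assoc)
  also have "\<dots> \<le> ennreal A * klen \<Omega> \<gamma> \<gamma>' a b"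
    unfolding klen_def by (rule nn_integral_cmult_le_nonmeasurable) (use A in auto)
  also have "\<dots> = ennreal (A * rlen \<Omega> \<gamma> \<gamma>' a b)"
    using fin A by (simp add: rlen_def ennreal_mult less_top)
  finally show ?thesis using A by (simp add: rlen_nonneg ennreal_le_iff)
qed

text \<open>The radial path \<open>t \<mapsto> f (t w)\<close> of a disc has Kobayashi length at most \<open>artanh (norm w)\<close>, so a
  lower bound for the cost of leaving \<open>ball z \<rho>\<close> keeps the smaller disc of radius \<open>(1 - q) / (1 + q)\<close> inside.\<close>

lemma disc_localization:
  fixes \<Omega> D :: "(complex ^ 'n) set"
  assumes \<Omega>: "open \<Omega>" "z \<in> \<Omega>" and sub: "\<Omega> \<inter> ball z \<rho> \<subseteq> D" and q: "0 < q" "q < 1"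
    and cost: "\<And>\<gamma> \<gamma>' S. pw_curve \<Omega> \<gamma> \<gamma>' S 0 1 \<Longrightarrow> \<gamma> 0 = z \<Longrightarrow> \<gamma> 1 \<notin> ball z \<rho> \<Longrightarrow>
      ennreal (- ln q / 2) \<le> klen \<Omega> \<gamma> \<gamma>' 0 1"
  shows "kobayashi_metric D z v \<le> (1 + q) / (1 - q) * kobayashi_metric \<Omega> z v"
proof -
  \<comment> \<open>Chosen so that \<open>artanh r = - ln q / 2\<close>.\<close>
  define r where "r = (1 - q) / (1 + q)"
  have r: "0 < r" "r < 1" using q by (auto simp: r_def)
  have "r * kobayashi_metric D z v \<le> kobayashi_metric \<Omega> z v"
  proof (rule kobayashi_metric_ge[OF \<Omega>])
    fix f \<zeta> assume f: "holomorphic_disc \<Omega> f" "f 0 = z" "\<zeta> *s disc_deriv f 0 = v"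
    have im: "f y \<in> \<Omega>" if "norm y < 1" for y
      using f(1) that by (auto simp: holomorphic_disc_def image_subset_iff)
    have near: "f w \<in> D" if w: "norm w < r" for w
    proof -
      let ?s = "norm w"
      have s1: "?s < 1" using w r by simp
      have ts: "t * ?s < 1" if "t \<le> 1" for t
      proof -
        have "t * ?s \<le> 1 * ?s" using that by (intro mult_right_mono) auto
        then show ?thesis using s1 by simp
      qed
      define \<gamma> where "\<gamma> t = f (of_real t * w)" for t :: real
      define \<gamma>' where "\<gamma>' t = w *s disc_deriv f (of_real t * w)" for t :: real
      have tw: "of_real t * w \<in> ball 0 1" if "0 \<le> t" "t \<le> 1" for t :: real
        using ts[OF that(2)] that by (simp add: norm_mult)
      have d: "(\<gamma> has_vector_derivative \<gamma>' t) (at t)" if "0 \<le> t" "t \<le> 1" for t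
      proof -
        have "((\<lambda>t. of_real t * w) has_derivative (\<lambda>h. of_real h * w)) (at t)"
          by (auto intro!: derivative_eq_intros)
        from has_derivative_compose[OF this holomorphic_disc_has_derivative[OF f(1) tw[OF that]]]
        show ?thesis
          unfolding has_vector_derivative_def \<gamma>_def \<gamma>'_def
          by (rule has_derivative_eq_rhs) (simp only: fun_eq_iff of_real_vector_scalar_mult[symmetric] vector_smult_assoc, simp)
      qed
      have "continuous_on {0..1} (\<lambda>t. deriv (\<lambda>w. f w $ i) (of_real t * w))" for i
      proof -
        have "deriv (\<lambda>w. f w $ i) holomorphic_on ball 0 1"
          using f(1) by (intro holomorphic_deriv) (auto simp: holomorphic_disc_def)
        from holomorphic_on_imp_continuous_on[OF this] show ?thesis
          by (rule continuous_on_compose2) (use tw in \<open>auto intro!: continuous_intros\<close>)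
      qed
      then have c': "continuous_on {0..1} \<gamma>'"
        unfolding \<gamma>'_def disc_deriv_def vector_scalar_mult_def
        by (intro continuous_on_vec_lambda) (auto intro!: continuous_intros)
      have pw: "pw_curve \<Omega> \<gamma> \<gamma>' {} 0 1"
        unfolding pw_curve_def
      proof (intro conjI ballI)
        show "continuous_on {0..1} \<gamma>"
          using d has_vector_derivative_continuous by (intro continuous_at_imp_continuous_on) force
        show "\<gamma> ` {0..1} \<subseteq> \<Omega>" using tw by (auto simp: \<gamma>_def intro!: im)
        show "continuous_on ({0<..<1} - {}) \<gamma>'" using c' by (rule continuous_on_subset) auto
      qed (use d in auto)
      \<comment> \<open>The antiderivative is \<open>artanh (t * norm w)\<close>, which vanishes at
        0.\<close>
      let ?F = "\<lambda>t. (ln (1 + t * ?s) - ln (1 - t * ?s)) / 2"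
      have sq: "(t * ?s)\<^sup>2 < 1" if "0 \<le> t" "t \<le> 1" for t
        using ts[OF that(2)] that by (simp add: abs_square_less_1)
      have "klen \<Omega> \<gamma> \<gamma>' 0 1 \<le> (\<integral>\<^sup>+t. ennreal (?s / (1 - (t * ?s)\<^sup>2)) * indicator {0..1} t \<partial>lborel)"
        unfolding klen_def
      proof (rule nn_integral_mono)
        fix t :: real
        show "ennreal (kobayashi_metric \<Omega> (\<gamma> t) (\<gamma>' t)) * indicator {0..1} t
          \<le> ennreal (?s / (1 - (t * ?s)\<^sup>2)) * indicator {0..1} t"
        proof (cases "t \<in> {0..1}")
          case True
          then have "norm (of_real t * w) < 1" using tw[of t] by simp
          from kobayashi_metric_disc_le[OF f(1) this, of w] True show ?thesis
            by (simp add: \<gamma>_def \<gamma>'_def norm_mult ennreal_leI)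
        qed simp
      qed
      also have "\<dots> = ennreal (?F 1 - ?F 0)"
      proof (rule nn_integral_derivative)
        fix t :: real assume t: "0 \<le> t" "t \<le> 1"
        show "0 \<le> ?s / (1 - (t * ?s)\<^sup>2)" using sq[OF t] by simp
        have p: "1 + t * ?s > 0" "1 - t * ?s > 0" using ts[OF t(2)] t by (auto simp: add_pos_nonneg)
        have "(?F has_real_derivative (?s / (1 + t * ?s) - - ?s / (1 - t * ?s)) / 2) (at t)"
          using p by (auto intro!: derivative_eq_intros simp: mult.commute)
        moreover have "(?s / (1 + t * ?s) - - ?s / (1 - t * ?s)) / 2 = ?s / ((1 - t * ?s) * (1 + t * ?s))"
          using p by (simp add: divide_simps) (simp add: algebra_simps)
        moreover have "(1 - t * ?s) * (1 + t * ?s) = 1 - (t * ?s)\<^sup>2" by (simp add: power2_eq_square algebra_simps)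
        ultimately show "(?F has_real_derivative ?s / (1 - (t * ?s)\<^sup>2)) (at t)"
          by (simp only:)
      qed simp
      also have "\<dots> < ennreal (- ln q / 2)"
      proof -
        have "?s * (1 + q) < 1 - q" using w q by (simp add: r_def pos_less_divide_eq)
        then have "q * (1 + ?s) < 1 - ?s" by (simp add: algebra_simps)
        then have "(1 + ?s) / (1 - ?s) < 1 / q" using s1 q by (simp add: field_simps)
        moreover have "(1 + ?s) / (1 - ?s) > 0" using s1 by (simp add: add_pos_nonneg)
        ultimately have "ln ((1 + ?s) / (1 - ?s)) < ln (1 / q)" by (simp only: ln_less_cancel_iff)
        then have "?F 1 - ?F 0 < - ln q / 2"
        proof -
          have "1 + ?s > 0" by (simp add: add_pos_nonneg)
          then have "1 + ?s \<noteq> 0" by linarith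
          then have "ln ((1 + ?s) / (1 - ?s)) = ln (1 + ?s) - ln (1 - ?s)" using s1 by (simp add: ln_div)
          moreover have "ln (1 / q) = - ln q" using q by (simp add: ln_div)
          ultimately show ?thesis using \<open>ln ((1 + ?s) / (1 - ?s)) < ln (1 / q)\<close> by simp
        qed
        moreover have "- ln q / 2 > 0" using q by simp
        ultimately show ?thesis by (intro ennreal_lessI)
      qed
      finally have "\<not> ennreal (- ln q / 2) \<le> klen \<Omega> \<gamma> \<gamma>' 0 1" by simp
      moreover have "\<gamma> 0 = z" "\<gamma> 1 = f w" by (auto simp: \<gamma>_def f(2))
      ultimately have "f w \<in> ball z \<rho>" using cost[OF pw] by metis
      then show ?thesis using sub im[OF s1] by blast
    qed
    \<comment> \<open>The dilated disc \<open>y \<mapsto> f (r * y)\<close> stays in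
      \<open>D\<close>, and its derivative at 0 is that of \<open>f\<close> times
      \<open>r\<close>.\<close>
    have g: "(\<lambda>y::complex. of_real r * y) holomorphic_on ball 0 1" "(\<lambda>y::complex. of_real r * y) ` ball 0 1 \<subseteq> ball 0 1"
    proof -
      have "norm (of_real r * y) < 1" if "norm y < 1" for y :: complex
        using mult_left_le_one_le[of "norm y" r] r that by (simp add: norm_mult)
      then show "(\<lambda>y::complex. of_real r * y) ` ball 0 1 \<subseteq> ball 0 1" by auto
    qed (auto intro!: holomorphic_intros)
    note C = holomorphic_disc_compose[OF f(1) g]
    have "deriv (\<lambda>y::complex. of_real r * y) 0 = of_real r"
      by (rule DERIV_imp_deriv) (auto intro!: derivative_eq_intros)
    then have e: "disc_deriv (f \<circ> (\<lambda>y::complex. of_real r * y)) 0 = of_real r *s disc_deriv f 0"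
      using C(2)[of 0] by simp
    have hD: "holomorphic_disc D (f \<circ> (\<lambda>y::complex. of_real r * y))"
      using C(1) near r unfolding holomorphic_disc_def by (auto simp: norm_mult)
    have "kobayashi_metric D z v \<le> norm (\<zeta> / of_real r)"
      by (rule kobayashi_metric_le[OF hD]) (use f r in \<open>auto simp: e\<close>)
    then show "r * kobayashi_metric D z v \<le> norm \<zeta>"
      using r by (simp add: norm_divide field_simps)
  qed
  then show ?thesis using q by (simp add: r_def field_simps)
qed

section \<open>Potentials and the cost of leaving a ball\<close>

lemma ball_infdist_frontier:
  fixes D :: "'a::euclidean_space set"
  assumes "z \<in> D"
  shows "ball z (infdist z (frontier D)) \<subseteq> D"
proof
  fix q assume q: "q \<in> ball z (infdist z (frontier D))"
  show "q \<in> D"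
  proof (rule ccontr)
    assume "q \<notin> D"
    then have "closed_segment z q \<inter> frontier D \<noteq> {}"
      using assms by (intro connected_Int_frontier) auto
    then obtain p where p: "p \<in> closed_segment z q" "p \<in> frontier D" by blast
    then have "infdist z (frontier D) \<le> dist z p" by (intro infdist_le)
    also have "\<dots> \<le> dist z q"
      using dist_in_closed_segment[OF p(1)] by (simp add: dist_commute)
    finally show False using q by simp
  qed
qed

lemma infdist_frontier_pos:
  fixes D :: "'a::euclidean_space set"
  assumes "open D" "z \<in> D" "frontier D \<noteq> {}"
  shows "0 < infdist z (frontier D)"
  using assms by (intro infdist_pos_not_in_closed) (auto simp: frontier_def interior_open)

text \<open>If \<open>l > 0\<close> satisfies \<open>\<bar>l'\<bar> \<le> 2 * l * (1 + B * l powr \<alpha>) * k\<close>, then \<open>growth_fn B \<alpha> \<circ> l\<close> is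
  \<open>k\<close>-Lipschitz, and it differs from \<open>ln l / 2\<close> by a bounded amount.\<close>

definition growth_fn :: "real \<Rightarrow> real \<Rightarrow> real \<Rightarrow> real" where
  "growth_fn B \<alpha> x = (ln x - ln (1 + B * x powr \<alpha>) / \<alpha>) / 2"

lemma growth_fn_derivative:
  assumes "x > 0" "B \<ge> 0" "\<alpha> > 0"
  shows "(growth_fn B \<alpha> has_real_derivative 1 / (2 * x * (1 + B * x powr \<alpha>))) (at x)"
proof -
  define P where "P = x powr \<alpha>"
  have P: "P > 0" using assms by (simp add: P_def)
  have nn: "1 + B * P > 0" using assms P by (simp add: add_pos_nonneg)
  have "((\<lambda>x. 1 + B * x powr \<alpha>) has_real_derivative 0 + B * (\<alpha> * x powr (\<alpha> - 1))) (at x)"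
    using assms(1) by (intro DERIV_add DERIV_const DERIV_cmult has_real_derivative_powr)
  from DERIV_chain2[OF DERIV_ln_divide[OF nn[unfolded P_def]] this]
  have "(growth_fn B \<alpha> has_real_derivative
      (1 / x - 1 / (1 + B * x powr \<alpha>) * (0 + B * (\<alpha> * x powr (\<alpha> - 1))) / \<alpha>) / 2) (at x)"
    unfolding growth_fn_def[abs_def] by (intro DERIV_cdivide DERIV_diff DERIV_ln_divide assms(1))
  moreover have "x powr (\<alpha> - 1) = P / x" using assms by (simp add: P_def powr_diff)
  then have "(1 / x - 1 / (1 + B * x powr \<alpha>) * (0 + B * (\<alpha> * x powr (\<alpha> - 1))) / \<alpha>) / 2 = 1 / (2 * x * (1 + B * x powr \<alpha>))"
  proof -
    define N where "N = 1 + B * P"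
    have "1 / N * (0 + B * (\<alpha> * (P / x))) / \<alpha> = (N - 1) / (N * x)"
      using assms by (simp add: N_def)
    moreover have "(1 / x - (N - 1) / (N * x)) / 2 = 1 / (2 * x * N)"
      using assms nn unfolding N_def[symmetric] by (simp add: field_simps)
    ultimately show ?thesis
      using \<open>x powr (\<alpha> - 1) = P / x\<close> unfolding P_def[symmetric] N_def[symmetric] by (simp only:)
  qed
  ultimately show ?thesis by (simp only:)
qed

lemma growth_fn_le: "B \<ge> 0 \<Longrightarrow> \<alpha> > 0 \<Longrightarrow> growth_fn B \<alpha> x \<le> ln x / 2"
  by (simp add: growth_fn_def ln_ge_zero)

lemma growth_fn_ge:
  assumes "0 < x" "x \<le> M" "B \<ge> 0" "\<alpha> > 0"
  shows "ln x / 2 - ln (1 + B * M powr \<alpha>) / (2 * \<alpha>) \<le> growth_fn B \<alpha> x"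
proof -
  have "B * x powr \<alpha> \<le> B * M powr \<alpha>" using assms by (intro mult_left_mono powr_mono2) auto
  moreover have "0 \<le> B * x powr \<alpha>" using assms by simp
  ultimately have "ln (1 + B * x powr \<alpha>) \<le> ln (1 + B * M powr \<alpha>)" by simp
  then have "ln (1 + B * x powr \<alpha>) / \<alpha> / 2 \<le> ln (1 + B * M powr \<alpha>) / \<alpha> / 2"
    using assms by (intro divide_right_mono) auto
  then show ?thesis by (simp add: growth_fn_def diff_divide_distrib mult.commute)
qed

text \<open>Beyond convexity, the \<open>m\<close>-convexity of the piece \<open>D\<close> enters
  only through \<open>metric_lower\<close>. By \<open>near\<close> this piece fills
  \<open>\<Omega>\<close> close to \<open>\<xi>\<close>, and \<open>M\<close> exceeds the distance
  of any two points of \<open>\<Omega>\<close>.\<close>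

locale local_model =
  fixes \<Omega> D :: "(complex ^ 'n) set" and \<xi> :: "complex ^ 'n" and m C1 R M :: real
  assumes open_\<Omega>: "open \<Omega>" and open_D: "open D" and convex_D: "convex D" and D_sub: "D \<subseteq> \<Omega>"
    and near: "\<Omega> \<inter> ball \<xi> R \<subseteq> D" and R: "R > 0" and M: "M > 0"
    and diam: "\<And>z. z \<in> \<Omega> \<Longrightarrow> \<Omega> \<subseteq> ball z M"
    and xi: "\<xi> \<in> frontier D" and m: "m > 1" and C1: "C1 > 0"
    and metric_lower: "\<And>z v. z \<in> D \<Longrightarrow>
      norm v \<le> C1 * infdist z (frontier D) powr (1 / m) * kobayashi_metric D z v"
begin

definition \<delta> :: "complex ^ 'n \<Rightarrow> real" where "\<delta> z = infdist z (frontier D)"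

lemma \<delta>_pos: "z \<in> D \<Longrightarrow> 0 < \<delta> z"
  unfolding \<delta>_def using infdist_frontier_pos open_D xi by blast

lemma \<delta>_ball: "z \<in> D \<Longrightarrow> ball z (\<delta> z) \<subseteq> D"
  unfolding \<delta>_def by (rule ball_infdist_frontier)

lemma \<delta>_le: "\<delta> z \<le> dist z \<xi>"
  unfolding \<delta>_def using xi by (rule infdist_le)

lemma \<delta>_Lipschitz: "\<delta> x \<le> \<delta> y + dist x y"
  unfolding \<delta>_def by (rule infdist_triangle)

lemma \<delta>_continuous: "continuous_on S \<delta>"
  unfolding \<delta>_def by (intro continuous_intros)

lemma near_D: "z \<in> \<Omega> \<Longrightarrow> z \<in> ball \<xi> R \<Longrightarrow> z \<in> D"
  using near by blast

text \<open>From \<open>w\<close> one can move any distance below \<open>\<delta> w\<close> in the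
  direction \<open>\<nu>\<close> without leaving \<open>D\<close>, hence without reaching the
  hyperplane.\<close>

lemma half_space_ge_\<delta>:
  assumes \<nu>: "norm \<nu> = 1" "\<And>w. w \<in> D \<Longrightarrow> (w - p) \<bullet> \<nu> < 0" and w: "w \<in> D"
  shows "\<delta> w \<le> (p - w) \<bullet> \<nu>"
proof (rule field_le_epsilon)
  fix e :: real assume e: "0 < e"
  define s where "s = max 0 (\<delta> w - e)"
  have "0 \<le> s" "s < \<delta> w" using e \<delta>_pos[OF w] by (auto simp: s_def)
  then have "w + s *\<^sub>R \<nu> \<in> D" using \<nu>(1) by (intro subsetD[OF \<delta>_ball[OF w]]) (simp add: dist_norm)
  from \<nu>(2)[OF this] have "s < (p - w) \<bullet> \<nu>"
    using \<nu>(1) by (simp add: inner_diff_left inner_add_left norm_eq_1)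
  then show "\<delta> w \<le> (p - w) \<bullet> \<nu> + e" by (simp add: s_def)
qed

text \<open>A half-space that supports \<open>D\<close> at the nearest boundary point
  \<open>p\<close> contains the ball of radius \<open>\<delta> z\<close> about \<open>z\<close>, so
  its hyperplane is tangent to this ball at \<open>p\<close>; equality in Cauchy--Schwarz makes
  \<open>\<nu>\<close> point from \<open>z\<close> to \<open>p\<close>.\<close>

lemma support:
  assumes z: "z \<in> D"
  obtains p \<nu> where "p \<in> frontier D" "norm \<nu> = 1" "\<And>w. w \<in> D \<Longrightarrow> (w - p) \<bullet> \<nu> < 0"
    "p - z = \<delta> z *\<^sub>R \<nu>" "(p - z) \<bullet> \<nu> = \<delta> z"
proof -
  obtain p where p: "p \<in> frontier D" "infdist z (frontier D) = dist z p"
    using infdist_attains_inf[of "frontier D" z] xi by auto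
  have "p \<notin> D" using p(1) open_D by (auto simp: frontier_def interior_open)
  moreover have "D \<noteq> {}" using z by blast
  ultimately obtain \<nu> where \<nu>: "norm \<nu> = 1" "\<And>w. w \<in> D \<Longrightarrow> (w - p) \<bullet> \<nu> < 0"
    using convex_open_support[OF convex_D open_D] by metis
  have n: "norm (p - z) = \<delta> z" using p(2) by (simp add: \<delta>_def dist_norm norm_minus_commute)
  have ge: "\<delta> z \<le> (p - z) \<bullet> \<nu>" by (rule half_space_ge_\<delta>[OF \<nu> z])
  have le: "(p - z) \<bullet> \<nu> \<le> \<delta> z" using norm_cauchy_schwarz[of "p - z" \<nu>] \<nu>(1) n by simp
  then have eq: "(p - z) \<bullet> \<nu> = \<delta> z" using ge by simp
  then have "norm \<nu> *\<^sub>R (p - z) = norm (p - z) *\<^sub>R \<nu>"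
    using norm_cauchy_schwarz_eq[of "p - z" \<nu>] \<nu>(1) n by simp
  then have "p - z = \<delta> z *\<^sub>R \<nu>" using \<nu>(1) n by simp
  then show ?thesis using that[OF p(1) \<nu> _ eq] by blast
qed

lemma half_space_le_M:
  assumes "p \<in> frontier D" "norm \<nu> = 1" "w \<in> D"
  shows "(p - w) \<bullet> \<nu> \<le> M"
proof -
  have "D \<subseteq> cball w M" using diam[of w] assms(3) D_sub by fastforce
  then have "closure D \<subseteq> cball w M" by (rule closure_minimal) simp
  then have "norm (p - w) \<le> M" using assms(1) by (auto simp: frontier_def dist_norm norm_minus_commute)
  then show ?thesis using norm_cauchy_schwarz[of "p - w" \<nu>] assms(2) by simp
qed

text \<open>The hypothesis on the metrics shared by the successive rounds of the bootstrap.\<close>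

definition comparison :: "real \<Rightarrow> real \<Rightarrow> real \<Rightarrow> real \<Rightarrow> bool" where
  "comparison R1 A B \<alpha> \<longleftrightarrow> 0 < R1 \<and> R1 \<le> R \<and> 1 \<le> A \<and> 0 \<le> B \<and> 0 < \<alpha> \<and>
     (\<forall>z\<in>\<Omega> \<inter> ball \<xi> R1. \<forall>v. kobayashi_metric D z v \<le> A * (1 + B * \<delta> z powr \<alpha>) * kobayashi_metric \<Omega> z v)"

text \<open>The height \<open>l\<close> satisfies \<open>\<delta> \<le> l\<close> along the curve,
  so the factor \<open>1 + B * \<delta> powr \<alpha>\<close> of the comparison can be replaced by
  one in \<open>l\<close> alone, and the derivative of \<open>growth_fn\<close> cancels it together
  with \<open>2 * l\<close>.\<close>

lemma growth:
  assumes cmp: "comparison R1 A B \<alpha>"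
    and \<gamma>: "pw_curve \<Omega> \<gamma> \<gamma>' S a b" and fin: "klen \<Omega> \<gamma> \<gamma>' a b < \<infinity>"
    and nr: "\<And>t. a \<le> t \<Longrightarrow> t \<le> b \<Longrightarrow> \<gamma> t \<in> ball \<xi> R1"
    and \<nu>: "norm \<nu> = 1" "\<And>w. w \<in> D \<Longrightarrow> (w - p) \<bullet> \<nu> < 0"
  shows "\<bar>growth_fn B \<alpha> ((p - \<gamma> b) \<bullet> \<nu>) - growth_fn B \<alpha> ((p - \<gamma> a) \<bullet> \<nu>)\<bar> \<le> A * rlen \<Omega> \<gamma> \<gamma>' a b"
proof -
  have par: "R1 \<le> R" "A \<ge> 1" "B \<ge> 0" "\<alpha> > 0"
    and K: "\<And>z v. z \<in> \<Omega> \<Longrightarrow> z \<in> ball \<xi> R1 \<Longrightarrow> kobayashi_metric D z v \<le> A * (1 + B * \<delta> z powr \<alpha>) * kobayashi_metric \<Omega> z v"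
    using cmp by (auto simp: comparison_def)
  define l where "l t = (p - \<gamma> t) \<bullet> \<nu>" for t
  have inD: "\<gamma> t \<in> D" if "a \<le> t" "t \<le> b" for t
    using near_D[OF pw_curve_mem[OF \<gamma> that]] nr[OF that] par by auto
  have l\<delta>: "\<delta> (\<gamma> t) \<le> l t" "0 < l t" if "a \<le> t" "t \<le> b" for t
    using half_space_ge_\<delta>[OF \<nu> inD[OF that]] \<delta>_pos[OF inD[OF that]] by (auto simp: l_def)
  have cl: "continuous_on {a..b} l"
    using \<gamma> unfolding l_def pw_curve_def by (intro continuous_intros) auto
  have nz: "1 + B * x powr \<alpha> > 0" for x using par by (simp add: add_pos_nonneg)
  have "\<bar>growth_fn B \<alpha> (l b) - growth_fn B \<alpha> (l a)\<bar> \<le> A * rlen \<Omega> \<gamma> \<gamma>' a b"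
  proof (rule curve_increment[OF \<gamma> fin, where u' = "\<lambda>t. 1 / (2 * l t * (1 + B * l t powr \<alpha>)) * - (\<gamma>' t \<bullet> \<nu>)"])
    show "continuous_on {a..b} (\<lambda>t. growth_fn B \<alpha> (l t))"
      unfolding growth_fn_def using cl l\<delta>(2) nz par
      by (intro continuous_intros) (auto simp: less_imp_neq[symmetric] dest!: less_imp_neq)
    show "continuous_on ({a<..<b} - S) (\<lambda>t. 1 / (2 * l t * (1 + B * l t powr \<alpha>)) * - (\<gamma>' t \<bullet> \<nu>))"
    proof -
      have "continuous_on ({a<..<b} - S) l" using cl by (rule continuous_on_subset) auto
      moreover have "continuous_on ({a<..<b} - S) \<gamma>'" using \<gamma> by (simp add: pw_curve_def)
      moreover have "l t \<noteq> 0" "1 + B * l t powr \<alpha> \<noteq> 0" if "t \<in> {a<..<b} - S" for t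
        using l\<delta>(2)[of t] nz[of "l t"] that by auto
      ultimately show ?thesis by (intro continuous_intros) auto
    qed
    fix t assume t: "t \<in> {a<..<b} - S"
    then have t': "a \<le> t" "t \<le> b" by auto
    have "(\<gamma> has_vector_derivative \<gamma>' t) (at t)" using \<gamma> t by (auto simp: pw_curve_def)
    then have "(l has_real_derivative - (\<gamma>' t \<bullet> \<nu>)) (at t)"
      unfolding l_def by (rule has_real_derivative_inner)
    from DERIV_chain2[OF growth_fn_derivative[OF l\<delta>(2)[OF t'] par(3,4)] this]
    show "((\<lambda>t. growth_fn B \<alpha> (l t)) has_real_derivative
        1 / (2 * l t * (1 + B * l t powr \<alpha>)) * - (\<gamma>' t \<bullet> \<nu>)) (at t)" .
    define P where "P = 1 + B * l t powr \<alpha>"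
    have P: "P > 0" using nz by (simp add: P_def)
    have l0: "l t > 0" using l\<delta>(2)[OF t'] .
    let ?K = "kobayashi_metric \<Omega> (\<gamma> t) (\<gamma>' t)"
    have K0: "?K \<ge> 0" using kobayashi_metric_nonneg[OF open_\<Omega> pw_curve_mem[OF \<gamma> t']] .
    have "\<bar>\<gamma>' t \<bullet> \<nu>\<bar> \<le> norm (hprod (\<gamma>' t) \<nu>)"
      using abs_Re_le_cmod[of "hprod (\<gamma>' t) \<nu>"] by (simp add: Re_hprod)
    also have "\<dots> \<le> 2 * l t * kobayashi_metric D (\<gamma> t) (\<gamma>' t)"
      unfolding l_def by (rule half_space_kobayashi_metric[OF open_D inD[OF t']]) (rule \<nu>(2))
    also have "\<dots> \<le> 2 * l t * (A * (1 + B * \<delta> (\<gamma> t) powr \<alpha>) * ?K)"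
      using l0 by (intro mult_left_mono K pw_curve_mem[OF \<gamma> t'] nr t') auto
    also have "\<dots> \<le> 2 * l t * (A * P * ?K)"
    proof -
      have "\<delta> (\<gamma> t) powr \<alpha> \<le> l t powr \<alpha>"
        using l\<delta>[OF t'] par \<delta>_pos[OF inD[OF t']] by (intro powr_mono2) auto
      then have "1 + B * \<delta> (\<gamma> t) powr \<alpha> \<le> P" unfolding P_def using par by (simp add: mult_left_mono)
      then show ?thesis using l0 K0 par by (intro mult_left_mono mult_right_mono) auto
    qed
    finally have "\<bar>\<gamma>' t \<bullet> \<nu>\<bar> \<le> (2 * l t * P) * (A * ?K)" by (simp add: mult_ac)
    then have "\<bar>\<gamma>' t \<bullet> \<nu>\<bar> / (2 * l t * P) \<le> A * ?K"
      using l0 P by (simp add: divide_le_eq mult.commute)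
    then show "\<bar>1 / (2 * l t * (1 + B * l t powr \<alpha>)) * - (\<gamma>' t \<bullet> \<nu>)\<bar> \<le> A * ?K"
      using l0 P unfolding P_def[symmetric] by (simp add: abs_mult)
  qed (use par in auto)
  then show ?thesis by (simp add: l_def)
qed

text \<open>Let \<open>l\<close> be the height over a supporting hyperplane and \<open>E\<close> the distance travelled. Up to the last time
  with \<open>E \<le> u0 * l powr (1 / m)\<close> the cost is at least the growth of \<open>ln l / 2\<close>; afterwards it is at least
  the growth of \<open>m / 2 * ln E\<close>, and the two potentials agree up to a constant at the switching time.\<close>

lemma exit_cost:
  assumes cmp: "comparison R1 A B \<alpha>" and \<rho>: "\<rho> > 0"
  shows "\<exists>C. \<forall>\<gamma> \<gamma>' S a b. pw_curve \<Omega> \<gamma> \<gamma>' S a b \<longrightarrow> klen \<Omega> \<gamma> \<gamma>' a b < \<infinity> \<longrightarrow>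
    (\<forall>t. a \<le> t \<longrightarrow> t \<le> b \<longrightarrow> \<gamma> t \<in> ball \<xi> R1) \<longrightarrow> \<rho> \<le> norm (\<gamma> b - \<gamma> a) \<longrightarrow>
    - ln (\<delta> (\<gamma> a)) / 2 - C \<le> A * rlen \<Omega> \<gamma> \<gamma>' a b"
proof -
  have par: "R1 \<le> R" "A \<ge> 1" "B \<ge> 0" "\<alpha> > 0"
    and K: "\<And>z v. z \<in> \<Omega> \<Longrightarrow> z \<in> ball \<xi> R1 \<Longrightarrow> kobayashi_metric D z v \<le> A * (1 + B * \<delta> z powr \<alpha>) * kobayashi_metric \<Omega> z v"
    using cmp by (auto simp: comparison_def)
  define c where "c = ln (1 + B * M powr \<alpha>) / (2 * \<alpha>)"
  define C2 where "C2 = C1 * (1 + B * M powr \<alpha>)"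
  \<comment> \<open>Where \<open>u0 * l powr (1 / m) \<le> E\<close>, the speed is at most
    \<open>C2 * l powr (1 / m) \<le> 2 / m * E\<close> times \<open>A\<close> times the metric of
    \<open>\<Omega>\<close>; this makes \<open>m / 2 * ln E\<close> Lipschitz with constant
    \<open>A\<close>.\<close>
  define u0 where "u0 = m * C2 / 2"
  have C2: "C2 > 0" using C1 par by (simp add: C2_def add_pos_nonneg)
  have u0: "u0 > 0" using C2 m by (simp add: u0_def)
  have main: "- ln (\<delta> (\<gamma> a)) / 2 - (c + m / 2 * (ln u0 - ln \<rho>)) \<le> A * rlen \<Omega> \<gamma> \<gamma>' a b"
    if \<gamma>: "pw_curve \<Omega> \<gamma> \<gamma>' S a b" and fin: "klen \<Omega> \<gamma> \<gamma>' a b < \<infinity>"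
      and nr: "\<And>t. a \<le> t \<Longrightarrow> t \<le> b \<Longrightarrow> \<gamma> t \<in> ball \<xi> R1" and far: "\<rho> \<le> norm (\<gamma> b - \<gamma> a)"
    for \<gamma> \<gamma>' S a b
  proof -
    have ab: "a \<le> b" using \<gamma> by (simp add: pw_curve_def)
    have inD: "\<gamma> t \<in> D" if "a \<le> t" "t \<le> b" for t
      using near_D[OF pw_curve_mem[OF \<gamma> that]] nr[OF that] par by auto
    obtain p \<nu> where p: "p \<in> frontier D" and \<nu>: "norm \<nu> = 1" "\<And>w. w \<in> D \<Longrightarrow> (w - p) \<bullet> \<nu> < 0"
      and pa: "(p - \<gamma> a) \<bullet> \<nu> = \<delta> (\<gamma> a)"
      using support[OF inD[OF order_refl ab]] by blast
    define l where "l t = (p - \<gamma> t) \<bullet> \<nu>" for t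
    have l\<delta>: "\<delta> (\<gamma> t) \<le> l t" "0 < l t" "l t \<le> M" if "a \<le> t" "t \<le> b" for t
      using half_space_ge_\<delta>[OF \<nu> inD[OF that]] \<delta>_pos[OF inD[OF that]] half_space_le_M[OF p \<nu>(1) inD[OF that]]
      by (auto simp: l_def)
    have cg: "continuous_on {a..b} \<gamma>" using \<gamma> by (simp add: pw_curve_def)
    have cl: "continuous_on {a..b} l"
      using cg unfolding l_def by (intro continuous_intros) auto
    define E where "E t = norm (\<gamma> t - \<gamma> a)" for t
    define f where "f t = E t - u0 * l t powr (1 / m)" for t
    have cf: "continuous_on {a..b} f"
      unfolding f_def E_def
    proof (intro continuous_intros cl cg ballI)
      show "l t \<noteq> 0" if "t \<in> {a..b}" for t using l\<delta>(2)[of t] that by auto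
    qed
    define T where "T = {t \<in> {a..b}. f t \<le> 0}"
    have aT: "a \<in> T" using ab u0 by (simp add: T_def f_def E_def)
    have "closed T"
      unfolding T_def using continuous_closed_preimage[OF cf closed_atLeastAtMost, of "{..0}"]
      by (simp add: vimage_def Int_def)
    moreover have bdd: "bdd_above T" by (auto simp: T_def intro: bdd_aboveI[of _ b])
    ultimately have sT: "Sup T \<in> T" using aT closed_contains_Sup by blast
    define s where "s = Sup T"
    have s: "a \<le> s" "s \<le> b" "f s \<le> 0" using sT by (auto simp: T_def s_def)
    have gts: "f t > 0" if "s < t" "t \<le> b" for t
    proof (rule ccontr)
      assume "\<not> f t > 0"
      then have "t \<in> T" using that s by (simp add: T_def)
      then have "t \<le> s" unfolding s_def using bdd by (rule cSup_upper)
      then show False using that by simp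
    qed
    have up_to_s: "ln (l s) / 2 - c - ln (\<delta> (\<gamma> a)) / 2 \<le> A * rlen \<Omega> \<gamma> \<gamma>' a s"
    proof -
      have "\<bar>growth_fn B \<alpha> ((p - \<gamma> s) \<bullet> \<nu>) - growth_fn B \<alpha> ((p - \<gamma> a) \<bullet> \<nu>)\<bar> \<le> A * rlen \<Omega> \<gamma> \<gamma>' a s"
        by (rule growth[OF cmp pw_curve_subinterval[OF \<gamma>] klen_finite_subinterval[OF fin]])
          (use s nr \<nu> in auto)
      moreover have "growth_fn B \<alpha> ((p - \<gamma> a) \<bullet> \<nu>) \<le> ln (\<delta> (\<gamma> a)) / 2"
        unfolding pa by (rule growth_fn_le[OF par(3,4)])
      moreover have "ln (l s) / 2 - c \<le> growth_fn B \<alpha> ((p - \<gamma> s) \<bullet> \<nu>)"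
        unfolding c_def l_def[symmetric] by (rule growth_fn_ge) (use l\<delta>[OF s(1,2)] par in auto)
      ultimately show ?thesis by linarith
    qed
    have ls: "0 < l s" using l\<delta>(2)[OF s(1,2)] .
    have lnu: "m / 2 * ln (u0 * l s powr (1 / m)) = m / 2 * ln u0 + ln (l s) / 2"
      using u0 ls m by (simp add: ln_mult ln_powr field_simps)
    show ?thesis
    proof (cases "s = b")
      case True
      \<comment> \<open>The curve ends before the switch: its displacement forces a large height at
        the end.\<close>
      have "\<rho> \<le> u0 * l s powr (1 / m)" using s(3) far True by (simp add: f_def E_def)
      then have "ln \<rho> \<le> ln (u0 * l s powr (1 / m))" using \<rho> by simp
      then have "m / 2 * ln \<rho> \<le> m / 2 * ln u0 + ln (l s) / 2"
        unfolding lnu[symmetric] using m by (intro mult_left_mono) auto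
      then show ?thesis using up_to_s unfolding True right_diff_distrib by linarith
    next
      case False
      then have sb: "s < b" using s by simp
      \<comment> \<open>After \<open>s\<close> the function \<open>f\<close> is positive, so a zero
        in \<open>{s..b}\<close> can only be \<open>s\<close> itself; this gives the equality by
        which the two potentials are matched.\<close>
      have "\<exists>t\<ge>s. t \<le> b \<and> f t = 0"
        by (rule IVT') (use s sb gts[of b] in \<open>auto intro: continuous_on_subset[OF cf]\<close>)
      then obtain t where t: "s \<le> t" "t \<le> b" "f t = 0" by blast
      then have "t = s" using gts[of t] by (cases "s = t") auto
      then have fs: "E s = u0 * l s powr (1 / m)" using t by (simp add: f_def)
      have Epos: "E t > 0" "u0 * l t powr (1 / m) \<le> E t" if "s \<le> t" "t \<le> b" for t
      proof -
        have "0 < u0 * l t powr (1 / m)" using u0 l\<delta>(2)[of t] that s by simp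
        moreover show "u0 * l t powr (1 / m) \<le> E t"
          using gts[of t] fs that by (cases "s = t") (auto simp: f_def)
        ultimately show "E t > 0" by simp
      qed
      \<comment> \<open>The square avoids differentiating the norm: \<open>m / 4 * ln q\<close> is
        \<open>m / 2 * ln E\<close>.\<close>
      define q where "q t = (\<gamma> t - \<gamma> a) \<bullet> (\<gamma> t - \<gamma> a)" for t
      have qE: "q t = (E t)\<^sup>2" for t by (simp add: q_def E_def power2_norm_eq_inner)
      have qpos: "q t > 0" if "s \<le> t" "t \<le> b" for t using Epos(1)[OF that] by (simp add: qE)
      have cq: "continuous_on {s..b} q"
        unfolding q_def by (intro continuous_intros continuous_on_subset[OF cg]) (use s in auto)
      have sub: "pw_curve \<Omega> \<gamma> \<gamma>' S s b" using pw_curve_subinterval[OF \<gamma> s(1,2)] by simp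
      have fin2: "klen \<Omega> \<gamma> \<gamma>' s b < \<infinity>" using klen_finite_subinterval[OF fin s(1)] by simp
      have "\<bar>m / 4 * ln (q b) - m / 4 * ln (q s)\<bar> \<le> A * rlen \<Omega> \<gamma> \<gamma>' s b"
      proof (rule curve_increment[OF sub fin2, where u' = "\<lambda>t. m / 4 * (1 / q t * (2 * (\<gamma>' t \<bullet> (\<gamma> t - \<gamma> a))))"])
        show "continuous_on {s..b} (\<lambda>t. m / 4 * ln (q t))"
        proof (intro continuous_intros cq ballI)
          show "q t \<noteq> 0" if "t \<in> {s..b}" for t using qpos[of t] that by auto
        qed
        show "continuous_on ({s<..<b} - S) (\<lambda>t. m / 4 * (1 / q t * (2 * (\<gamma>' t \<bullet> (\<gamma> t - \<gamma> a)))))"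
        proof -
          have "continuous_on ({s<..<b} - S) q" using cq by (rule continuous_on_subset) auto
          moreover have "continuous_on ({s<..<b} - S) \<gamma>'" using sub by (simp add: pw_curve_def)
          moreover have "continuous_on ({s<..<b} - S) \<gamma>" using cg by (rule continuous_on_subset) (use s in auto)
          moreover have "q t \<noteq> 0" if "t \<in> {s<..<b} - S" for t
            using qpos[of t] that by auto
          ultimately show ?thesis by (intro continuous_intros) auto
        qed
        fix t assume t: "t \<in> {s<..<b} - S"
        then have t': "s \<le> t" "t \<le> b" "a \<le> t" using s by auto
        have "(\<gamma> has_vector_derivative \<gamma>' t) (at t)" using sub t by (auto simp: pw_curve_def)
        then have "(q has_real_derivative 2 * (\<gamma>' t \<bullet> (\<gamma> t - \<gamma> a))) (at t)"
          unfolding q_def by (rule has_real_derivative_inner)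
        from DERIV_cmult[OF DERIV_chain2[OF DERIV_ln_divide[OF qpos[OF t'(1,2)]] this]]
        show "((\<lambda>t. m / 4 * ln (q t)) has_real_derivative m / 4 * (1 / q t * (2 * (\<gamma>' t \<bullet> (\<gamma> t - \<gamma> a))))) (at t)" .
        let ?K = "kobayashi_metric \<Omega> (\<gamma> t) (\<gamma>' t)"
        have g: "\<gamma> t \<in> \<Omega>" "\<gamma> t \<in> D" "\<gamma> t \<in> ball \<xi> R1" using inD nr pw_curve_mem[OF \<gamma>] t' by auto
        have K0: "?K \<ge> 0" using kobayashi_metric_nonneg[OF open_\<Omega> g(1)] .
        have \<delta>0: "\<delta> (\<gamma> t) > 0" using \<delta>_pos[OF g(2)] .
        have "\<delta> (\<gamma> t) \<le> M" using l\<delta>[of t] t' by simp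
        then have "\<delta> (\<gamma> t) powr \<alpha> \<le> M powr \<alpha>" using \<delta>0 par by (intro powr_mono2) auto
        then have le1: "1 + B * \<delta> (\<gamma> t) powr \<alpha> \<le> 1 + B * M powr \<alpha>" using par by (simp add: mult_left_mono)
        have le2: "\<delta> (\<gamma> t) powr (1 / m) \<le> l t powr (1 / m)" using \<delta>0 l\<delta>[of t] t' m by (intro powr_mono2) auto
        have "norm (\<gamma>' t) \<le> C1 * \<delta> (\<gamma> t) powr (1 / m) * kobayashi_metric D (\<gamma> t) (\<gamma>' t)"
          unfolding \<delta>_def by (rule metric_lower[OF g(2)])
        also have "\<dots> \<le> C1 * l t powr (1 / m) * (A * (1 + B * \<delta> (\<gamma> t) powr \<alpha>) * ?K)"
          using C1 le2 by (intro mult_mono K g kobayashi_metric_nonneg[OF open_D]) auto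
        also have "\<dots> \<le> C1 * l t powr (1 / m) * (A * (1 + B * M powr \<alpha>) * ?K)"
          using C1 par K0 le1 by (intro mult_left_mono mult_right_mono) auto
        also have "\<dots> = 2 / m * (u0 * l t powr (1 / m)) * (A * ?K)"
          using m by (simp add: u0_def C2_def field_simps)
        also have "\<dots> \<le> 2 / m * E t * (A * ?K)"
          using Epos(2)[OF t'(1,2)] m K0 par by (intro mult_right_mono mult_left_mono) auto
        finally have n: "norm (\<gamma>' t) \<le> 2 / m * E t * (A * ?K)" .
        have E0: "E t > 0" using Epos(1)[OF t'(1,2)] .
        have "\<bar>\<gamma>' t \<bullet> (\<gamma> t - \<gamma> a)\<bar> \<le> norm (\<gamma>' t) * E t"
          unfolding E_def by (rule Cauchy_Schwarz_ineq2)
        also have "\<dots> \<le> 2 / m * E t * (A * ?K) * E t" using n E0 by (intro mult_right_mono) auto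
        finally have "m / 4 * (1 / q t * (2 * \<bar>\<gamma>' t \<bullet> (\<gamma> t - \<gamma> a)\<bar>)) \<le> m / 4 * (1 / q t * (2 * (2 / m * E t * (A * ?K) * E t)))"
          using m qpos[OF t'(1,2)] by (intro mult_left_mono) auto
        also have "\<dots> = A * ?K" unfolding qE using m E0 by (simp add: power2_eq_square)
        finally show "\<bar>m / 4 * (1 / q t * (2 * (\<gamma>' t \<bullet> (\<gamma> t - \<gamma> a))))\<bar> \<le> A * ?K"
          using m qpos[OF t'(1,2)] by (simp add: abs_mult)
      qed (use par in auto)
      moreover have "m / 4 * ln (q t) = m / 2 * ln (E t)" if "s \<le> t" "t \<le> b" for t
        using Epos(1)[OF that] by (simp add: qE ln_realpow)
      ultimately have "m / 2 * ln (E b) - m / 2 * ln (E s) \<le> A * rlen \<Omega> \<gamma> \<gamma>' s b"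
        using sb by (smt (verit))
      moreover have "m / 2 * ln \<rho> \<le> m / 2 * ln (E b)"
      proof (rule mult_left_mono)
        have "\<rho> \<le> E b" using far by (simp add: E_def)
        then show "ln \<rho> \<le> ln (E b)" using \<rho> by simp
      qed (use m in simp)
      moreover have "A * rlen \<Omega> \<gamma> \<gamma>' a b = A * rlen \<Omega> \<gamma> \<gamma>' a s + A * rlen \<Omega> \<gamma> \<gamma>' s b"
        using rlen_split[OF fin s(1,2)] by (simp add: distrib_left)
      moreover have "m / 2 * ln (E s) = m / 2 * ln u0 + ln (l s) / 2" using lnu unfolding fs .
      ultimately show ?thesis using up_to_s unfolding right_diff_distrib by linarith
    qed
  qed
  show ?thesis using main by blast
qed

text \<open>Cutting the curve at its first exit from the ball of radius \<open>\<rho>\<close> about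
  its start keeps the part used inside \<open>ball \<xi> R1\<close>, where the comparison holds,
  whatever the curve does afterwards.\<close>

lemma exit_ball_cost:
  assumes cmp: "comparison R1 A B \<alpha>" and \<rho>: "0 < \<rho>" "\<rho> < R1"
  shows "\<exists>C. \<forall>\<gamma> \<gamma>' S a b. pw_curve \<Omega> \<gamma> \<gamma>' S a b \<longrightarrow> klen \<Omega> \<gamma> \<gamma>' a b < \<infinity> \<longrightarrow>
    dist \<xi> (\<gamma> a) + \<rho> < R1 \<longrightarrow> \<rho> \<le> norm (\<gamma> b - \<gamma> a) \<longrightarrow>
    - ln (\<delta> (\<gamma> a)) / 2 - C \<le> A * rlen \<Omega> \<gamma> \<gamma>' a b"
proof -
  have A: "A \<ge> 1" using cmp by (simp add: comparison_def)
  obtain C where C: "\<And>\<gamma> \<gamma>' S a b. pw_curve \<Omega> \<gamma> \<gamma>' S a b \<Longrightarrow> klen \<Omega> \<gamma> \<gamma>' a b < \<infinity> \<Longrightarrow>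
    (\<And>t. a \<le> t \<Longrightarrow> t \<le> b \<Longrightarrow> \<gamma> t \<in> ball \<xi> R1) \<Longrightarrow> \<rho> \<le> norm (\<gamma> b - \<gamma> a) \<Longrightarrow>
    - ln (\<delta> (\<gamma> a)) / 2 - C \<le> A * rlen \<Omega> \<gamma> \<gamma>' a b"
    using exit_cost[OF cmp \<rho>(1)] by blast
  have "- ln (\<delta> (\<gamma> a)) / 2 - C \<le> A * rlen \<Omega> \<gamma> \<gamma>' a b"
    if \<gamma>: "pw_curve \<Omega> \<gamma> \<gamma>' S a b" and fin: "klen \<Omega> \<gamma> \<gamma>' a b < \<infinity>"
      and st: "dist \<xi> (\<gamma> a) + \<rho> < R1" and far: "\<rho> \<le> norm (\<gamma> b - \<gamma> a)" for \<gamma> \<gamma>' S a b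
  proof -
    have ab: "a \<le> b" and cg: "continuous_on {a..b} \<gamma>" using \<gamma> by (auto simp: pw_curve_def)
    obtain s where s: "a \<le> s" "s \<le> b" "norm (\<gamma> s - \<gamma> a) = \<rho>"
      "\<And>t. a \<le> t \<Longrightarrow> t \<le> s \<Longrightarrow> norm (\<gamma> t - \<gamma> a) \<le> \<rho>"
      using first_exit[OF ab cg \<rho>(1) far] by blast
    have "- ln (\<delta> (\<gamma> a)) / 2 - C \<le> A * rlen \<Omega> \<gamma> \<gamma>' a s"
    proof (rule C)
      show "pw_curve \<Omega> \<gamma> \<gamma>' S a s" using pw_curve_subinterval[OF \<gamma> order_refl s(1,2)] .
      show "klen \<Omega> \<gamma> \<gamma>' a s < \<infinity>" using klen_finite_subinterval[OF fin order_refl s(2)] .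
      show "\<rho> \<le> norm (\<gamma> s - \<gamma> a)" using s(3) by simp
      show "\<gamma> t \<in> ball \<xi> R1" if "a \<le> t" "t \<le> s" for t
        using s(4)[OF that] st dist_triangle[of \<xi> "\<gamma> t" "\<gamma> a"]
        by (simp add: dist_norm norm_minus_commute)
    qed
    also have "\<dots> \<le> A * rlen \<Omega> \<gamma> \<gamma>' a b"
      using A rlen_mono_interval[OF fin order_refl s(2)] by (intro mult_left_mono) auto
    finally show ?thesis .
  qed
  then show ?thesis by blast
qed

section \<open>The bootstrap for the comparison of the metrics\<close>

lemma comparison_0: "\<exists>A. comparison (R / 2) A 0 1"
proof -
  \<comment> \<open>A curve that leaves \<open>ball z (R / 2)\<close> has length at least
    \<open>R / (2 * M)\<close>, which is \<open>- ln q / 2\<close>.\<close>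
  define q where "q = exp (- (R / M))"
  have q: "0 < q" "q < 1" using R M by (auto simp: q_def)
  have "kobayashi_metric D z v \<le> (1 + q) / (1 - q) * kobayashi_metric \<Omega> z v"
    if z: "z \<in> \<Omega>" "z \<in> ball \<xi> (R / 2)" for z v
  proof (rule disc_localization[OF open_\<Omega> z(1) _ q])
    have "ball z (R / 2) \<subseteq> ball \<xi> R"
    proof
      fix y assume "y \<in> ball z (R / 2)"
      then show "y \<in> ball \<xi> R" using z(2) dist_triangle[of \<xi> y z] by simp
    qed
    then show "\<Omega> \<inter> ball z (R / 2) \<subseteq> D" using near by blast
    fix \<gamma> \<gamma>' S assume \<gamma>: "pw_curve \<Omega> \<gamma> \<gamma>' S 0 1" "\<gamma> 0 = z" "\<gamma> 1 \<notin> ball z (R / 2)"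
    have "ennreal (- ln q / 2) \<le> ennreal (norm (\<gamma> 0 - \<gamma> 1) / M)"
      using \<gamma> M by (intro ennreal_leI) (simp add: q_def dist_norm divide_right_mono field_simps)
    also have "\<dots> \<le> kdist \<Omega> (\<gamma> 0) (\<gamma> 1)" by (rule kdist_ge_norm[OF open_\<Omega> M diam])
    also have "\<dots> \<le> klen \<Omega> \<gamma> \<gamma>' 0 1" by (rule kdist_le_klen[OF open_\<Omega> \<gamma>(1)])
    finally show "ennreal (- ln q / 2) \<le> klen \<Omega> \<gamma> \<gamma>' 0 1" .
  qed
  then have "comparison (R / 2) ((1 + q) / (1 - q)) 0 1"
    using q R by (auto simp: comparison_def)
  then show ?thesis by blast
qed

text \<open>The leading constant becomes 1 whatever \<open>A\<close> was, and \<open>A\<close>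
  survives only in the exponent: \<open>disc_localization\<close> is applied with \<open>q\<close>
  of order \<open>\<delta> z powr (1 / A)\<close>, and
  \<open>(1 + q) / (1 - q) \<le> 1 + 4 * q\<close> for \<open>q \<le> 1 / 2\<close>.\<close>

lemma comparison_improve:
  assumes cmp: "comparison R1 A B \<alpha>"
  shows "\<exists>R2 B'. R2 \<le> R1 \<and> comparison R2 1 B' (1 / A)"
proof -
  have par: "0 < R1" "R1 \<le> R" "A \<ge> 1" using cmp by (auto simp: comparison_def)
  define \<rho> where "\<rho> = R1 / 2"
  obtain C where C: "\<And>\<gamma> \<gamma>' S a b. pw_curve \<Omega> \<gamma> \<gamma>' S a b \<Longrightarrow> klen \<Omega> \<gamma> \<gamma>' a b < \<infinity> \<Longrightarrow>
    dist \<xi> (\<gamma> a) + \<rho> < R1 \<Longrightarrow> \<rho> \<le> norm (\<gamma> b - \<gamma> a) \<Longrightarrow>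
    - ln (\<delta> (\<gamma> a)) / 2 - C \<le> A * rlen \<Omega> \<gamma> \<gamma>' a b"
    using exit_ball_cost[OF cmp, of \<rho>] par by (auto simp: \<rho>_def)
  \<comment> \<open>The second bound on \<open>R2\<close> makes \<open>q \<le> 1 / 2\<close>
    below.\<close>
  define R2 where "R2 = min (R1 / 2) ((1 / 2) powr A * exp (- (2 * C)))"
  define B' where "B' = 4 * exp (2 * C / A)"
  have R2: "0 < R2" "R2 \<le> R1 / 2" "R2 \<le> (1 / 2) powr A * exp (- (2 * C))" using par by (auto simp: R2_def)
  have "kobayashi_metric D z v \<le> 1 * (1 + B' * \<delta> z powr (1 / A)) * kobayashi_metric \<Omega> z v"
    if z: "z \<in> \<Omega>" "z \<in> ball \<xi> R2" for z v
  proof -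
    have zD: "z \<in> D" using z R2 par by (intro near_D) auto
    have \<delta>0: "0 < \<delta> z" using \<delta>_pos[OF zD] .
    have "\<delta> z < R2" using \<delta>_le[of z] z(2) by (simp add: dist_commute)
    \<comment> \<open>The solution of \<open>- ln q / 2 = (- ln (\<delta> z) / 2 - C) / A\<close>,
      the exit cost divided by \<open>A\<close>.\<close>
    define q where "q = (exp (2 * C) * \<delta> z) powr (1 / A)"
    have q0: "0 < q" using \<delta>0 by (simp add: q_def)
    have "exp (2 * C) * \<delta> z \<le> exp (2 * C) * ((1 / 2) powr A * exp (- (2 * C)))"
      using \<open>\<delta> z < R2\<close> R2(3) by (intro mult_left_mono) auto
    also have "\<dots> = (1 / 2) powr A" by (simp add: exp_minus field_simps)
    finally have "q \<le> ((1 / 2) powr A) powr (1 / A)"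
      unfolding q_def using \<delta>0 par by (intro powr_mono2) auto
    then have q: "q \<le> 1 / 2" using par by (simp add: powr_powr)
    have lnq: "- ln q / 2 = (- ln (\<delta> z) / 2 - C) / A"
      using \<delta>0 par by (simp add: q_def ln_powr ln_mult field_simps)
    have "kobayashi_metric D z v \<le> (1 + q) / (1 - q) * kobayashi_metric \<Omega> z v"
    proof (rule disc_localization[OF open_\<Omega> z(1) _ q0])
      show "q < 1" using q by simp
      have "ball z \<rho> \<subseteq> ball \<xi> R1"
      proof
        fix y assume "y \<in> ball z \<rho>"
        then show "y \<in> ball \<xi> R1"
          using z(2) R2(2) dist_triangle[of \<xi> y z] by (simp add: \<rho>_def)
      qed
      then show "\<Omega> \<inter> ball z \<rho> \<subseteq> D" using near par by (auto simp: subset_iff)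
      fix \<gamma> \<gamma>' S assume \<gamma>: "pw_curve \<Omega> \<gamma> \<gamma>' S 0 1" "\<gamma> 0 = z" "\<gamma> 1 \<notin> ball z \<rho>"
      show "ennreal (- ln q / 2) \<le> klen \<Omega> \<gamma> \<gamma>' 0 1"
      proof (cases "klen \<Omega> \<gamma> \<gamma>' 0 1 < \<infinity>")
        case True
        have "- ln (\<delta> (\<gamma> 0)) / 2 - C \<le> A * rlen \<Omega> \<gamma> \<gamma>' 0 1"
          by (rule C[OF \<gamma>(1) True]) (use \<gamma> z R2 in \<open>auto simp: \<rho>_def dist_norm norm_minus_commute\<close>)
        then have "- ln q / 2 \<le> rlen \<Omega> \<gamma> \<gamma>' 0 1"
          unfolding lnq using par \<gamma>(2) by (simp add: divide_le_eq mult.commute)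
        then have "ennreal (- ln q / 2) \<le> ennreal (rlen \<Omega> \<gamma> \<gamma>' 0 1)" by (rule ennreal_leI)
        also have "\<dots> = klen \<Omega> \<gamma> \<gamma>' 0 1" using True by (simp add: rlen_def less_top)
        finally show ?thesis .
      qed (simp add: not_less top_unique)
    qed
    also have "\<dots> \<le> (1 + 4 * q) * kobayashi_metric \<Omega> z v"
    proof (rule mult_right_mono)
      have "q * (1 - 2 * q) \<ge> 0" using q q0 by (intro mult_nonneg_nonneg) auto
      then have "1 + q \<le> (1 + 4 * q) * (1 - q)" by (simp add: algebra_simps)
      then show "(1 + q) / (1 - q) \<le> 1 + 4 * q" using q by (simp add: divide_le_eq)
    qed (rule kobayashi_metric_nonneg[OF open_\<Omega> z(1)])
    also have "4 * q = B' * \<delta> z powr (1 / A)"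
      using \<delta>0 by (simp add: q_def B'_def powr_mult exp_powr_real)
    finally show ?thesis by simp
  qed
  moreover have "B' \<ge> 0" by (simp add: B'_def)
  ultimately have "comparison R2 1 B' (1 / A)"
    using R2 par by (auto simp: comparison_def)
  then show ?thesis using R2 par by (intro exI[of _ R2] exI[of _ B']) auto
qed

lemma comparison_final: "\<exists>R1 B. comparison R1 1 B 1"
proof -
  obtain A where "comparison (R / 2) A 0 1" using comparison_0 by blast
  then obtain R2 B where "comparison R2 1 B (1 / A)" using comparison_improve by blast
  \<comment> \<open>This round starts from the leading constant 1, so its exponent
    \<open>1 / A\<close> is 1.\<close>
  then show ?thesis using comparison_improve by fastforce
qed

end

section \<open>The distance near a Dini-smooth boundary\<close>

lemma kdist_sym_le:
  assumes D: "open D"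
  shows "kdist D y x \<le> kdist D x y"
proof (rule dense_ge)
  fix c assume "kdist D x y < c"
  then obtain \<gamma> \<gamma>' S where *: "pw_curve D \<gamma> \<gamma>' S 0 1" "\<gamma> 0 = x" "\<gamma> 1 = y" "klen D \<gamma> \<gamma>' 0 1 < c"
    by (rule kdist_less_curve)
  let ?g = "\<lambda>t. \<gamma> (1 + - 1 * t)" let ?g' = "\<lambda>t. - 1 *\<^sub>R \<gamma>' (1 + - 1 * t)"
  have pw: "pw_curve D ?g ?g' ((\<lambda>u. (u - 1) / - 1) ` S) 0 1"
    by (rule pw_curve_affine[OF *(1)]) auto
  have "kdist D (?g 0) (?g 1) \<le> klen D ?g ?g' 0 1" by (rule kdist_le_klen[OF D pw])
  also have "\<dots> \<le> klen D \<gamma> \<gamma>' 0 1" by (rule klen_affine_le[OF D *(1)]) auto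
  finally show "kdist D y x \<le> c" using * by simp
qed

lemma kdist_sym: "open D \<Longrightarrow> kdist D y x = kdist D x y"
  by (intro antisym kdist_sym_le)

text \<open>Outside \<open>closure D\<close> the metric projection serves, with
  \<open>q - q'\<close> as normal. A point of \<open>closure D\<close> outside \<open>D\<close> is
  already on the frontier; its projection would give no direction, and a separating hyperplane is
  used instead.\<close>

lemma convex_open_nearby_support:
  fixes D :: "'a::euclidean_space set"
  assumes D: "open D" "convex D" "q \<notin> D" and p: "p \<in> closure D"
  obtains q' \<nu> where "q' \<in> frontier D" "norm \<nu> = 1" "\<And>w. w \<in> D \<Longrightarrow> (w - q') \<bullet> \<nu> < 0"
    "0 \<le> (q - q') \<bullet> \<nu>" "dist q q' \<le> dist q p"
proof (cases "q \<in> closure D")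
  case True
  have "D \<noteq> {}" using p by auto
  then obtain \<nu> where \<nu>: "norm \<nu> = 1" "\<And>w. w \<in> D \<Longrightarrow> (w - q) \<bullet> \<nu> < 0"
    using convex_open_support[OF D(2,1,3)] by metis
  have "q \<in> frontier D" using True D by (auto simp: frontier_def interior_open)
  then show ?thesis using that[of q \<nu>] \<nu> by simp
next
  case False
  define q' where "q' = closest_point (closure D) q"
  have ne: "closure D \<noteq> {}" using p by (metis empty_iff)
  have q': "q' \<in> closure D" "dist q q' \<le> dist q p"
    unfolding q'_def using closest_point_in_set[OF closed_closure ne] closest_point_le[OF closed_closure p] by auto
  define \<nu> where "\<nu> = (q - q') /\<^sub>R norm (q - q')"
  have nz: "q - q' \<noteq> 0" using False q' by auto
  have n1: "norm \<nu> = 1" using nz by (simp add: \<nu>_def)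
  have le: "(w - q') \<bullet> \<nu> \<le> 0" if "w \<in> D" for w
  proof -
    have "w \<in> closure D" using that closure_subset by blast
    then have "(q - q') \<bullet> (w - q') \<le> 0"
      unfolding q'_def by (intro closest_point_dot convex_closure D closed_closure)
    then show ?thesis by (simp add: \<nu>_def inner_commute mult_nonneg_nonpos)
  qed
  have lt: "(w - q') \<bullet> \<nu> < 0" if "w \<in> D" for w
    by (rule open_half_space_strict[OF D(1) that n1]) (rule le)
  then have "q' \<notin> D" by force
  then have "q' \<in> frontier D" using q' D by (auto simp: frontier_def interior_open)
  moreover have "0 \<le> (q - q') \<bullet> \<nu>" by (simp add: \<nu>_def)
  ultimately show ?thesis using that[of q' \<nu>] n1 lt q' by blast
qed

text \<open>\<open>n\<close> is the only supporting direction at boundary points near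
  \<open>\<xi>\<close>, and \<open>\<omega>\<close> may be any monotone majorant of its oscillation
  with finite Dini integral; monotonicity supplies both measurability and the comparison of
  scales.\<close>

locale dini_model = local_model \<Omega> D \<xi> m C1 R M for \<Omega> D :: "(complex ^ 'n) set" and \<xi> m C1 R M +
  fixes n :: "complex ^ 'n \<Rightarrow> complex ^ 'n" and \<omega> :: "real \<Rightarrow> real"
  assumes normal: "\<And>p \<nu>. p \<in> frontier D \<Longrightarrow> p \<in> ball \<xi> R \<Longrightarrow> norm \<nu> = 1 \<Longrightarrow>
      (\<And>w. w \<in> D \<Longrightarrow> (w - p) \<bullet> \<nu> < 0) \<Longrightarrow> \<nu> = n p"
    and modulus: "\<And>p q t. p \<in> frontier D \<Longrightarrow> p \<in> ball \<xi> R \<Longrightarrow> q \<in> frontier D \<Longrightarrow> q \<in> ball \<xi> R \<Longrightarrow>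
      norm (p - q) < t \<Longrightarrow> norm (n p - n q) \<le> \<omega> t"
    and mono_\<omega>: "mono \<omega>" and \<omega>_nonneg: "\<And>t. 0 \<le> \<omega> t"
    and dini: "(\<integral>\<^sup>+ t \<in> {0<..<1}. ennreal (\<omega> t / t) \<partial>lborel) < \<infinity>"
begin

lemma normal_unit:
  assumes "p \<in> frontier D" "p \<in> ball \<xi> R"
  shows "norm (n p) = 1" "\<And>w. w \<in> D \<Longrightarrow> (w - p) \<bullet> n p < 0"
proof -
  have "p \<notin> D" using assms(1) open_D by (auto simp: frontier_def interior_open)
  moreover have "D \<noteq> {}" using xi by auto
  ultimately obtain \<nu> where \<nu>: "norm \<nu> = 1" "\<And>w. w \<in> D \<Longrightarrow> (w - p) \<bullet> \<nu> < 0"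
    using convex_open_support[OF convex_D open_D] by metis
  then have "\<nu> = n p" using normal[OF assms] by blast
  then show "norm (n p) = 1" "\<And>w. w \<in> D \<Longrightarrow> (w - p) \<bullet> n p < 0" using \<nu> by auto
qed

text \<open>If \<open>p - v\<close> were outside \<open>D\<close>, its projection onto \<open>closure D\<close> would be a boundary point near
  \<open>p\<close> whose normal has a nonpositive product with \<open>v\<close>.\<close>

lemma inner_cone:
  assumes p: "p \<in> frontier D" "p \<in> ball \<xi> (R / 4)" and v: "norm v < R / 8"
    and cone: "norm v * \<omega> (3 * norm v) < v \<bullet> n p"
  shows "p - v \<in> D"
proof (rule ccontr)
  assume "p - v \<notin> D"
  moreover have pc: "p \<in> closure D" using p(1) by (simp add: frontier_def)
  ultimately obtain q \<nu> where q: "q \<in> frontier D" "norm \<nu> = 1" "\<And>w. w \<in> D \<Longrightarrow> (w - q) \<bullet> \<nu> < 0"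
    "0 \<le> (p - v - q) \<bullet> \<nu>" "dist (p - v) q \<le> dist (p - v) p"
    using convex_open_nearby_support[OF open_D convex_D] by metis
  have v0: "v \<noteq> 0" using cone by auto
  \<comment> \<open>The projection \<open>q\<close> is no farther from \<open>p - v\<close> than
    \<open>p\<close> is, whence the factor 2; the 3 in the hypothesis absorbs the strict inequality
    in \<open>modulus\<close>.\<close>
  have dpq: "norm (p - q) \<le> 2 * norm v"
    using q(5) norm_triangle_ineq[of "p - v - q" v] by (simp add: dist_norm)
  have pR: "p \<in> ball \<xi> R" using p(2) R by simp
  have qR: "q \<in> ball \<xi> R"
    using dpq v p(2) R dist_triangle[of \<xi> q p] by (simp add: dist_norm)
  have "\<nu> = n q" by (rule normal[OF q(1) qR q(2)]) (rule q(3))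
  have "closure D \<subseteq> {w. \<nu> \<bullet> w \<le> \<nu> \<bullet> q}"
  proof (rule closure_minimal)
    show "D \<subseteq> {w. \<nu> \<bullet> w \<le> \<nu> \<bullet> q}"
    proof
      fix w assume "w \<in> D"
      from q(3)[OF this] show "w \<in> {w. \<nu> \<bullet> w \<le> \<nu> \<bullet> q}"
        by (simp add: inner_diff_left inner_commute[of \<nu>])
    qed
    show "closed {w. \<nu> \<bullet> w \<le> \<nu> \<bullet> q}" by (rule closed_halfspace_le)
  qed
  then have "\<nu> \<bullet> p \<le> \<nu> \<bullet> q" using pc by blast
  then have "v \<bullet> \<nu> \<le> 0" using q(4) by (simp add: inner_diff_left inner_commute[of \<nu>])
  then have "v \<bullet> n p \<le> v \<bullet> (n p - n q)" using \<open>\<nu> = n q\<close> by (simp add: inner_diff_right)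
  also have "\<dots> \<le> norm v * norm (n p - n q)" by (rule norm_cauchy_schwarz)
  also have "\<dots> \<le> norm v * \<omega> (3 * norm v)"
    using dpq v0 by (intro mult_left_mono modulus[OF p(1) pR q(1) qR]) (auto intro: le_less_trans)
  finally show False using cone by simp
qed

text \<open>If \<open>\<omega>\<close> stayed above \<open>1 / 2\<close>, the integrand would exceed
  \<open>1 / (2 * t)\<close> and the Dini integral would diverge.\<close>

lemma \<omega>_small: "\<exists>t>0. t < 1 \<and> \<omega> t \<le> 1 / 2"
proof (rule ccontr)
  assume "\<not> ?thesis"
  then have big: "\<omega> t > 1 / 2" if "0 < t" "t < 1" for t using that by (auto simp: not_le)
  define I where "I = (\<integral>\<^sup>+ t \<in> {0<..<1}. ennreal (\<omega> t / t) \<partial>lborel)"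
  obtain r where r: "I = ennreal r" "r \<ge> 0" using dini by (cases I) (auto simp: I_def)
  \<comment> \<open>With this \<open>e\<close> the integral of \<open>1 / (2 * t)\<close> over
    \<open>{e..1/2}\<close> is \<open>r + 1\<close>.\<close>
  define e where "e = exp (- (2 * r + 2)) / 2"
  have e: "0 < e" "e < 1 / 2" using r by (auto simp: e_def)
  have "ennreal (1 / 2 * ln (1 / 2) - 1 / 2 * ln e) = (\<integral>\<^sup>+t. ennreal (1 / 2 * (1 / t)) * indicator {e..1/2} t \<partial>lborel)"
    by (rule nn_integral_derivative[symmetric]) (use e in \<open>auto intro!: derivative_eq_intros\<close>)
  also have "\<dots> \<le> I"
    unfolding I_def
  proof (rule nn_integral_mono)
    fix t :: real
    show "ennreal (1 / 2 * (1 / t)) * indicator {e..1/2} t \<le> ennreal (\<omega> t / t) * indicator {0<..<1} t"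
      using e big[of t] by (auto split: split_indicator intro!: ennreal_leI simp: divide_right_mono field_simps)
  qed
  finally have "1 / 2 * ln (1 / 2) - 1 / 2 * ln e \<le> r" using r by (simp add: ennreal_le_iff)
  moreover have "ln e = - (2 * r + 2) + ln (1 / 2)" by (simp add: e_def ln_div)
  ultimately show False by (simp only:) argo
qed

text \<open>For \<open>norm e < h / 4\<close> the vector \<open>v = h *\<^sub>R n p + e\<close> has
  \<open>norm v < 5 * h / 4\<close> and \<open>v \<bullet> n p > 3 * h / 4\<close>, so it satisfies
  the condition of \<open>inner_cone\<close> as soon as \<open>\<omega> (3 * norm v)\<close> is at
  most \<open>1 / 2\<close>.\<close>

lemma inner_ball:
  "\<exists>h1>0. \<forall>p\<in>frontier D \<inter> ball \<xi> (R / 4). \<forall>h. 0 < h \<longrightarrow> h \<le> h1 \<longrightarrow> ball (p - h *\<^sub>R n p) (h / 4) \<subseteq> D"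
proof -
  obtain t0 where t0: "0 < t0" "\<omega> t0 \<le> 1 / 2" using \<omega>_small by blast
  define h1 where "h1 = min (R / 16) (t0 / 4)"
  have "ball (p - h *\<^sub>R n p) (h / 4) \<subseteq> D"
    if p: "p \<in> frontier D" "p \<in> ball \<xi> (R / 4)" and h: "0 < h" "h \<le> h1" for p h
  proof
    fix y assume "y \<in> ball (p - h *\<^sub>R n p) (h / 4)"
    define e where "e = p - h *\<^sub>R n p - y"
    have e: "norm e < h / 4" using \<open>y \<in> _\<close> by (simp add: e_def dist_norm)
    define v where "v = h *\<^sub>R n p + e"
    have n1: "norm (n p) = 1" using normal_unit(1)[OF p(1)] p(2) R by simp
    have nv: "norm v < 5 * h / 4" using norm_triangle_ineq[of "h *\<^sub>R n p" e] e h n1 by (simp add: v_def)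
    have "3 * norm v \<le> t0" using nv h by (simp add: h1_def)
    then have "\<omega> (3 * norm v) \<le> 1 / 2" using monoD[OF mono_\<omega>] t0 by (meson order_trans)
    then have "norm v * \<omega> (3 * norm v) \<le> norm v * (1 / 2)" by (rule mult_left_mono) simp
    also have "\<dots> < h - h / 4" using nv h(1) by simp
    also have "\<dots> < v \<bullet> n p"
      using Cauchy_Schwarz_ineq2[of e "n p"] e n1 by (simp add: v_def inner_add_left norm_eq_1 abs_le_iff)
    finally have "p - v \<in> D" by (intro inner_cone p) (use nv h in \<open>auto simp: h1_def\<close>)
    then show "y \<in> D" by (simp add: v_def e_def)
  qed
  moreover have "h1 > 0" using R t0 by (simp add: h1_def)
  ultimately show ?thesis by blast
qed

text \<open>A disc of centre \<open>s / b\<close> and radius \<open>s / b * sqrt (1 - b\<^sup>2)\<close> in the complex normal line lies in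
  the sector \<open>Re \<zeta> > b * norm \<zeta>\<close>; the choice of the centre makes its metric at \<open>s\<close> optimal up to a
  factor \<open>1 + O(b)\<close>.\<close>

lemma metric_normal:
  assumes p: "p \<in> frontier D" "p \<in> ball \<xi> (R / 4)" and s: "0 < s" "2 * sqrt s < R / 8"
    and b: "sqrt s \<le> b" "\<omega> (6 * sqrt s) \<le> b" "b \<le> 1 / 2"
  shows "kobayashi_metric D (p - s *\<^sub>R n p) (n p) \<le> (1 + 2 * b) / (2 * s)"
proof -
  have b0: "0 < b" using s b by (meson less_le_trans real_sqrt_gt_zero)
  have n1: "norm (n p) = 1" using normal_unit(1)[OF p(1)] p(2) R by simp
  define c where "c = s / b"
  have c0: "0 < c" and cb: "c * b = s" using s b0 by (auto simp: c_def)
  \<comment> \<open>This is the purpose of \<open>sqrt s \<le> b\<close>: points of the disc are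
    within \<open>2 * sqrt s\<close> of \<open>p\<close>, so that \<open>\<omega>\<close> is
    evaluated at most at \<open>6 * sqrt s\<close>.\<close>
  have cs: "c \<le> sqrt s"
  proof -
    have "sqrt s * sqrt s \<le> sqrt s * b" using b s by (intro mult_left_mono) auto
    then show ?thesis using b0 s by (simp add: c_def divide_le_eq)
  qed
  define \<rho> where "\<rho> = c * sqrt (1 - b\<^sup>2)"
  have b21: "0 < 1 - b\<^sup>2" "1 - b\<^sup>2 \<le> 1" using b0 b(3) by (auto simp: abs_square_less_1)
  have \<rho>0: "0 < \<rho>" and \<rho>c: "\<rho> \<le> c" using c0 b21 by (auto simp: \<rho>_def mult_left_le)
  have \<rho>2: "\<rho>\<^sup>2 = c\<^sup>2 * (1 - b\<^sup>2)" using b21 by (simp add: \<rho>_def power_mult_distrib)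
  define f where "f w = (p - c *\<^sub>R n p) + w *s (- \<rho> *\<^sub>R n p)" for w
  have inD: "(p - c *\<^sub>R n p) + w *s (- \<rho> *\<^sub>R n p) \<in> D" if w: "norm w < 1" for w
  proof -
    define \<zeta> where "\<zeta> = of_real c + of_real \<rho> * w"
    have eq: "(p - c *\<^sub>R n p) + w *s (- \<rho> *\<^sub>R n p) = p - \<zeta> *s n p"
    proof -
      have "c *\<^sub>R n p = of_real c *s n p" "- \<rho> *\<^sub>R n p = of_real (- \<rho>) *s n p"
        by (simp_all only: of_real_vector_scalar_mult)
      then show ?thesis by (simp only:) (simp add: \<zeta>_def vec_eq_iff algebra_simps)
    qed
    \<comment> \<open>Since \<open>c\<^sup>2 - \<rho>\<^sup>2 = (c * b)\<^sup>2\<close>, membership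
      in the disc reads \<open>(norm \<zeta>)\<^sup>2 + (c * b)\<^sup>2 < 2 * c * Re
      \<zeta>\<close>, and the inequality of the arithmetic and geometric means turns it into the
      sector condition.\<close>
    have "norm (\<zeta> - of_real c) < \<rho>" using w \<rho>0 by (simp add: \<zeta>_def norm_mult)
    then have "(norm (\<zeta> - of_real c))\<^sup>2 < \<rho>\<^sup>2" by (intro power_strict_mono) auto
    moreover have "(norm (\<zeta> - of_real c))\<^sup>2 = (norm \<zeta>)\<^sup>2 - 2 * c * Re \<zeta> + c\<^sup>2"
      unfolding cmod_power2 by (simp add: power2_eq_square algebra_simps)
    ultimately have "(norm \<zeta>)\<^sup>2 + (c * b)\<^sup>2 < 2 * c * Re \<zeta>" unfolding \<rho>2 by (simp add: power_mult_distrib algebra_simps)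
    moreover have "0 \<le> (norm \<zeta> - c * b)\<^sup>2" by simp
    then have "2 * norm \<zeta> * (c * b) \<le> (norm \<zeta>)\<^sup>2 + (c * b)\<^sup>2" by (simp add: power2_diff)
    ultimately have "c * (b * norm \<zeta>) < c * Re \<zeta>" by (simp add: mult_ac)
    then have sector: "b * norm \<zeta> < Re \<zeta>" using c0 by simp
    have n\<zeta>: "norm \<zeta> < 2 * sqrt s"
    proof -
      have "norm \<zeta> \<le> c + \<rho> * norm w" unfolding \<zeta>_def using norm_triangle_ineq[of "of_real c" "of_real \<rho> * w"] c0 \<rho>0
        by (simp add: norm_mult)
      also have "\<dots> < c + \<rho>" using w \<rho>0 by simp
      finally show ?thesis using \<rho>c cs by simp
    qed
    have nv: "norm (\<zeta> *s n p) = norm \<zeta>" using n1 by (simp add: norm_vector_scalar_mult_complex)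
    have "\<omega> (3 * norm \<zeta>) \<le> \<omega> (6 * sqrt s)" using n\<zeta> by (intro monoD[OF mono_\<omega>]) simp
    then have "norm \<zeta> * \<omega> (3 * norm \<zeta>) \<le> norm \<zeta> * b" using b(2) by (intro mult_left_mono) auto
    also have "\<dots> < (\<zeta> *s n p) \<bullet> n p"
      using sector n1 by (simp add: hprod_smult hprod_self mult.commute flip: Re_hprod)
    finally have "p - \<zeta> *s n p \<in> D"
      by (intro inner_cone p) (use nv n\<zeta> s in simp_all)
    then show ?thesis by (simp only: eq)
  qed
  note aff = holomorphic_disc_affine[of "p - c *\<^sub>R n p" "- \<rho> *\<^sub>R n p" D, OF inD, folded f_def[abs_def]]
  have hol: "holomorphic_disc D f" "disc_deriv f z = - \<rho> *\<^sub>R n p" for z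
    using aff by auto
  \<comment> \<open>The parameter at which the disc passes through
    \<open>p - s *\<^sub>R n p\<close>; the relation \<open>c * b = s\<close> brings
    \<open>1 - \<tau>\<^sup>2\<close> into closed form.\<close>
  define \<tau> where "\<tau> = (s - c) / \<rho>"
  have disc: "\<rho>\<^sup>2 - (s - c)\<^sup>2 = 2 * s * (c * (1 - b))"
    unfolding \<rho>2 cb[symmetric] by (simp add: power2_eq_square algebra_simps)
  have pos: "2 * s * (c * (1 - b)) > 0" using s c0 b(3) by simp
  have \<tau>: "1 - \<tau>\<^sup>2 = 2 * s * (c * (1 - b)) / \<rho>\<^sup>2"
    using \<rho>0 by (simp add: \<tau>_def power_divide divide_simps flip: disc)
  have "\<tau>\<^sup>2 < 1" using pos \<rho>0 \<tau> by (smt (verit) divide_pos_pos zero_less_power)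
  then have \<tau>1: "norm (complex_of_real \<tau>) < 1" by (simp add: abs_square_less_1)
  have "kobayashi_metric D (f (of_real \<tau>)) (of_real (- 1 / \<rho>) *s disc_deriv f (of_real \<tau>)) \<le>
      norm (complex_of_real (- 1 / \<rho>)) / (1 - (norm (complex_of_real \<tau>))\<^sup>2)"
    by (rule kobayashi_metric_disc_le[OF hol(1) \<tau>1])
  moreover have "f (of_real \<tau>) = p - s *\<^sub>R n p"
  proof -
    have "f (of_real \<tau>) = p - (c + \<tau> * \<rho>) *\<^sub>R n p"
      unfolding f_def of_real_vector_scalar_mult by (simp add: algebra_simps)
    then show ?thesis using \<rho>0 by (simp add: \<tau>_def)
  qed
  moreover have "of_real (- 1 / \<rho>) *s disc_deriv f (of_real \<tau>) = n p"
    unfolding hol(2) of_real_vector_scalar_mult using \<rho>0 by simp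
  moreover have "norm (complex_of_real (- 1 / \<rho>)) / (1 - (norm (complex_of_real \<tau>))\<^sup>2) = \<rho> / (2 * s * (c * (1 - b)))"
  proof -
    have "norm (complex_of_real (- 1 / \<rho>)) = 1 / \<rho>" using \<rho>0 by (simp add: norm_divide)
    moreover have "(norm (complex_of_real \<tau>))\<^sup>2 = \<tau>\<^sup>2" by simp
    moreover have "1 / \<rho> / (P / \<rho>\<^sup>2) = \<rho> / P" for P using \<rho>0 by (simp add: power2_eq_square)
    ultimately show ?thesis by (simp only: \<tau>)
  qed
  ultimately have "kobayashi_metric D (p - s *\<^sub>R n p) (n p) \<le> \<rho> / (2 * s * (c * (1 - b)))" by (simp only:)
  also have "\<dots> \<le> c / (2 * s * (c * (1 - b)))" using \<rho>c pos by (intro divide_right_mono) auto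
  also have "\<dots> = (1 / (1 - b)) / (2 * s)" using c0 by simp
  also have "\<dots> \<le> (1 + 2 * b) / (2 * s)"
  proof (rule divide_right_mono)
    have "0 \<le> b * (1 - 2 * b)" using b0 b(3) by simp
    then have "1 \<le> (1 + 2 * b) * (1 - b)" by (simp add: algebra_simps)
    then show "1 / (1 - b) \<le> 1 + 2 * b" using b(3) by (simp add: divide_le_eq)
  qed (use s in simp)
  finally show ?thesis .
qed

text \<open>The parametrization by \<open>\<sigma> = 6 * sqrt s\<close> turns the error term of \<open>metric_normal\<close> into the integrand
  of the Dini condition without a change of variables.\<close>

lemma kdist_normal:
  "\<exists>h2>0. \<exists>C\<ge>0. \<forall>p\<in>frontier D \<inter> ball \<xi> (R / 4). \<forall>d h. 0 < d \<longrightarrow> d \<le> h \<longrightarrow> h \<le> h2 \<longrightarrow>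
     kdist D (p - d *\<^sub>R n p) (p - h *\<^sub>R n p) \<le> ennreal (ln (h / d) / 2 + C)"
proof -
  obtain t0 where t0: "0 < t0" "t0 < 1" "\<omega> t0 \<le> 1 / 2" using \<omega>_small by blast
  obtain h1 where h1: "0 < h1" and ib: "\<And>p h. p \<in> frontier D \<Longrightarrow> p \<in> ball \<xi> (R / 4) \<Longrightarrow> 0 < h \<Longrightarrow> h \<le> h1 \<Longrightarrow>
    ball (p - h *\<^sub>R n p) (h / 4) \<subseteq> D"
    using inner_ball by blast
  define I where "I = (\<integral>\<^sup>+ t \<in> {0<..<1}. ennreal (\<omega> t / t) \<partial>lborel)"
  obtain r where r: "I = ennreal r" "r \<ge> 0" using dini by (cases I) (auto simp: I_def)
  \<comment> \<open>\<open>g\<close> bounds \<open>sqrt h\<close>, so that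
    \<open>\<sigma> = 6 * sqrt s\<close> stays below \<open>t0 / 2\<close>, where
    \<open>\<omega> \<le> 1 / 2\<close>.\<close>
  define g where "g = min (t0 / 12) (R / 32)"
  have g: "0 < g" "6 * g \<le> t0 / 2" "g \<le> R / 32" using t0 R by (auto simp: g_def)
  define h2 where "h2 = min h1 (g\<^sup>2)"
  have main: "kdist D (p - d *\<^sub>R n p) (p - h *\<^sub>R n p) \<le> ennreal (ln (h / d) / 2 + (1 + 2 * r))"
    if p: "p \<in> frontier D" "p \<in> ball \<xi> (R / 4)" and dh: "0 < d" "d \<le> h" "h \<le> h2" for p d h
  proof -
    have n1: "norm (n p) = 1" using normal_unit(1)[OF p(1)] p(2) R by simp
    define a where "a = 6 * sqrt d"
    define c where "c = 6 * sqrt h"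
    have "sqrt h \<le> g" using dh g by (intro real_le_lsqrt) (auto simp: h2_def)
    then have ac: "0 < a" "a \<le> c" "c \<le> 6 * g" using dh by (auto simp: a_def c_def)
    then have c1: "c \<le> t0 / 2" using g by simp
    define \<gamma> where "\<gamma> \<sigma> = p - (\<sigma>\<^sup>2 / 36) *\<^sub>R n p" for \<sigma>
    define \<gamma>' where "\<gamma>' \<sigma> = (- (\<sigma> / 18)) *\<^sub>R n p" for \<sigma>
    have \<sigma>h: "0 < \<sigma>\<^sup>2 / 36" "\<sigma>\<^sup>2 / 36 \<le> h1" if "a \<le> \<sigma>" "\<sigma> \<le> c" for \<sigma>
    proof -
      have "\<sigma>\<^sup>2 \<le> c\<^sup>2" using that ac by (intro power_mono) auto
      also have "c\<^sup>2 = 36 * h" using dh by (simp add: c_def power_mult_distrib)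
      finally show "\<sigma>\<^sup>2 / 36 \<le> h1" using dh by (simp add: h2_def)
      show "0 < \<sigma>\<^sup>2 / 36" using that ac by simp
    qed
    have mem: "\<gamma> \<sigma> \<in> D" if "a \<le> \<sigma>" "\<sigma> \<le> c" for \<sigma>
      using ib[OF p \<sigma>h[OF that]] \<sigma>h[OF that] by (auto simp: \<gamma>_def subset_iff)
    have pw: "pw_curve D \<gamma> \<gamma>' {} a c"
      unfolding pw_curve_def
    proof (intro conjI ballI)
      show "continuous_on {a..c} \<gamma>" unfolding \<gamma>_def by (auto intro!: continuous_intros)
      show "continuous_on ({a<..<c} - {}) \<gamma>'" unfolding \<gamma>'_def by (auto intro!: continuous_intros)
      fix \<sigma>
      have "((\<lambda>\<sigma>. \<sigma>\<^sup>2 / 36) has_real_derivative (\<sigma> / 18)) (at \<sigma>)" by (auto intro!: derivative_eq_intros)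
      then have "((\<lambda>\<sigma>. p - (\<sigma>\<^sup>2 / 36) *\<^sub>R n p) has_vector_derivative 0 - (((\<sigma>\<^sup>2 / 36) *\<^sub>R 0) + (\<sigma> / 18) *\<^sub>R n p)) (at \<sigma>)"
        by (intro has_vector_derivative_diff has_vector_derivative_const has_vector_derivative_scaleR)
      then show "(\<gamma> has_vector_derivative \<gamma>' \<sigma>) (at \<sigma>)" by (simp add: \<gamma>_def[abs_def] \<gamma>'_def)
    qed (use mem ac in auto)
    \<comment> \<open>The term \<open>1 / \<sigma>\<close> integrates to
      \<open>ln (c / a) = ln (h / d) / 2\<close>; the other two contribute a bounded amount, the
      last one by the Dini condition.\<close>
    have K: "kobayashi_metric D (\<gamma> \<sigma>) (\<gamma>' \<sigma>) \<le> 1 / \<sigma> + 1 / 3 + 2 * (\<omega> \<sigma> / \<sigma>)" if \<sigma>: "a \<le> \<sigma>" "\<sigma> \<le> c" for \<sigma>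
    proof -
      have s0: "0 < \<sigma>" using \<sigma> ac by simp
      have sq: "sqrt (\<sigma>\<^sup>2 / 36) = \<sigma> / 6" using s0 by (simp add: real_sqrt_divide)
      define b where "b = max (\<sigma> / 6) (\<omega> \<sigma>)"
      have "\<omega> \<sigma> \<le> \<omega> t0" using \<sigma> c1 t0 by (intro monoD[OF mono_\<omega>]) simp
      then have b: "b \<le> 1 / 2" using t0 \<sigma> c1 by (auto simp: b_def)
      have "kobayashi_metric D (\<gamma> \<sigma>) (\<gamma>' \<sigma>) \<le> \<bar>- (\<sigma> / 18)\<bar> * kobayashi_metric D (\<gamma> \<sigma>) (n p)"
        unfolding \<gamma>'_def by (rule kobayashi_metric_scale_le[OF open_D mem[OF \<sigma>]])
      also have "\<dots> \<le> \<bar>- (\<sigma> / 18)\<bar> * ((1 + 2 * b) / (2 * (\<sigma>\<^sup>2 / 36)))"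
        unfolding \<gamma>_def
      proof (intro mult_left_mono metric_normal[OF p])
        show "2 * sqrt (\<sigma>\<^sup>2 / 36) < R / 8" unfolding sq using \<sigma> ac g R by simp
        show "sqrt (\<sigma>\<^sup>2 / 36) \<le> b" "\<omega> (6 * sqrt (\<sigma>\<^sup>2 / 36)) \<le> b" unfolding sq by (auto simp: b_def)
      qed (use s0 b in auto)
      also have "\<dots> = (1 + 2 * b) / \<sigma>" using s0 by (simp add: power2_eq_square field_simps)
      also have "\<dots> \<le> (1 + 2 * (\<sigma> / 6 + \<omega> \<sigma>)) / \<sigma>"
        using s0 \<omega>_nonneg[of \<sigma>] by (intro divide_right_mono) (auto simp: b_def)
      also have "\<dots> = 1 / \<sigma> + 1 / 3 + 2 * (\<omega> \<sigma> / \<sigma>)" using s0 by (simp add: field_simps)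
      finally show ?thesis .
    qed
    have [measurable]: "\<omega> \<in> borel_measurable borel" by (rule borel_measurable_mono[OF mono_\<omega>])
    have "klen D \<gamma> \<gamma>' a c \<le> (\<integral>\<^sup>+\<sigma>. (ennreal (1 / \<sigma> + 1 / 3) * indicator {a..c} \<sigma>) + 2 * (ennreal (\<omega> \<sigma> / \<sigma>) * indicator {0<..<1} \<sigma>) \<partial>lborel)"
      unfolding klen_def
    proof (rule nn_integral_mono)
      fix \<sigma> :: real
      show "ennreal (kobayashi_metric D (\<gamma> \<sigma>) (\<gamma>' \<sigma>)) * indicator {a..c} \<sigma> \<le>
        (ennreal (1 / \<sigma> + 1 / 3) * indicator {a..c} \<sigma>) + 2 * (ennreal (\<omega> \<sigma> / \<sigma>) * indicator {0<..<1} \<sigma>)"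
      proof (cases "\<sigma> \<in> {a..c}")
        case True
        then have \<sigma>: "a \<le> \<sigma>" "\<sigma> \<le> c" "0 < \<sigma>" "\<sigma> < 1" using ac c1 t0 by auto
        have "ennreal (kobayashi_metric D (\<gamma> \<sigma>) (\<gamma>' \<sigma>)) \<le> ennreal ((1 / \<sigma> + 1 / 3) + 2 * (\<omega> \<sigma> / \<sigma>))"
          using K[OF \<sigma>(1,2)] by (intro ennreal_leI) simp
        also have "\<dots> = ennreal (1 / \<sigma> + 1 / 3) + 2 * ennreal (\<omega> \<sigma> / \<sigma>)"
        proof -
          have "ennreal (u + 2 * v) = ennreal u + 2 * ennreal v" if "0 \<le> u" "0 \<le> v" for u v
            using that by (simp add: ennreal_mult)
          moreover have "0 \<le> 1 / \<sigma> + 1 / 3" "0 \<le> \<omega> \<sigma> / \<sigma>" using \<sigma> \<omega>_nonneg[of \<sigma>] by auto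
          ultimately show ?thesis by blast
        qed
        finally show ?thesis using \<sigma> True by simp
      qed simp
    qed
    also have "\<dots> = (\<integral>\<^sup>+\<sigma>. ennreal (1 / \<sigma> + 1 / 3) * indicator {a..c} \<sigma> \<partial>lborel) + 2 * I"
      unfolding I_def by (subst nn_integral_add) (auto simp: nn_integral_cmult)
    also have "(\<integral>\<^sup>+\<sigma>. ennreal (1 / \<sigma> + 1 / 3) * indicator {a..c} \<sigma> \<partial>lborel) = ennreal ((ln c + c / 3) - (ln a + a / 3))"
      by (rule nn_integral_derivative) (use ac in \<open>auto intro!: derivative_eq_intros\<close>)
    also have "(ln c + c / 3) - (ln a + a / 3) \<le> ln (h / d) / 2 + 1"
    proof -
      have "ln c - ln a = ln (h / d) / 2" using dh by (simp add: a_def c_def ln_mult ln_sqrt ln_div diff_divide_distrib)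
      then show ?thesis using ac c1 t0 by simp
    qed
    then have "ennreal ((ln c + c / 3) - (ln a + a / 3)) + 2 * I \<le> ennreal (ln (h / d) / 2 + 1) + 2 * I"
      by (intro add_right_mono ennreal_leI)
    also have "ennreal (ln (h / d) / 2 + 1) + 2 * I = ennreal (ln (h / d) / 2 + (1 + 2 * r))"
    proof -
      have "0 \<le> ln (h / d)" using dh by simp
      moreover have "2 * I = ennreal (2 * r)" using r by (simp add: ennreal_mult)
      ultimately show ?thesis using r by (simp add: add.assoc flip: ennreal_plus)
    qed
    finally have "klen D \<gamma> \<gamma>' a c \<le> ennreal (ln (h / d) / 2 + (1 + 2 * r))" .
    moreover have "\<gamma> a = p - d *\<^sub>R n p" "\<gamma> c = p - h *\<^sub>R n p"
      using dh by (auto simp: \<gamma>_def a_def c_def power_mult_distrib)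
    ultimately show ?thesis using kdist_le_klen[OF open_D pw] by (metis order_trans)
  qed
  have "h2 > 0" using h1 g by (simp add: h2_def)
  then show ?thesis using main r by (intro exI[of _ h2] conjI exI[of _ "1 + 2 * r"]) auto
qed

text \<open>Both points are pushed along their normals to depth \<open>h = norm (x - y)\<close>,
  unless they are already that deep. The resulting points are at most \<open>3 * h\<close> apart and
  are centres of balls of radius \<open>h / 4\<close> inside \<open>D\<close>, so convexity joins
  them at cost at most 12.\<close>

lemma kdist_upper:
  "\<exists>R4>0. \<exists>C\<ge>0. \<forall>x\<in>D \<inter> ball \<xi> R4. \<forall>y\<in>D \<inter> ball \<xi> R4.
     kdist D x y \<le> ennreal (ln (max (norm (x - y)) (\<delta> x) / \<delta> x) / 2 + ln (max (norm (x - y)) (\<delta> y) / \<delta> y) / 2 + C)"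
proof -
  obtain h1 where h1: "0 < h1" and ib: "\<And>p h. p \<in> frontier D \<Longrightarrow> p \<in> ball \<xi> (R / 4) \<Longrightarrow> 0 < h \<Longrightarrow> h \<le> h1 \<Longrightarrow>
    ball (p - h *\<^sub>R n p) (h / 4) \<subseteq> D"
    using inner_ball by blast
  obtain h2 C where h2: "0 < h2" "0 \<le> C" and kn: "\<And>p d h. p \<in> frontier D \<Longrightarrow> p \<in> ball \<xi> (R / 4) \<Longrightarrow> 0 < d \<Longrightarrow> d \<le> h \<Longrightarrow> h \<le> h2 \<Longrightarrow>
     kdist D (p - d *\<^sub>R n p) (p - h *\<^sub>R n p) \<le> ennreal (ln (h / d) / 2 + C)"
    using kdist_normal by blast
  define R4 where "R4 = min (R / 16) (min h1 h2 / 2)"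
  have step: "\<exists>x'. ball x' (h / 4) \<subseteq> D \<and> norm (x - x') \<le> h \<and> kdist D x x' \<le> ennreal (ln (max h (\<delta> x) / \<delta> x) / 2 + C)"
    if x: "x \<in> D" "x \<in> ball \<xi> R4" and h: "0 < h" "h \<le> min h1 h2" for x h
  proof (cases "h \<le> \<delta> x")
    case True
    have "ball x (h / 4) \<subseteq> D" using \<delta>_ball[OF x(1)] True h by (auto simp: subset_iff)
    then show ?thesis using True h \<delta>_pos[OF x(1)] h2
      by (intro exI[of _ x]) (auto simp: kdist_self[OF open_D x(1)] max_def)
  next
    case False
    obtain p \<nu> where p: "p \<in> frontier D" "norm \<nu> = 1" "\<And>w. w \<in> D \<Longrightarrow> (w - p) \<bullet> \<nu> < 0" "p - x = \<delta> x *\<^sub>R \<nu>"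
      using support[OF x(1)] by metis
    have \<delta>0: "0 < \<delta> x" using \<delta>_pos[OF x(1)] .
    have "norm (p - x) = \<delta> x" using p(2,4) \<delta>0 by simp
    moreover have "\<delta> x < R4" using \<delta>_le[of x] x(2) by (simp add: dist_commute)
    ultimately have pR: "p \<in> ball \<xi> (R / 4)"
      using x(2) dist_triangle[of \<xi> p x] R by (simp add: R4_def dist_norm norm_minus_commute)
    then have "\<nu> = n p" using R by (intro normal[OF p(1) _ p(2)] p(3)) auto
    then have xe: "x = p - \<delta> x *\<^sub>R n p" using p(4) by (simp add: algebra_simps)
    have "kdist D x (p - h *\<^sub>R n p) \<le> ennreal (ln (h / \<delta> x) / 2 + C)"
      using kn[OF p(1) pR \<delta>0, of h] False h xe by simp
    moreover have "norm (x - (p - h *\<^sub>R n p)) \<le> h"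
    proof -
      have "x - (p - h *\<^sub>R n p) = (h - \<delta> x) *\<^sub>R n p" by (subst xe) (simp add: algebra_simps)
      then show ?thesis using p(2) \<open>\<nu> = n p\<close> False \<delta>0 by simp
    qed
    ultimately show ?thesis using ib[OF p(1) pR h(1)] h False
      by (intro exI[of _ "p - h *\<^sub>R n p"]) (auto simp: max_def)
  qed
  have "kdist D x y \<le> ennreal (ln (max (norm (x - y)) (\<delta> x) / \<delta> x) / 2 + ln (max (norm (x - y)) (\<delta> y) / \<delta> y) / 2 + (2 * C + 12))"
    if x: "x \<in> D" "x \<in> ball \<xi> R4" and y: "y \<in> D" "y \<in> ball \<xi> R4" for x y
  proof (cases "x = y")
    case True
    then show ?thesis using kdist_self[OF open_D x(1)] by simp
  next
    case False
    define h where "h = norm (x - y)"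
    have "h < R4 + R4"
      using x(2) y(2) dist_triangle_less_add[of x \<xi> R4 y R4] by (simp add: h_def dist_norm norm_minus_commute)
    then have h: "0 < h" "h \<le> min h1 h2" using False by (auto simp: h_def R4_def)
    obtain x' where x': "ball x' (h / 4) \<subseteq> D" "norm (x - x') \<le> h" "kdist D x x' \<le> ennreal (ln (max h (\<delta> x) / \<delta> x) / 2 + C)"
      using step[OF x h] by blast
    obtain y' where y': "ball y' (h / 4) \<subseteq> D" "norm (y - y') \<le> h" "kdist D y y' \<le> ennreal (ln (max h (\<delta> y) / \<delta> y) / 2 + C)"
      using step[OF y h] by blast
    have "norm (x' - y') \<le> norm (x - x') + norm (x - y) + norm (y - y')"
      using norm_triangle_ineq4[of "x - y" "(x - x') - (y - y')"] norm_triangle_ineq4[of "x - x'" "y - y'"]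
      by (simp add: algebra_simps)
    then have n3: "norm (x' - y') / (h / 4) \<le> 12" using x' y' h by (simp add: h_def[symmetric] divide_le_eq)
    have "kdist D x' y' \<le> ennreal (norm (x' - y') / (h / 4))"
      by (rule kdist_convex_le[OF open_D convex_D _ x'(1) y'(1)]) (use h in simp)
    also have "\<dots> \<le> ennreal 12" using n3 by (rule ennreal_leI)
    finally have mid: "kdist D x' y' \<le> ennreal 12" .
    have l0: "0 \<le> ln (max h (\<delta> x) / \<delta> x)" "0 \<le> ln (max h (\<delta> y) / \<delta> y)"
      using \<delta>_pos[OF x(1)] \<delta>_pos[OF y(1)] by (auto intro!: ln_ge_zero simp: le_divide_eq)
    have "kdist D x y \<le> kdist D x x' + (kdist D x' y' + kdist D y' y)"
      using kdist_triangle[OF open_D, of x y x'] kdist_triangle[OF open_D, of x' y y']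
      by (meson add_left_mono order_trans)
    also have "\<dots> \<le> ennreal (ln (max h (\<delta> x) / \<delta> x) / 2 + C) + (ennreal 12 + ennreal (ln (max h (\<delta> y) / \<delta> y) / 2 + C))"
      using x'(3) mid y'(3) kdist_sym[OF open_D, of y' y] by (intro add_mono) auto
    also have "\<dots> = ennreal ((ln (max h (\<delta> x) / \<delta> x) / 2 + C) + (12 + (ln (max h (\<delta> y) / \<delta> y) / 2 + C)))"
    proof -
      have "ennreal a + (ennreal 12 + ennreal b) = ennreal (a + (12 + b))" if "0 \<le> a" "0 \<le> b" for a b
        using that by (simp only: ennreal_plus)
      moreover have "0 \<le> ln (max h (\<delta> x) / \<delta> x) / 2 + C" "0 \<le> ln (max h (\<delta> y) / \<delta> y) / 2 + C"
        using l0 h2 by auto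
      ultimately show ?thesis by blast
    qed
    finally show ?thesis by (simp add: h_def algebra_simps)
  qed
  moreover have "R4 > 0" using R h1 h2 by (simp add: R4_def)
  ultimately show ?thesis using h2 by (intro exI[of _ R4] conjI exI[of _ "2 * C + 12"]) auto
qed

end

section \<open>Near-geodesics\<close>

lemma pw_curve_reverse:
  assumes \<gamma>: "pw_curve D \<gamma> \<gamma>' S a b" and D: "open D"
  shows "pw_curve D (\<lambda>t. \<gamma> (a + b + - 1 * t)) (\<lambda>t. - 1 *\<^sub>R \<gamma>' (a + b + - 1 * t)) ((\<lambda>u. (u - (a + b)) / - 1) ` S) a b"
    and "klen D (\<lambda>t. \<gamma> (a + b + - 1 * t)) (\<lambda>t. - 1 *\<^sub>R \<gamma>' (a + b + - 1 * t)) a b \<le> klen D \<gamma> \<gamma>' a b"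
proof -
  have "a \<le> b" using \<gamma> by (simp add: pw_curve_def)
  then show "pw_curve D (\<lambda>t. \<gamma> (a + b + - 1 * t)) (\<lambda>t. - 1 *\<^sub>R \<gamma>' (a + b + - 1 * t)) ((\<lambda>u. (u - (a + b)) / - 1) ` S) a b"
    by (intro pw_curve_affine[OF \<gamma>]) auto
  show "klen D (\<lambda>t. \<gamma> (a + b + - 1 * t)) (\<lambda>t. - 1 *\<^sub>R \<gamma>' (a + b + - 1 * t)) a b \<le> klen D \<gamma> \<gamma>' a b"
    by (rule klen_affine_le[OF D \<gamma>]) auto
qed

text \<open>No minimizing curve is assumed to exist, hence the slack \<open>\<kappa>\<close>; the
  strict inequality also forces the length to be finite.\<close>

definition near_geodesic :: "(complex ^ 'n) set \<Rightarrow> complex ^ 'n \<Rightarrow> complex ^ 'n \<Rightarrow> real \<Rightarrow>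
    (real \<Rightarrow> complex ^ 'n) \<Rightarrow> (real \<Rightarrow> complex ^ 'n) \<Rightarrow> real set \<Rightarrow> bool" where
  "near_geodesic \<Omega> x y \<kappa> \<gamma> \<gamma>' S \<longleftrightarrow> pw_curve \<Omega> \<gamma> \<gamma>' S 0 1 \<and> \<gamma> 0 = x \<and> \<gamma> 1 = y \<and>
     klen \<Omega> \<gamma> \<gamma>' 0 1 < kdist \<Omega> x y + ennreal \<kappa>"

lemma near_geodesic_finite: "near_geodesic \<Omega> x y \<kappa> \<gamma> \<gamma>' S \<Longrightarrow> klen \<Omega> \<gamma> \<gamma>' 0 1 < \<infinity>"
  unfolding near_geodesic_def by (metis infinity_ennreal_def less_top order_less_le_trans top_greatest top.not_eq_extremum)

lemma near_geodesic_exists: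
  assumes "kdist \<Omega> x y < \<infinity>" "0 < \<kappa>"
  obtains \<gamma> \<gamma>' S where "near_geodesic \<Omega> x y \<kappa> \<gamma> \<gamma>' S"
proof -
  have "kdist \<Omega> x y < kdist \<Omega> x y + ennreal \<kappa>"
    using assms by (cases "kdist \<Omega> x y") (auto simp: ennreal_less_iff simp flip: ennreal_plus)
  then obtain \<gamma> \<gamma>' S where "pw_curve \<Omega> \<gamma> \<gamma>' S 0 1" "\<gamma> 0 = x" "\<gamma> 1 = y" "klen \<Omega> \<gamma> \<gamma>' 0 1 < kdist \<Omega> x y + ennreal \<kappa>"
    by (rule kdist_less_curve)
  then show ?thesis using that by (auto simp: near_geodesic_def)
qed

lemma near_geodesic_rlen:
  assumes g: "near_geodesic \<Omega> x y \<kappa> \<gamma> \<gamma>' S" and fin: "kdist \<Omega> x y < \<infinity>" and \<kappa>: "0 \<le> \<kappa>"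
  shows "rlen \<Omega> \<gamma> \<gamma>' 0 1 < enn2real (kdist \<Omega> x y) + \<kappa>"
proof -
  have "klen \<Omega> \<gamma> \<gamma>' 0 1 < kdist \<Omega> x y + ennreal \<kappa>" using g by (simp add: near_geodesic_def)
  then show ?thesis
    using near_geodesic_finite[OF g] fin \<kappa> unfolding rlen_def
    by (cases "klen \<Omega> \<gamma> \<gamma>' 0 1"; cases "kdist \<Omega> x y") (auto simp: ennreal_less_iff simp flip: ennreal_plus)
qed

text \<open>A detour cheaper than the arc by more than \<open>\<kappa>\<close> would shorten the
  whole curve below the distance of its ends, so every sub-arc inherits the slack of the
  curve.\<close>

lemma near_geodesic_piece:
  assumes \<Omega>: "open \<Omega>" and g: "near_geodesic \<Omega> x y \<kappa> \<gamma> \<gamma>' S" and \<kappa>: "0 \<le> \<kappa>"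
    and st: "0 \<le> s" "s \<le> t" "t \<le> 1" and fin: "kdist \<Omega> (\<gamma> s) (\<gamma> t) \<le> ennreal q" "0 \<le> q"
  shows "rlen \<Omega> \<gamma> \<gamma>' s t \<le> q + \<kappa>"
proof -
  have \<gamma>: "pw_curve \<Omega> \<gamma> \<gamma>' S 0 1" "\<gamma> 0 = x" "\<gamma> 1 = y" "klen \<Omega> \<gamma> \<gamma>' 0 1 < kdist \<Omega> x y + ennreal \<kappa>"
    using g by (auto simp: near_geodesic_def)
  have f: "klen \<Omega> \<gamma> \<gamma>' 0 1 < \<infinity>" by (rule near_geodesic_finite[OF g])
  have e: "klen \<Omega> \<gamma> \<gamma>' u v = ennreal (rlen \<Omega> \<gamma> \<gamma>' u v)" if "0 \<le> u" "v \<le> 1" for u v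
    using klen_finite_subinterval[OF f that] by (simp add: rlen_def less_top)
  have "kdist \<Omega> x y \<le> kdist \<Omega> x (\<gamma> s) + (kdist \<Omega> (\<gamma> s) (\<gamma> t) + kdist \<Omega> (\<gamma> t) y)"
    using kdist_triangle[OF \<Omega>, of x y "\<gamma> s"] kdist_triangle[OF \<Omega>, of "\<gamma> s" y "\<gamma> t"]
    by (meson add_left_mono order_trans)
  also have "\<dots> \<le> klen \<Omega> \<gamma> \<gamma>' 0 s + (ennreal q + klen \<Omega> \<gamma> \<gamma>' t 1)"
  proof (intro add_mono fin)
    show "kdist \<Omega> x (\<gamma> s) \<le> klen \<Omega> \<gamma> \<gamma>' 0 s"
      using kdist_le_klen[OF \<Omega> pw_curve_subinterval[OF \<gamma>(1), of 0 s]] st \<gamma> by simp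
    show "kdist \<Omega> (\<gamma> t) y \<le> klen \<Omega> \<gamma> \<gamma>' t 1"
      using kdist_le_klen[OF \<Omega> pw_curve_subinterval[OF \<gamma>(1), of t 1]] st \<gamma> by simp
  qed
  also have "\<dots> = ennreal (rlen \<Omega> \<gamma> \<gamma>' 0 s + (q + rlen \<Omega> \<gamma> \<gamma>' t 1))"
    using st fin(2) by (simp add: e rlen_nonneg)
  finally have "kdist \<Omega> x y \<le> ennreal (rlen \<Omega> \<gamma> \<gamma>' 0 s + (q + rlen \<Omega> \<gamma> \<gamma>' t 1))" .
  then have "kdist \<Omega> x y + ennreal \<kappa> \<le> ennreal (rlen \<Omega> \<gamma> \<gamma>' 0 s + (q + rlen \<Omega> \<gamma> \<gamma>' t 1)) + ennreal \<kappa>"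
    by (rule add_right_mono)
  also have "\<dots> = ennreal (rlen \<Omega> \<gamma> \<gamma>' 0 s + (q + rlen \<Omega> \<gamma> \<gamma>' t 1) + \<kappa>)"
    using \<kappa> fin(2) by (simp add: rlen_nonneg)
  finally have "ennreal (rlen \<Omega> \<gamma> \<gamma>' 0 1) < ennreal (rlen \<Omega> \<gamma> \<gamma>' 0 s + (q + rlen \<Omega> \<gamma> \<gamma>' t 1) + \<kappa>)"
    using \<gamma>(4) e[of 0 1] by simp
  then have "rlen \<Omega> \<gamma> \<gamma>' 0 1 < rlen \<Omega> \<gamma> \<gamma>' 0 s + (q + rlen \<Omega> \<gamma> \<gamma>' t 1) + \<kappa>"
    by (simp add: ennreal_less_iff rlen_nonneg)
  moreover have "rlen \<Omega> \<gamma> \<gamma>' 0 1 = rlen \<Omega> \<gamma> \<gamma>' 0 s + (rlen \<Omega> \<gamma> \<gamma>' s t + rlen \<Omega> \<gamma> \<gamma>' t 1)"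
    using rlen_split[OF f, of s] rlen_split[OF klen_finite_subinterval[OF f st(1) order_refl], of t] st by simp
  ultimately show ?thesis by simp
qed

context local_model
begin

lemma comparison_shrink: "comparison R1 A B \<alpha> \<Longrightarrow> 0 < r \<Longrightarrow> r \<le> R1 \<Longrightarrow> comparison r A B \<alpha>"
  by (auto simp: comparison_def)

lemma kdist_\<Omega>_le: "kdist \<Omega> x y \<le> kdist D x y"
  by (rule kdist_mono[OF open_D open_\<Omega> D_sub])

lemma kdist_\<Omega>_finite: "x \<in> D \<Longrightarrow> y \<in> D \<Longrightarrow> kdist \<Omega> x y < \<infinity>"
  using kdist_\<Omega>_le kdist_convex_finite[OF open_D convex_D] by (metis le_less_trans)

text \<open>\<open>growth\<close> is applied with the half-space supporting \<open>D\<close> at the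
  boundary point nearest to one end: at this end the height equals \<open>\<delta>\<close>, at the
  other it is at least \<open>\<delta>\<close>. Exchanging the ends gives the absolute
  value.\<close>

lemma growth_log:
  assumes cmp: "comparison R1 1 B 1"
    and \<gamma>: "pw_curve \<Omega> \<gamma> \<gamma>' S a b" and fin: "klen \<Omega> \<gamma> \<gamma>' a b < \<infinity>"
    and nr: "\<And>t. a \<le> t \<Longrightarrow> t \<le> b \<Longrightarrow> \<gamma> t \<in> ball \<xi> R1"
  shows "\<bar>ln (\<delta> (\<gamma> b)) - ln (\<delta> (\<gamma> a))\<bar> / 2 - ln (1 + B * M powr 1) / 2 \<le> rlen \<Omega> \<gamma> \<gamma>' a b"
proof -
  have par: "R1 \<le> R" "B \<ge> 0" using cmp by (auto simp: comparison_def)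
  have ab: "a \<le> b" using \<gamma> by (simp add: pw_curve_def)
  have inD: "\<gamma> t \<in> D" if "a \<le> t" "t \<le> b" for t
    using near_D[OF pw_curve_mem[OF \<gamma> that]] nr[OF that] par by auto
  have one: "ln (\<delta> (\<gamma> t)) / 2 - ln (1 + B * M powr 1) / 2 - ln (\<delta> (\<gamma> s)) / 2 \<le> rlen \<Omega> \<gamma> \<gamma>' a b"
    if st: "s \<in> {a, b}" "t \<in> {a, b}" "s \<noteq> t" for s t
  proof -
    have s: "\<gamma> s \<in> D" and t: "\<gamma> t \<in> D" using inD st ab by auto
    obtain p \<nu> where p: "p \<in> frontier D" and \<nu>: "norm \<nu> = 1" "\<And>w. w \<in> D \<Longrightarrow> (w - p) \<bullet> \<nu> < 0"
      and ps: "(p - \<gamma> s) \<bullet> \<nu> = \<delta> (\<gamma> s)"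
      using support[OF s] by blast
    have "\<bar>growth_fn B 1 ((p - \<gamma> b) \<bullet> \<nu>) - growth_fn B 1 ((p - \<gamma> a) \<bullet> \<nu>)\<bar> \<le> 1 * rlen \<Omega> \<gamma> \<gamma>' a b"
      by (rule growth[OF cmp \<gamma> fin nr \<nu>])
    then have "growth_fn B 1 ((p - \<gamma> t) \<bullet> \<nu>) - growth_fn B 1 ((p - \<gamma> s) \<bullet> \<nu>) \<le> rlen \<Omega> \<gamma> \<gamma>' a b"
      using st by auto
    moreover have "growth_fn B 1 ((p - \<gamma> s) \<bullet> \<nu>) \<le> ln (\<delta> (\<gamma> s)) / 2"
      unfolding ps by (rule growth_fn_le) (use par in auto)
    moreover have "\<delta> (\<gamma> t) \<le> (p - \<gamma> t) \<bullet> \<nu>" by (rule half_space_ge_\<delta>[OF \<nu> t])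
    then have "ln (\<delta> (\<gamma> t)) \<le> ln ((p - \<gamma> t) \<bullet> \<nu>)" "0 < (p - \<gamma> t) \<bullet> \<nu>" using \<delta>_pos[OF t] by auto
    moreover have "ln ((p - \<gamma> t) \<bullet> \<nu>) / 2 - ln (1 + B * M powr 1) / (2 * 1) \<le> growth_fn B 1 ((p - \<gamma> t) \<bullet> \<nu>)"
      by (rule growth_fn_ge) (use calculation half_space_le_M[OF p \<nu>(1) t] par in auto)
    ultimately show ?thesis by simp
  qed
  show ?thesis
  proof (cases "a = b")
    case True
    have "0 \<le> ln (1 + B * M powr 1)" using par by (intro ln_ge_zero) simp
    then show ?thesis using True rlen_nonneg[of \<Omega> \<gamma> \<gamma>' b b] by simp
  next
    case False
    then show ?thesis using one[of a b] one[of b a] by (simp add: abs_le_iff field_simps abs_if)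
  qed
qed

lemma metric_le_on_level:
  assumes cmp: "comparison R1 1 B 1" and z: "z \<in> \<Omega>" "z \<in> ball \<xi> R1" and H: "\<delta> z \<le> H"
  shows "kobayashi_metric D z v \<le> (1 + B * H) * kobayashi_metric \<Omega> z v"
proof -
  have par: "R1 \<le> R" "B \<ge> 0" using cmp by (auto simp: comparison_def)
  have zD: "z \<in> D" using z par by (intro near_D) auto
  have "kobayashi_metric D z v \<le> 1 * (1 + B * \<delta> z powr 1) * kobayashi_metric \<Omega> z v"
    using cmp z by (auto simp: comparison_def)
  also have "\<dots> \<le> (1 + B * H) * kobayashi_metric \<Omega> z v"
    using H par \<delta>_pos[OF zD] kobayashi_metric_nonneg[OF open_\<Omega> z(1)]
    by (intro mult_right_mono) (auto simp: mult_left_mono)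
  finally show ?thesis .
qed

lemma set_integral_metric_le:
  fixes T :: "real set"
  assumes cmp: "comparison R1 1 B 1" and H: "0 \<le> H"
    and T: "\<And>t. t \<in> T \<Longrightarrow> \<gamma> t \<in> \<Omega> \<and> \<gamma> t \<in> ball \<xi> R1 \<and> \<delta> (\<gamma> t) \<le> H"
  shows "(\<integral>\<^sup>+t\<in>T. ennreal (kobayashi_metric D (\<gamma> t) (\<gamma>' t)) \<partial>lborel)
    \<le> ennreal (1 + B * H) * (\<integral>\<^sup>+t\<in>T. ennreal (kobayashi_metric \<Omega> (\<gamma> t) (\<gamma>' t)) \<partial>lborel)"
proof -
  have B: "B \<ge> 0" using cmp by (auto simp: comparison_def)
  then have BH: "0 < 1 + B * H" using H by (simp add: add_pos_nonneg)
  have "(\<integral>\<^sup>+t\<in>T. ennreal (kobayashi_metric D (\<gamma> t) (\<gamma>' t)) \<partial>lborel) \<le>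
    (\<integral>\<^sup>+t. ennreal (1 + B * H) * (ennreal (kobayashi_metric \<Omega> (\<gamma> t) (\<gamma>' t)) * indicator T t) \<partial>lborel)"
  proof (rule nn_integral_mono)
    fix t :: real
    show "ennreal (kobayashi_metric D (\<gamma> t) (\<gamma>' t)) * indicator T t \<le>
      ennreal (1 + B * H) * (ennreal (kobayashi_metric \<Omega> (\<gamma> t) (\<gamma>' t)) * indicator T t)"
    proof (cases "t \<in> T")
      case True
      then have g: "\<gamma> t \<in> \<Omega>" "\<gamma> t \<in> ball \<xi> R1" "\<delta> (\<gamma> t) \<le> H" using T by auto
      have "ennreal (kobayashi_metric D (\<gamma> t) (\<gamma>' t)) \<le> ennreal ((1 + B * H) * kobayashi_metric \<Omega> (\<gamma> t) (\<gamma>' t))"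
        by (intro ennreal_leI metric_le_on_level[OF cmp g])
      also have "\<dots> = ennreal (1 + B * H) * ennreal (kobayashi_metric \<Omega> (\<gamma> t) (\<gamma>' t))"
        by (rule ennreal_mult) (use BH kobayashi_metric_nonneg[OF open_\<Omega> g(1)] in auto)
      finally show ?thesis using True by simp
    qed simp
  qed
  also have "\<dots> \<le> ennreal (1 + B * H) * (\<integral>\<^sup>+t\<in>T. ennreal (kobayashi_metric \<Omega> (\<gamma> t) (\<gamma>' t)) \<partial>lborel)"
    by (rule nn_integral_cmult_le_nonmeasurable) (use BH in auto)
  finally show ?thesis .
qed

end

text \<open>The first ball carries the end points, the second one the near-geodesics between them.\<close>

definition (in local_model) controlled :: "real \<Rightarrow> real \<Rightarrow> real \<Rightarrow> real \<Rightarrow> real \<Rightarrow> bool" where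
  "controlled \<eta> r B Cu C \<longleftrightarrow> 0 < \<eta> \<and> \<eta> \<le> r \<and> r \<le> 1 / 2 \<and> 0 \<le> Cu \<and> 0 < C \<and> comparison r 1 B 1 \<and>
     (\<forall>x\<in>D \<inter> ball \<xi> r. \<forall>y\<in>D \<inter> ball \<xi> r. kdist D x y \<le>
        ennreal (ln (max (norm (x - y)) (\<delta> x) / \<delta> x) / 2 + ln (max (norm (x - y)) (\<delta> y) / \<delta> y) / 2 + Cu)) \<and>
     (\<forall>x\<in>D \<inter> ball \<xi> \<eta>. \<forall>y\<in>D \<inter> ball \<xi> \<eta>. \<forall>\<kappa> \<gamma> \<gamma>' S. x \<noteq> y \<longrightarrow> 0 < \<kappa> \<longrightarrow> \<kappa> \<le> 1 \<longrightarrow> near_geodesic \<Omega> x y \<kappa> \<gamma> \<gamma>' S \<longrightarrow>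
        (\<forall>t. 0 \<le> t \<longrightarrow> t \<le> 1 \<longrightarrow> \<gamma> t \<in> ball \<xi> r \<and> \<delta> (\<gamma> t) \<le> C * (norm (x - y) + min (\<delta> x) (\<delta> y))))"

lemma (in dini_model) near_geodesics_controlled: "\<exists>\<eta> r B Cu C. controlled \<eta> r B Cu C"
proof -
  obtain R1 B where cmp1: "comparison R1 1 B 1" using comparison_final by blast
  obtain R4 Cu where R4: "0 < R4" "0 \<le> Cu" and up4: "\<And>x y. x \<in> D \<Longrightarrow> x \<in> ball \<xi> R4 \<Longrightarrow> y \<in> D \<Longrightarrow> y \<in> ball \<xi> R4 \<Longrightarrow> kdist D x y \<le>
    ennreal (ln (max (norm (x - y)) (\<delta> x) / \<delta> x) / 2 + ln (max (norm (x - y)) (\<delta> y) / \<delta> y) / 2 + Cu)"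
    using kdist_upper by blast
  define r where "r = min (min R1 R4) (1 / 2)"
  have R1: "0 < R1" "R1 \<le> R" "0 \<le> B" using cmp1 by (auto simp: comparison_def)
  then have r: "0 < r" "r \<le> R1" "r \<le> R4" "r \<le> 1 / 2" "r \<le> R" using R4 by (auto simp: r_def)
  have cmp: "comparison r 1 B 1" by (rule comparison_shrink[OF cmp1 r(1,2)])
  have up: "kdist D x y \<le> ennreal (ln (max (norm (x - y)) (\<delta> x) / \<delta> x) / 2 + ln (max (norm (x - y)) (\<delta> y) / \<delta> y) / 2 + Cu)"
    if "x \<in> D" "x \<in> ball \<xi> r" "y \<in> D" "y \<in> ball \<xi> r" for x y
    using that r by (intro up4) auto
  obtain Ce where Ce: "\<And>\<gamma> \<gamma>' S a b. pw_curve \<Omega> \<gamma> \<gamma>' S a b \<Longrightarrow> klen \<Omega> \<gamma> \<gamma>' a b < \<infinity> \<Longrightarrow>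
    dist \<xi> (\<gamma> a) + r / 2 < r \<Longrightarrow> r / 2 \<le> norm (\<gamma> b - \<gamma> a) \<Longrightarrow>
    - ln (\<delta> (\<gamma> a)) / 2 - Ce \<le> 1 * rlen \<Omega> \<gamma> \<gamma>' a b"
    using exit_ball_cost[OF cmp, of "r / 2"] r by auto
  \<comment> \<open>The exit cost seen from the terminal point, by reversing the curve.\<close>
  have Ce': "- ln (\<delta> (\<gamma> b)) / 2 - Ce \<le> rlen \<Omega> \<gamma> \<gamma>' a b"
    if \<gamma>: "pw_curve \<Omega> \<gamma> \<gamma>' S a b" and fin: "klen \<Omega> \<gamma> \<gamma>' a b < \<infinity>"
      and c: "dist \<xi> (\<gamma> b) + r / 2 < r" "r / 2 \<le> norm (\<gamma> b - \<gamma> a)" for \<gamma> \<gamma>' S a b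
  proof -
    note rev = pw_curve_reverse[OF \<gamma> open_\<Omega>]
    have fin': "klen \<Omega> (\<lambda>t. \<gamma> (a + b + - 1 * t)) (\<lambda>t. - 1 *\<^sub>R \<gamma>' (a + b + - 1 * t)) a b < \<infinity>"
      using rev(2) fin by (rule le_less_trans)
    have "- ln (\<delta> (\<gamma> (a + b + - 1 * a))) / 2 - Ce \<le> 1 * rlen \<Omega> (\<lambda>t. \<gamma> (a + b + - 1 * t)) (\<lambda>t. - 1 *\<^sub>R \<gamma>' (a + b + - 1 * t)) a b"
      by (rule Ce[OF rev(1) fin']) (use c in \<open>auto simp: norm_minus_commute\<close>)
    also have "\<dots> \<le> rlen \<Omega> \<gamma> \<gamma>' a b" using enn2real_mono[OF rev(2)] fin by (simp add: rlen_def)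
    finally show ?thesis by simp
  qed
  \<comment> \<open>Once \<open>h\<close>, \<open>\<delta> x\<close> and \<open>\<delta> y\<close>
    are below the exponential, the two exit costs together exceed the upper bound for the
    length.\<close>
  define \<eta> where "\<eta> = min (r / 8) (exp (- (2 * Ce + Cu + 2)) / 2)"
  have \<eta>: "0 < \<eta>" "\<eta> \<le> r / 8" "2 * \<eta> \<le> exp (- (2 * Ce + Cu + 2))" using r by (auto simp: \<eta>_def)
  define c where "c = ln (1 + B * M powr 1) / 2"
  define C where "C = 2 * exp (2 * c + Cu + 1)"
  have main: "\<gamma> t \<in> ball \<xi> r" "\<delta> (\<gamma> t) \<le> C * (norm (x - y) + min (\<delta> x) (\<delta> y))"
    if x: "x \<in> D" "x \<in> ball \<xi> \<eta>" and y: "y \<in> D" "y \<in> ball \<xi> \<eta>" and xy: "x \<noteq> y" and \<kappa>: "0 < \<kappa>" "\<kappa> \<le> 1"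
      and g: "near_geodesic \<Omega> x y \<kappa> \<gamma> \<gamma>' S" and t: "0 \<le> t" "t \<le> 1" for x y \<kappa> \<gamma> \<gamma>' S t
  proof -
    have \<gamma>: "pw_curve \<Omega> \<gamma> \<gamma>' S 0 1" "\<gamma> 0 = x" "\<gamma> 1 = y" using g by (auto simp: near_geodesic_def)
    have f: "klen \<Omega> \<gamma> \<gamma>' 0 1 < \<infinity>" by (rule near_geodesic_finite[OF g])
    have xr: "x \<in> ball \<xi> r" "y \<in> ball \<xi> r" using x y \<eta> r by auto
    define h where "h = norm (x - y)"
    have h0: "0 < h" using xy by (simp add: h_def)
    have h: "h < 2 * \<eta>" using x(2) y(2) dist_triangle_less_add[of x \<xi> \<eta> y \<eta>] by (simp add: h_def dist_norm norm_minus_commute)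
    have d0: "0 < \<delta> x" "0 < \<delta> y" using \<delta>_pos x y by auto
    have d\<eta>: "\<delta> x < \<eta>" "\<delta> y < \<eta>" using \<delta>_le[of x] \<delta>_le[of y] x y by (auto simp: dist_commute)
    have q0: "0 \<le> ln (max h (\<delta> x) / \<delta> x) / 2 + ln (max h (\<delta> y) / \<delta> y) / 2 + Cu"
      using d0 R4 by (auto intro!: add_nonneg_nonneg ln_ge_zero simp: le_divide_eq)
    have "kdist \<Omega> x y \<le> ennreal (ln (max h (\<delta> x) / \<delta> x) / 2 + ln (max h (\<delta> y) / \<delta> y) / 2 + Cu)"
      using kdist_\<Omega>_le[of x y] up[OF x(1) xr(1) y(1) xr(2)] unfolding h_def by (rule order_trans)
    then have "rlen \<Omega> \<gamma> \<gamma>' 0 1 \<le> (ln (max h (\<delta> x) / \<delta> x) / 2 + ln (max h (\<delta> y) / \<delta> y) / 2 + Cu) + \<kappa>"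
      using near_geodesic_piece[OF open_\<Omega> g _ _ _ _ _ q0, of 0 1] \<gamma> \<kappa> by simp
    also have "ln (max h (\<delta> x) / \<delta> x) = ln (max h (\<delta> x)) - ln (\<delta> x)" using d0 by (auto simp: ln_div max_def)
    also have "ln (max h (\<delta> y) / \<delta> y) = ln (max h (\<delta> y)) - ln (\<delta> y)" using d0 by (auto simp: ln_div max_def)
    finally have len: "rlen \<Omega> \<gamma> \<gamma>' 0 1 \<le> (ln (max h (\<delta> x)) - ln (\<delta> x)) / 2 + (ln (max h (\<delta> y)) - ln (\<delta> y)) / 2 + Cu + 1"
      using \<kappa> by simp
    have split: "rlen \<Omega> \<gamma> \<gamma>' 0 1 = rlen \<Omega> \<gamma> \<gamma>' 0 s + rlen \<Omega> \<gamma> \<gamma>' s 1" if "0 \<le> s" "s \<le> 1" for s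
      using rlen_split[OF f that] .
    have sub: "pw_curve \<Omega> \<gamma> \<gamma>' S 0 s" "pw_curve \<Omega> \<gamma> \<gamma>' S s 1"
      "klen \<Omega> \<gamma> \<gamma>' 0 s < \<infinity>" "klen \<Omega> \<gamma> \<gamma>' s 1 < \<infinity>" if "0 \<le> s" "s \<le> 1" for s
      using pw_curve_subinterval[OF \<gamma>(1), of 0 s] pw_curve_subinterval[OF \<gamma>(1), of s 1]
        klen_finite_subinterval[OF f, of 0 s] klen_finite_subinterval[OF f, of s 1] that by auto
    have inball: "\<gamma> s \<in> ball \<xi> r" if s: "0 \<le> s" "s \<le> 1" for s
    proof (rule ccontr)
      assume out: "\<gamma> s \<notin> ball \<xi> r"
      have "- ln (\<delta> (\<gamma> 0)) / 2 - Ce \<le> 1 * rlen \<Omega> \<gamma> \<gamma>' 0 s"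
      proof (rule Ce[OF sub(1,3)[OF s]])
        show "dist \<xi> (\<gamma> 0) + r / 2 < r" using x(2) \<gamma>(2) \<eta> r by simp
        show "r / 2 \<le> norm (\<gamma> s - \<gamma> 0)"
          using out x(2) \<gamma>(2) \<eta> r dist_triangle[of \<xi> "\<gamma> s" "\<gamma> 0"] by (simp add: dist_norm norm_minus_commute)
      qed
      moreover have "- ln (\<delta> (\<gamma> 1)) / 2 - Ce \<le> rlen \<Omega> \<gamma> \<gamma>' s 1"
      proof (rule Ce'[OF sub(2,4)[OF s]])
        show "dist \<xi> (\<gamma> 1) + r / 2 < r" using y(2) \<gamma>(3) \<eta> r by simp
        show "r / 2 \<le> norm (\<gamma> 1 - \<gamma> s)"
          using out y(2) \<gamma>(3) \<eta> r dist_triangle[of \<xi> "\<gamma> s" "\<gamma> 1"] by (simp add: dist_norm norm_minus_commute)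
      qed
      moreover have "ln (max h (\<delta> x)) \<le> - (2 * Ce + Cu + 2)" "ln (max h (\<delta> y)) \<le> - (2 * Ce + Cu + 2)"
      proof -
        have "max h (\<delta> x) \<le> exp (- (2 * Ce + Cu + 2))" "max h (\<delta> y) \<le> exp (- (2 * Ce + Cu + 2))"
          using h d\<eta> \<eta> by auto
        then show "ln (max h (\<delta> x)) \<le> - (2 * Ce + Cu + 2)" "ln (max h (\<delta> y)) \<le> - (2 * Ce + Cu + 2)"
          using h0 by (metis exp_gt_zero ln_exp ln_le_cancel_iff less_max_iff_disj)+
      qed
      moreover define X Y where "X = ln (max h (\<delta> x))" and "Y = ln (max h (\<delta> y))"
      ultimately show False
        using len split[OF s] unfolding \<gamma>(2,3) X_def[symmetric] Y_def[symmetric] by (simp add: field_simps)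
    qed
    show "\<gamma> t \<in> ball \<xi> r" by (rule inball[OF t])
    then have \<gamma>tD: "\<gamma> t \<in> D" using pw_curve_mem[OF \<gamma>(1) t] r by (intro near_D) auto
    \<comment> \<open>Growth from both ends to \<open>\<gamma> t\<close> costs \<open>ln (\<delta>
      (\<gamma> t)) - (ln (\<delta> x) + ln (\<delta> y)) / 2\<close> up to \<open>2 * c\<close>.
      Against the upper bound for the length the terms \<open>ln (\<delta> x)\<close> and
      \<open>ln (\<delta> y)\<close> cancel.\<close>
    have "\<bar>ln (\<delta> (\<gamma> t)) - ln (\<delta> (\<gamma> 0))\<bar> / 2 - c \<le> rlen \<Omega> \<gamma> \<gamma>' 0 t"
      unfolding c_def by (rule growth_log[OF cmp sub(1,3)[OF t]]) (use inball t in auto)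
    moreover have "\<bar>ln (\<delta> (\<gamma> 1)) - ln (\<delta> (\<gamma> t))\<bar> / 2 - c \<le> rlen \<Omega> \<gamma> \<gamma>' t 1"
      unfolding c_def by (rule growth_log[OF cmp sub(2,4)[OF t]]) (use inball t in auto)
    moreover define w where "w = h + min (\<delta> x) (\<delta> y)"
    have w0: "0 < w" using h0 d0 by (simp add: w_def)
    have "max h (\<delta> x) \<le> 2 * w" "max h (\<delta> y) \<le> 2 * w"
      using \<delta>_Lipschitz[of x y] \<delta>_Lipschitz[of y x] h0 d0 by (auto simp: w_def h_def dist_norm norm_minus_commute)
    then have "ln (max h (\<delta> x)) \<le> ln (2 * w)" "ln (max h (\<delta> y)) \<le> ln (2 * w)"
      using h0 w0 by (auto simp del: max.bounded_iff)
    ultimately have "ln (\<delta> (\<gamma> t)) \<le> ln (2 * w) + (2 * c + Cu + 1)"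
      using len split[OF t] \<gamma>(2,3) by (simp add: abs_if field_simps split: if_splits)
    then have "\<delta> (\<gamma> t) \<le> exp (ln (2 * w) + (2 * c + Cu + 1))"
      using \<delta>_pos[OF \<gamma>tD] by (metis exp_le_cancel_iff exp_ln)
    also have "\<dots> = C * w" using w0 by (simp add: exp_add C_def)
    finally show "\<delta> (\<gamma> t) \<le> C * (norm (x - y) + min (\<delta> x) (\<delta> y))" by (simp add: w_def h_def)
  qed
  have "controlled \<eta> r B Cu C"
    unfolding controlled_def
  proof (intro conjI ballI allI impI)
    show "comparison r 1 B 1" by (rule cmp)
  qed (use main up \<eta> r R4 in \<open>auto simp: C_def\<close>)
  then show ?thesis by blast
qed

section \<open>The quotient estimate and the additive estimate\<close>

context local_model
begin

definition dD :: "complex ^ 'n \<Rightarrow> complex ^ 'n \<Rightarrow> real" where "dD x y = kobayashi_dist D x y"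

definition d\<Omega> :: "complex ^ 'n \<Rightarrow> complex ^ 'n \<Rightarrow> real" where "d\<Omega> x y = kobayashi_dist \<Omega> x y"

lemma kdist_dD: "x \<in> D \<Longrightarrow> y \<in> D \<Longrightarrow> kdist D x y = ennreal (dD x y)"
  using kdist_convex_finite[OF open_D convex_D] by (simp add: dD_def kobayashi_dist_eq less_top)

lemma kdist_d\<Omega>: "x \<in> D \<Longrightarrow> y \<in> D \<Longrightarrow> kdist \<Omega> x y = ennreal (d\<Omega> x y)"
  using kdist_\<Omega>_finite by (simp add: d\<Omega>_def kobayashi_dist_eq less_top)

lemma dD_nonneg: "0 \<le> dD x y" and d\<Omega>_nonneg: "0 \<le> d\<Omega> x y"
  by (simp_all add: dD_def d\<Omega>_def kobayashi_dist_eq)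

lemma d\<Omega>_le_dD: "x \<in> D \<Longrightarrow> y \<in> D \<Longrightarrow> d\<Omega> x y \<le> dD x y"
  using kdist_\<Omega>_le[of x y] by (simp add: kdist_dD kdist_d\<Omega> dD_nonneg)

lemma d\<Omega>_pos:
  assumes "x \<in> D" "y \<in> D" "x \<noteq> y"
  shows "0 < d\<Omega> x y"
proof -
  have "ennreal (norm (x - y) / M) \<le> ennreal (d\<Omega> x y)"
    using kdist_ge_norm[OF open_\<Omega> M diam, of x y] assms by (simp add: kdist_d\<Omega>)
  then have "norm (x - y) / M \<le> d\<Omega> x y" by (simp add: d\<Omega>_nonneg)
  moreover have "0 < norm (x - y) / M" using assms M by simp
  ultimately show ?thesis by linarith
qed

lemma near_geodesic_dD_le:
  assumes ctl: "controlled \<eta> r B Cu C" and x: "x \<in> D \<inter> ball \<xi> \<eta>" and y: "y \<in> D \<inter> ball \<xi> \<eta>" and xy: "x \<noteq> y"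
  shows "dD x y \<le> (1 + B * (C * (norm (x - y) + min (\<delta> x) (\<delta> y)))) * d\<Omega> x y"
proof (rule field_le_epsilon)
  fix e :: real assume e: "0 < e"
  define H where "H = C * (norm (x - y) + min (\<delta> x) (\<delta> y))"
  have cmp: "comparison r 1 B 1" and C: "0 < C"
    and ng: "\<And>\<kappa> \<gamma> \<gamma>' S t. 0 < \<kappa> \<Longrightarrow> \<kappa> \<le> 1 \<Longrightarrow> near_geodesic \<Omega> x y \<kappa> \<gamma> \<gamma>' S \<Longrightarrow> 0 \<le> t \<Longrightarrow> t \<le> 1 \<Longrightarrow>
      \<gamma> t \<in> ball \<xi> r \<and> \<delta> (\<gamma> t) \<le> H"
    using ctl x y xy unfolding controlled_def H_def by blast+
  have B: "0 \<le> B" using cmp by (simp add: comparison_def)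
  have d0: "0 < \<delta> x" "0 < \<delta> y" using \<delta>_pos x y by auto
  then have H0: "0 \<le> H" using C by (simp add: H_def)
  have BH: "1 \<le> 1 + B * H" using B H0 by simp
  \<comment> \<open>The slack is multiplied by \<open>1 + B * H\<close> as well and has to end up
    below \<open>e\<close>.\<close>
  define \<kappa> where "\<kappa> = min 1 (e / (1 + B * H))"
  have \<kappa>: "0 < \<kappa>" "\<kappa> \<le> 1" "(1 + B * H) * \<kappa> \<le> e"
  proof -
    have "(1 + B * H) * \<kappa> \<le> (1 + B * H) * (e / (1 + B * H))" using BH by (intro mult_left_mono) (auto simp: \<kappa>_def)
    then show "(1 + B * H) * \<kappa> \<le> e" using BH by simp
  qed (use e BH in \<open>auto simp: \<kappa>_def\<close>)
  have fin: "kdist \<Omega> x y < \<infinity>" using kdist_\<Omega>_finite x y by blast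
  obtain \<gamma> \<gamma>' S where g: "near_geodesic \<Omega> x y \<kappa> \<gamma> \<gamma>' S" using near_geodesic_exists[OF fin \<kappa>(1)] by blast
  have \<gamma>: "pw_curve \<Omega> \<gamma> \<gamma>' S 0 1" "\<gamma> 0 = x" "\<gamma> 1 = y" using g by (auto simp: near_geodesic_def)
  have inD: "\<gamma> t \<in> D" if "0 \<le> t" "t \<le> 1" for t
    using ng[OF \<kappa>(1,2) g that] pw_curve_mem[OF \<gamma>(1) that] cmp by (intro near_D) (auto simp: comparison_def)
  have "ennreal (dD x y) \<le> klen D \<gamma> \<gamma>' 0 1"
    using kdist_le_klen[OF open_D pw_curve_subset[OF \<gamma>(1) inD]] x y by (simp add: \<gamma> kdist_dD)
  also have "\<dots> \<le> ennreal (1 + B * H) * klen \<Omega> \<gamma> \<gamma>' 0 1"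
    unfolding klen_def
    by (rule set_integral_metric_le[OF cmp H0]) (use ng[OF \<kappa>(1,2) g] pw_curve_mem[OF \<gamma>(1)] in auto)
  also have "\<dots> = ennreal ((1 + B * H) * rlen \<Omega> \<gamma> \<gamma>' 0 1)"
    using near_geodesic_finite[OF g] BH by (simp add: ennreal_mult rlen_def less_top)
  finally have "dD x y \<le> (1 + B * H) * rlen \<Omega> \<gamma> \<gamma>' 0 1"
    using BH rlen_nonneg[of \<Omega> \<gamma> \<gamma>' 0 1] by (simp add: ennreal_le_iff)
  also have "\<dots> \<le> (1 + B * H) * (d\<Omega> x y + \<kappa>)"
    using near_geodesic_rlen[OF g fin] \<kappa>(1) BH by (intro mult_left_mono) (auto simp: d\<Omega>_def kobayashi_dist_eq)
  also have "\<dots> \<le> (1 + B * H) * d\<Omega> x y + e" using \<kappa>(3) by (simp add: distrib_left)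
  finally show "dD x y \<le> (1 + B * (C * (norm (x - y) + min (\<delta> x) (\<delta> y)))) * d\<Omega> x y + e" by (simp add: H_def)
qed

text \<open>With \<open>\<mu>\<close> the smaller depth, the quotient estimate has relative error
  \<open>O(\<mu>)\<close>, while the segment from \<open>x\<close> to \<open>y\<close> shows
  \<open>d\<Omega> x y \<le> norm (x - y) / \<mu>\<close>; the product of the two is
  \<open>O(norm (x - y))\<close>.\<close>

lemma additive_far:
  assumes ctl: "controlled \<eta> r B Cu C" and x: "x \<in> D \<inter> ball \<xi> \<eta>" and y: "y \<in> D \<inter> ball \<xi> \<eta>" and xy: "x \<noteq> y"
    and far: "norm (x - y) \<le> min (\<delta> x) (\<delta> y)"
  shows "dD x y \<le> d\<Omega> x y + 2 * B * C * norm (x - y)"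
proof -
  define \<mu> where "\<mu> = min (\<delta> x) (\<delta> y)"
  have \<mu>: "0 < \<mu>" using \<delta>_pos x y by (simp add: \<mu>_def)
  have B: "0 \<le> B" and C: "0 < C" using ctl by (auto simp: controlled_def comparison_def)
  have "kdist D x y \<le> ennreal (norm (x - y) / \<mu>)"
    by (rule kdist_convex_le[OF open_D convex_D \<mu>]) (use \<delta>_ball x y in \<open>auto simp: \<mu>_def subset_iff\<close>)
  then have "dD x y \<le> norm (x - y) / \<mu>" using x y \<mu> by (simp add: kdist_dD dD_nonneg)
  then have d: "d\<Omega> x y \<le> norm (x - y) / \<mu>" using d\<Omega>_le_dD[of x y] x y by simp
  have "dD x y \<le> (1 + B * (C * (norm (x - y) + \<mu>))) * d\<Omega> x y"
    unfolding \<mu>_def by (rule near_geodesic_dD_le[OF ctl x y xy])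
  also have "\<dots> = d\<Omega> x y + B * C * (norm (x - y) + \<mu>) * d\<Omega> x y" by (simp add: algebra_simps)
  also have "B * C * (norm (x - y) + \<mu>) * d\<Omega> x y \<le> B * C * (2 * \<mu>) * (norm (x - y) / \<mu>)"
    using B C far d \<mu> d\<Omega>_nonneg by (intro mult_mono) (auto simp: \<mu>_def)
  also have "\<dots> = 2 * B * C * norm (x - y)" using \<mu> by simp
  finally show ?thesis by simp
qed

text \<open>The part of a near-geodesic in a dyadic level set of \<open>\<delta>\<close> is contained in an arc with both ends at
  height at least \<open>\<eta>k\<close>, so its length is \<open>O(1 + ln (1 / \<eta>k))\<close>.\<close>

lemma level_length:
  assumes ctl: "controlled \<eta> r B Cu C" and \<kappa>: "0 < \<kappa>" "\<kappa> \<le> 1" and g: "near_geodesic \<Omega> x y \<kappa> \<gamma> \<gamma>' S"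
    and nr: "\<And>t. 0 \<le> t \<Longrightarrow> t \<le> 1 \<Longrightarrow> \<gamma> t \<in> ball \<xi> r"
    and \<eta>k: "0 < \<eta>k" and ne: "\<exists>t\<in>{0..1}. \<eta>k \<le> \<delta> (\<gamma> t)" and \<theta>: "0 < \<theta>"
  shows "(\<integral>\<^sup>+t\<in>{t\<in>{0..1}. \<eta>k < \<delta> (\<gamma> t) \<and> \<delta> (\<gamma> t) \<le> b}. ennreal (kobayashi_metric \<Omega> (\<gamma> t) (\<gamma>' t)) \<partial>lborel)
    \<le> ennreal ((1 / \<theta> + Cu + 1) * \<eta>k powr - \<theta>)"
proof -
  have r: "r \<le> 1 / 2" "r \<le> R" "0 \<le> Cu"
    and up: "\<And>x y. x \<in> D \<Longrightarrow> x \<in> ball \<xi> r \<Longrightarrow> y \<in> D \<Longrightarrow> y \<in> ball \<xi> r \<Longrightarrow> kdist D x y \<le>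
      ennreal (ln (max (norm (x - y)) (\<delta> x) / \<delta> x) / 2 + ln (max (norm (x - y)) (\<delta> y) / \<delta> y) / 2 + Cu)"
    using ctl unfolding controlled_def comparison_def by auto
  have \<gamma>: "pw_curve \<Omega> \<gamma> \<gamma>' S 0 1" "\<gamma> 0 = x" "\<gamma> 1 = y" using g by (auto simp: near_geodesic_def)
  have inD: "\<gamma> t \<in> D" if "0 \<le> t" "t \<le> 1" for t
    using nr[OF that] pw_curve_mem[OF \<gamma>(1) that] r by (intro near_D) auto
  have f: "klen \<Omega> \<gamma> \<gamma>' 0 1 < \<infinity>" by (rule near_geodesic_finite[OF g])
  have c: "continuous_on {0..1} (\<lambda>t. \<delta> (\<gamma> t))"
    using \<gamma>(1) by (intro continuous_on_compose2[OF \<delta>_continuous[of UNIV]]) (auto simp: pw_curve_def)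
  define Z where "Z = {t\<in>{0..1}. \<eta>k \<le> \<delta> (\<gamma> t)}"
  have clZ: "closed Z"
    unfolding Z_def using continuous_closed_preimage[OF c closed_atLeastAtMost, of "{\<eta>k..}"]
    by (simp add: vimage_def Int_def)
  have neZ: "Z \<noteq> {}" using ne by (auto simp: Z_def)
  have bZ: "bdd_below Z" "bdd_above Z" by (auto simp: Z_def intro: bdd_belowI[of _ 0] bdd_aboveI[of _ 1])
  \<comment> \<open>First and last time at depth at least \<open>\<eta>k\<close>. In between the
    curve may go lower, which only enlarges the integral.\<close>
  define s t where "s = Inf Z" and "t = Sup Z"
  have sZ: "s \<in> Z" "t \<in> Z" unfolding s_def t_def
    using closed_contains_Inf[OF neZ bZ(1) clZ] closed_contains_Sup[OF neZ bZ(2) clZ] by auto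
  have st: "0 \<le> s" "s \<le> t" "t \<le> 1" "\<eta>k \<le> \<delta> (\<gamma> s)" "\<eta>k \<le> \<delta> (\<gamma> t)"
    using sZ cInf_lower[OF sZ(2) bZ(1)] by (auto simp: Z_def s_def)
  have sub: "u \<in> {s..t}" if "u \<in> Z" for u
    using that cInf_lower[OF _ bZ(1)] cSup_upper[OF _ bZ(2)] by (auto simp: s_def t_def)
  define p where "p = \<gamma> s"
  define q where "q = \<gamma> t"
  have pq: "p \<in> D" "q \<in> D" "p \<in> ball \<xi> r" "q \<in> ball \<xi> r" using inD nr st by (auto simp: p_def q_def)
  \<comment> \<open>The bound \<open>r \<le> 1 / 2\<close> keeps depths and mutual distances below
    1, so that each logarithm in the upper bound is at most \<open>- ln \<eta>k\<close>.\<close>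
  have d1: "\<delta> p < 1" "\<delta> q < 1" using \<delta>_le[of p] \<delta>_le[of q] pq r by (auto simp: dist_commute)
  have n1: "norm (p - q) < 1"
    using pq r dist_triangle_less_add[of p \<xi> r q r] by (simp add: dist_norm norm_minus_commute)
  have d0: "0 < \<delta> p" "0 < \<delta> q" using \<delta>_pos pq by auto
  have L: "ln (max (norm (p - q)) (\<delta> z) / \<delta> z) \<le> - ln \<eta>k" "0 \<le> ln (max (norm (p - q)) (\<delta> z) / \<delta> z)"
    if "z \<in> {p, q}" for z
  proof -
    have z: "0 < \<delta> z" "\<delta> z < 1" "\<eta>k \<le> \<delta> z" using that d0 d1 st by (auto simp: p_def q_def)
    have "max (norm (p - q)) (\<delta> z) / \<delta> z \<le> 1 / \<eta>k"
      using z n1 \<eta>k by (intro frac_le) auto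
    then have "ln (max (norm (p - q)) (\<delta> z) / \<delta> z) \<le> ln (1 / \<eta>k)"
      using z \<eta>k by (subst ln_le_cancel_iff) (auto simp: less_max_iff_disj)
    then show "ln (max (norm (p - q)) (\<delta> z) / \<delta> z) \<le> - ln \<eta>k" using \<eta>k by (simp add: ln_div)
    show "0 \<le> ln (max (norm (p - q)) (\<delta> z) / \<delta> z)" using z by (intro ln_ge_zero) (simp add: le_divide_eq)
  qed
  have ln\<eta>: "0 \<le> - ln \<eta>k" using L[of p] by simp
  have "kdist \<Omega> p q \<le> ennreal (- ln \<eta>k + Cu)"
  proof -
    have "kdist \<Omega> p q \<le> ennreal (ln (max (norm (p - q)) (\<delta> p) / \<delta> p) / 2 + ln (max (norm (p - q)) (\<delta> q) / \<delta> q) / 2 + Cu)"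
      using kdist_\<Omega>_le up[OF pq(1,3,2,4)] by (rule order_trans)
    also have "\<dots> \<le> ennreal (- ln \<eta>k + Cu)" using L(1)[of p] L(1)[of q] by (intro ennreal_leI) simp
    finally show ?thesis .
  qed
  then have "rlen \<Omega> \<gamma> \<gamma>' s t \<le> (- ln \<eta>k + Cu) + \<kappa>"
    unfolding p_def q_def using ln\<eta> r \<kappa> by (intro near_geodesic_piece[OF open_\<Omega> g _ st(1,2,3)]) auto
  also have "\<dots> \<le> - ln \<eta>k + (Cu + 1)" using \<kappa> by simp
  \<comment> \<open>The logarithm is traded for a power: \<open>ln u \<le> u\<close> at
    \<open>u = \<eta>k powr - \<theta>\<close>, and \<open>1 \<le> u\<close> because
    \<open>\<eta>k \<le> 1\<close>.\<close>
  also have "\<dots> \<le> (1 / \<theta>) * \<eta>k powr - \<theta> + (Cu + 1) * \<eta>k powr - \<theta>"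
  proof (rule add_mono)
    have "ln (\<eta>k powr - \<theta>) \<le> \<eta>k powr - \<theta>"
      using ln_le_minus_one[of "\<eta>k powr - \<theta>"] \<eta>k by simp
    then show "- ln \<eta>k \<le> (1 / \<theta>) * \<eta>k powr - \<theta>" using \<theta> \<eta>k by (simp add: ln_powr field_simps)
    have "1 \<le> \<eta>k powr - \<theta>"
      using \<theta> ln\<eta> \<eta>k unfolding powr_def by (simp add: mult_nonneg_nonpos)
    then show "Cu + 1 \<le> (Cu + 1) * \<eta>k powr - \<theta>" using r by (simp add: mult_le_cancel_left1)
  qed
  also have "\<dots> = (1 / \<theta> + Cu + 1) * \<eta>k powr - \<theta>" by (simp add: algebra_simps)
  finally have le: "rlen \<Omega> \<gamma> \<gamma>' s t \<le> (1 / \<theta> + Cu + 1) * \<eta>k powr - \<theta>" .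
  have "(\<integral>\<^sup>+t\<in>{t\<in>{0..1}. \<eta>k < \<delta> (\<gamma> t) \<and> \<delta> (\<gamma> t) \<le> b}. ennreal (kobayashi_metric \<Omega> (\<gamma> t) (\<gamma>' t)) \<partial>lborel) \<le> klen \<Omega> \<gamma> \<gamma>' s t"
    unfolding klen_def
  proof (rule nn_integral_mono)
    fix u :: real
    show "ennreal (kobayashi_metric \<Omega> (\<gamma> u) (\<gamma>' u)) * indicator {t\<in>{0..1}. \<eta>k < \<delta> (\<gamma> t) \<and> \<delta> (\<gamma> t) \<le> b} u
      \<le> ennreal (kobayashi_metric \<Omega> (\<gamma> u) (\<gamma>' u)) * indicator {s..t} u"
      using sub[of u] by (auto simp: Z_def split: split_indicator)
  qed
  also have "\<dots> = ennreal (rlen \<Omega> \<gamma> \<gamma>' s t)"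
    using klen_finite_subinterval[OF f st(1,3)] by (simp add: rlen_def less_top)
  also have "\<dots> \<le> ennreal ((1 / \<theta> + Cu + 1) * \<eta>k powr - \<theta>)" using le by (rule ennreal_leI)
  finally show ?thesis .
qed

lemma near_geodesic_additive:
  assumes ctl: "controlled \<eta> r B Cu C" and \<kappa>: "0 < \<kappa>" "\<kappa> \<le> 1" and g: "near_geodesic \<Omega> x y \<kappa> \<gamma> \<gamma>' S"
    and nr: "\<And>t. 0 \<le> t \<Longrightarrow> t \<le> 1 \<Longrightarrow> \<gamma> t \<in> ball \<xi> r"
    and H: "0 < H" "\<And>t. 0 \<le> t \<Longrightarrow> t \<le> 1 \<Longrightarrow> \<delta> (\<gamma> t) \<le> H"
  shows "klen D \<gamma> \<gamma>' 0 1 \<le> ennreal (rlen \<Omega> \<gamma> \<gamma>' 0 1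
    + 2 * B * (1 / (1 - 1 / m) + Cu + 1) / (1 - (1 / 2) powr (1 / m)) * H powr (1 / m))"
proof -
  have r: "r \<le> R" "0 \<le> Cu" "0 \<le> B" and cmp: "comparison r 1 B 1"
    using ctl unfolding controlled_def comparison_def by auto
  have \<gamma>: "pw_curve \<Omega> \<gamma> \<gamma>' S 0 1" "\<gamma> 0 = x" "\<gamma> 1 = y" using g by (auto simp: near_geodesic_def)
  have inD: "\<gamma> t \<in> D" if "0 \<le> t" "t \<le> 1" for t
    using nr[OF that] pw_curve_mem[OF \<gamma>(1) that] r by (intro near_D) auto
  have f: "klen \<Omega> \<gamma> \<gamma>' 0 1 < \<infinity>" by (rule near_geodesic_finite[OF g])
  have c: "continuous_on {0..1} (\<lambda>t. \<delta> (\<gamma> t))"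
    using \<gamma>(1) by (intro continuous_on_compose2[OF \<delta>_continuous[of UNIV]]) (auto simp: pw_curve_def)
  \<comment> \<open>With this exponent the error of a level is, up to a constant,
    \<open>e k * e (Suc k) powr - \<theta>\<close>, that is, twice
    \<open>e (Suc k) powr (1 / m)\<close>.\<close>
  define \<theta> where "\<theta> = 1 - 1 / m"
  have \<theta>: "0 < \<theta>" using m by (simp add: \<theta>_def)
  define C4 where "C4 = 1 / \<theta> + Cu + 1"
  have C4: "0 < C4" using \<theta> r by (simp add: C4_def add_pos_nonneg)
  define e where "e k = H * (1 / 2) ^ k" for k :: nat
  have e0: "0 < e k" for k using H by (simp add: e_def)
  have eSuc: "e k = 2 * e (Suc k)" for k by (simp add: e_def)
  have edec: "e j \<le> e k" if "k \<le> j" for j k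
    using H that by (simp add: e_def power_decreasing)
  define T where "T k = {t\<in>{0..1}. e (Suc k) < \<delta> (\<gamma> t) \<and> \<delta> (\<gamma> t) \<le> e k}" for k
  \<comment> \<open>The depth has a positive minimum along the compact curve, so finitely many
    levels cover the interval and finite additivity of the lower integral is enough.\<close>
  obtain t0 where t0: "t0 \<in> {0..1}" "\<And>t. t \<in> {0..1} \<Longrightarrow> \<delta> (\<gamma> t0) \<le> \<delta> (\<gamma> t)"
    using continuous_attains_inf[OF compact_Icc _ c] by force
  have "0 < \<delta> (\<gamma> t0)" using \<delta>_pos inD t0(1) by auto
  then obtain N where N: "(1 / 2) ^ N < \<delta> (\<gamma> t0) / H"
    using real_arch_pow_inv[of "\<delta> (\<gamma> t0) / H" "1 / 2"] H by auto
  then have eN: "e N < \<delta> (\<gamma> t0)" using H by (simp add: e_def field_simps)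
  have cover: "{0..1} = (\<Union>k\<in>{..<N}. T k)"
  proof
    show "(\<Union>k\<in>{..<N}. T k) \<subseteq> {0..1}" by (auto simp: T_def)
    show "{0..1} \<subseteq> (\<Union>k\<in>{..<N}. T k)"
    proof
      fix t :: real assume t: "t \<in> {0..1}"
      \<comment> \<open>\<open>e k\<close> is the first threshold below the depth at
        \<open>t\<close>, so \<open>t\<close> belongs to the level before it; \<open>k\<close> is
        positive because \<open>e 0 = H\<close>.\<close>
      define k where "k = (LEAST k. e k < \<delta> (\<gamma> t))"
      have "e N < \<delta> (\<gamma> t)" using eN t0(2)[OF t] by simp
      then have k: "e k < \<delta> (\<gamma> t)" "k \<le> N" unfolding k_def by (auto intro: LeastI Least_le)
      have "\<not> e 0 < \<delta> (\<gamma> t)" using H(2)[of t] t by (simp add: e_def)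
      then have "k \<noteq> 0" using k(1) by (metis)
      then obtain j where j: "k = Suc j" by (cases k) auto
      have "\<not> e j < \<delta> (\<gamma> t)" using not_less_Least[of j "\<lambda>k. e k < \<delta> (\<gamma> t)"] j by (simp add: k_def)
      then have "t \<in> T j" using k j t by (auto simp: T_def)
      then show "t \<in> (\<Union>k\<in>{..<N}. T k)" using k j by auto
    qed
  qed
  have disj: "disjoint_family_on T {..<N}"
  proof -
    have "T j \<inter> T k = {}" if "j < k" for j k
      using edec[of "Suc j" k] that by (auto simp: T_def)
    then show ?thesis unfolding disjoint_family_on_def
      by (metis Int_commute linorder_neqE_nat)
  qed
  have meas: "T k \<in> sets lborel" for k
  proof -
    have "closed ({0..1} \<inter> (\<lambda>t. \<delta> (\<gamma> t)) -` {..e j})" for j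
      by (rule continuous_closed_preimage[OF c]) auto
    then have b: "{0..1} \<inter> (\<lambda>t. \<delta> (\<gamma> t)) -` {..e j} \<in> sets borel" for j by (rule borel_closed)
    have "T k = ({0..1} \<inter> (\<lambda>t. \<delta> (\<gamma> t)) -` {..e k}) - ({0..1} \<inter> (\<lambda>t. \<delta> (\<gamma> t)) -` {..e (Suc k)})"
      by (auto simp: T_def)
    then show ?thesis using b by auto
  qed
  define K\<Omega> where "K\<Omega> t = ennreal (kobayashi_metric \<Omega> (\<gamma> t) (\<gamma>' t))" for t
  define KD where "KD t = ennreal (kobayashi_metric D (\<gamma> t) (\<gamma>' t))" for t
  define l where "l k = enn2real (\<integral>\<^sup>+t\<in>T k. K\<Omega> t \<partial>lborel)" for k
  have lfin: "(\<integral>\<^sup>+t\<in>T k. K\<Omega> t \<partial>lborel) = ennreal (l k)" for k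
  proof -
    have "(\<integral>\<^sup>+t\<in>T k. K\<Omega> t \<partial>lborel) \<le> klen \<Omega> \<gamma> \<gamma>' 0 1"
      unfolding klen_def K\<Omega>_def by (intro nn_integral_mono) (auto simp: T_def split: split_indicator)
    then show ?thesis using f by (auto simp: l_def less_top dest: le_less_trans)
  qed
  have l0: "0 \<le> l k" for k by (simp add: l_def)
  have sum\<Omega>: "rlen \<Omega> \<gamma> \<gamma>' 0 1 = (\<Sum>k<N. l k)"
  proof -
    have "klen \<Omega> \<gamma> \<gamma>' 0 1 = (\<Sum>k<N. \<integral>\<^sup>+t\<in>T k. K\<Omega> t \<partial>lborel)"
      unfolding klen_def K\<Omega>_def cover by (rule set_nn_integral_UN_nonmeasurable) (use meas disj in auto)
    also have "\<dots> = ennreal (\<Sum>k<N. l k)" by (simp add: lfin l0)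
    finally show ?thesis by (simp add: rlen_def l0 sum_nonneg)
  qed
  have piece: "(\<integral>\<^sup>+t\<in>T k. KD t \<partial>lborel) \<le> ennreal (l k + 2 * B * C4 * e (Suc k) powr (1 / m))" for k
  proof -
    have "(\<integral>\<^sup>+t\<in>T k. KD t \<partial>lborel) \<le> ennreal (1 + B * e k) * (\<integral>\<^sup>+t\<in>T k. K\<Omega> t \<partial>lborel)"
      unfolding KD_def K\<Omega>_def
      by (rule set_integral_metric_le[OF cmp]) (use e0[of k] nr pw_curve_mem[OF \<gamma>(1)] in \<open>auto simp: T_def\<close>)
    also have "\<dots> = ennreal ((1 + B * e k) * l k)"
      unfolding lfin using r e0[of k] l0 by (subst ennreal_mult) auto
    also have "\<dots> \<le> ennreal (l k + 2 * B * C4 * e (Suc k) powr (1 / m))"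
    proof (rule ennreal_leI)
      have "l k \<le> C4 * e (Suc k) powr - \<theta>"
      proof (cases "T k = {}")
        case True
        then show ?thesis using C4 by (simp add: l_def)
      next
        case False
        then have "\<exists>t\<in>{0..1}. e (Suc k) \<le> \<delta> (\<gamma> t)" by (auto simp: T_def intro: less_imp_le)
        then have "ennreal (l k) \<le> ennreal (C4 * e (Suc k) powr - \<theta>)"
          unfolding lfin[symmetric] K\<Omega>_def T_def C4_def
          by (intro level_length[OF ctl \<kappa> g nr e0 _ \<theta>])
        then show ?thesis using C4 by (simp add: ennreal_le_iff)
      qed
      then have "B * e k * l k \<le> B * e k * (C4 * e (Suc k) powr - \<theta>)"
        using r e0[of k] by (intro mult_left_mono) auto
      also have "\<dots> = 2 * B * C4 * (e (Suc k) powr 1 * e (Suc k) powr - \<theta>)"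
        using e0[of "Suc k"] by (simp add: eSuc[of k])
      also have "e (Suc k) powr 1 * e (Suc k) powr - \<theta> = e (Suc k) powr (1 / m)"
      proof -
        have "1 + - \<theta> = 1 / m" by (simp add: \<theta>_def)
        then show ?thesis by (simp only: powr_add[symmetric])
      qed
      finally show "(1 + B * e k) * l k \<le> l k + 2 * B * C4 * e (Suc k) powr (1 / m)"
        by (simp add: algebra_simps)
    qed
    finally show ?thesis .
  qed
  define q where "q = (1 / 2 :: real) powr (1 / m)"
  have q: "0 < q" "q < 1" using powr_less_mono2[of "1 / m" "1 / 2" 1] m by (auto simp: q_def)
  have epow: "e k powr (1 / m) = H powr (1 / m) * q ^ k" for k
  proof -
    have "((1 / 2 :: real) ^ k) powr (1 / m) = q ^ k"
      unfolding q_def by (simp add: powr_powr powr_realpow[symmetric] mult.commute)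
    then show ?thesis using H by (simp add: e_def powr_mult)
  qed
  have geo: "(\<Sum>k<N. q ^ Suc k) \<le> 1 / (1 - q)"
  proof -
    have "(\<Sum>k<N. q ^ Suc k) \<le> (\<Sum>k<N. q ^ k)" using q by (intro sum_mono) (simp add: mult_left_le_one_le)
    also have "\<dots> = (1 - q ^ N) / (1 - q)" using q by (simp add: sum_gp_strict)
    also have "\<dots> \<le> 1 / (1 - q)" using q by (intro divide_right_mono) auto
    finally show ?thesis .
  qed
  have "klen D \<gamma> \<gamma>' 0 1 = (\<Sum>k<N. \<integral>\<^sup>+t\<in>T k. KD t \<partial>lborel)"
    unfolding klen_def KD_def cover by (rule set_nn_integral_UN_nonmeasurable) (use meas disj in auto)
  also have "\<dots> \<le> (\<Sum>k<N. ennreal (l k + 2 * B * C4 * e (Suc k) powr (1 / m)))"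
    by (intro sum_mono piece)
  also have "\<dots> = ennreal (\<Sum>k<N. l k + 2 * B * C4 * e (Suc k) powr (1 / m))"
    using l0 r C4 by (intro sum_ennreal) auto
  also have "(\<Sum>k<N. l k + 2 * B * C4 * e (Suc k) powr (1 / m)) = rlen \<Omega> \<gamma> \<gamma>' 0 1 + 2 * B * C4 * H powr (1 / m) * (\<Sum>k<N. q ^ Suc k)"
    unfolding epow by (simp add: sum\<Omega> sum.distrib sum_distrib_left mult.assoc)
  also have "\<dots> \<le> rlen \<Omega> \<gamma> \<gamma>' 0 1 + 2 * B * C4 * H powr (1 / m) * (1 / (1 - q))"
    using geo r C4 by (intro add_left_mono mult_left_mono) auto
  finally have "klen D \<gamma> \<gamma>' 0 1 \<le> ennreal (rlen \<Omega> \<gamma> \<gamma>' 0 1 + 2 * B * C4 * H powr (1 / m) * (1 / (1 - q)))"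
    by (simp add: ennreal_leI)
  then show ?thesis by (simp add: C4_def \<theta>_def q_def mult_ac)
qed

text \<open>Here the depth of the near-geodesic is at most \<open>2 * C * norm (x - y)\<close>, so
  the error \<open>O(H powr (1 / m))\<close> of the dyadic sum has the required order.\<close>

lemma additive_near:
  assumes ctl: "controlled \<eta> r B Cu C" and x: "x \<in> D \<inter> ball \<xi> \<eta>" and y: "y \<in> D \<inter> ball \<xi> \<eta>" and xy: "x \<noteq> y"
    and near': "min (\<delta> x) (\<delta> y) \<le> norm (x - y)"
  shows "dD x y \<le> d\<Omega> x y + 2 * B * (1 / (1 - 1 / m) + Cu + 1) / (1 - (1 / 2) powr (1 / m)) * (2 * C * norm (x - y)) powr (1 / m)"
proof (rule field_le_epsilon)
  fix e :: real assume e: "0 < e"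
  have C: "0 < C" and r: "r \<le> R" "0 \<le> B" "0 \<le> Cu"
    and ng: "\<And>\<kappa> \<gamma> \<gamma>' S t. 0 < \<kappa> \<Longrightarrow> \<kappa> \<le> 1 \<Longrightarrow> near_geodesic \<Omega> x y \<kappa> \<gamma> \<gamma>' S \<Longrightarrow> 0 \<le> t \<Longrightarrow> t \<le> 1 \<Longrightarrow>
      \<gamma> t \<in> ball \<xi> r \<and> \<delta> (\<gamma> t) \<le> C * (norm (x - y) + min (\<delta> x) (\<delta> y))"
    using ctl x y xy unfolding controlled_def comparison_def by blast+
  define H where "H = 2 * C * norm (x - y)"
  have H: "0 < H" "C * (norm (x - y) + min (\<delta> x) (\<delta> y)) \<le> H"
  proof -
    have "C * (norm (x - y) + min (\<delta> x) (\<delta> y)) \<le> C * (norm (x - y) + norm (x - y))"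
      using C near' by (intro mult_left_mono) auto
    then show "C * (norm (x - y) + min (\<delta> x) (\<delta> y)) \<le> H" by (simp add: H_def)
    show "0 < H" using C xy by (simp add: H_def)
  qed
  define \<kappa> where "\<kappa> = min 1 e"
  have \<kappa>: "0 < \<kappa>" "\<kappa> \<le> 1" "\<kappa> \<le> e" using e by (auto simp: \<kappa>_def)
  have fin: "kdist \<Omega> x y < \<infinity>" using kdist_\<Omega>_finite x y by blast
  obtain \<gamma> \<gamma>' S where g: "near_geodesic \<Omega> x y \<kappa> \<gamma> \<gamma>' S" using near_geodesic_exists[OF fin \<kappa>(1)] by blast
  have \<gamma>: "pw_curve \<Omega> \<gamma> \<gamma>' S 0 1" "\<gamma> 0 = x" "\<gamma> 1 = y" using g by (auto simp: near_geodesic_def)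
  have nr: "\<gamma> t \<in> ball \<xi> r" "\<delta> (\<gamma> t) \<le> H" if "0 \<le> t" "t \<le> 1" for t
    using ng[OF \<kappa>(1,2) g that] H by auto
  have inD: "\<gamma> t \<in> D" if "0 \<le> t" "t \<le> 1" for t
    using nr[OF that] pw_curve_mem[OF \<gamma>(1) that] r by (intro near_D) auto
  let ?E = "2 * B * (1 / (1 - 1 / m) + Cu + 1) / (1 - (1 / 2) powr (1 / m)) * H powr (1 / m)"
  have E0: "0 \<le> ?E"
  proof -
    have "(1 / 2 :: real) powr (1 / m) < 1" using powr_less_mono2[of "1 / m" "1 / 2" 1] m by simp
    then show ?thesis using r m by (intro mult_nonneg_nonneg divide_nonneg_nonneg add_nonneg_nonneg) auto
  qed
  have "ennreal (dD x y) \<le> klen D \<gamma> \<gamma>' 0 1"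
    using kdist_le_klen[OF open_D pw_curve_subset[OF \<gamma>(1) inD]] x y by (simp add: \<gamma> kdist_dD)
  also have "\<dots> \<le> ennreal (rlen \<Omega> \<gamma> \<gamma>' 0 1 + ?E)"
    by (rule near_geodesic_additive[OF ctl \<kappa>(1,2) g nr(1) H(1) nr(2)])
  finally have "dD x y \<le> rlen \<Omega> \<gamma> \<gamma>' 0 1 + ?E"
    using E0 rlen_nonneg[of \<Omega> \<gamma> \<gamma>' 0 1] by (subst (asm) ennreal_le_iff) auto
  also have "rlen \<Omega> \<gamma> \<gamma>' 0 1 \<le> d\<Omega> x y + e"
    using near_geodesic_rlen[OF g fin] \<kappa> by (simp add: d\<Omega>_def kobayashi_dist_eq)
  finally show "dD x y \<le> d\<Omega> x y + 2 * B * (1 / (1 - 1 / m) + Cu + 1) / (1 - (1 / 2) powr (1 / m)) * (2 * C * norm (x - y)) powr (1 / m) + e"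
    by (simp add: H_def)
qed

lemma powr_inverse_ge:
  assumes "0 \<le> h" "h \<le> 1"
  shows "h \<le> h powr (1 / m)"
proof (cases "h = 0")
  case False
  then have "h powr 1 \<le> h powr (1 / m)" using assms m by (intro powr_mono') auto
  then show ?thesis using assms by simp
qed simp

end

lemma (in dini_model) distance_localization:
  "\<exists>\<eta>>0. \<exists>C>0. \<forall>x\<in>D \<inter> ball \<xi> \<eta>. \<forall>y\<in>D \<inter> ball \<xi> \<eta>.
     dD x y \<le> d\<Omega> x y + C * norm (x - y) powr (1 / m) \<and>
     dD x y \<le> (1 + C * (min (\<delta> x) (\<delta> y) + norm (x - y) powr (1 / m))) * d\<Omega> x y"
proof -
  obtain \<eta> r B Cu C where ctl: "controlled \<eta> r B Cu C" using near_geodesics_controlled by blast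
  then have par: "0 < \<eta>" "\<eta> \<le> 1 / 2" "0 \<le> B" "0 \<le> Cu" "0 < C"
    unfolding controlled_def comparison_def by auto
  define E where "E = 2 * B * (1 / (1 - 1 / m) + Cu + 1) / (1 - (1 / 2) powr (1 / m)) * (2 * C) powr (1 / m)"
  have E: "0 \<le> E"
  proof -
    have "(1 / 2 :: real) powr (1 / m) < 1" using powr_less_mono2[of "1 / m" "1 / 2" 1] m by simp
    then show ?thesis using par m unfolding E_def
      by (intro mult_nonneg_nonneg divide_nonneg_nonneg add_nonneg_nonneg) auto
  qed
  \<comment> \<open>Collects the constants of the deep case, \<open>2 * B * C\<close>, and of the
    dyadic sum, \<open>E\<close>, and dominates \<open>B * C\<close> from the quotient estimate; the
    1 makes it positive.\<close>
  define C' where "C' = 1 + 2 * B * C + E"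
  have C': "0 < C'" "2 * B * C \<le> C'" "B * C \<le> C'" "E \<le> C'" using par E by (auto simp: C'_def add_pos_nonneg)
  have "dD x y \<le> d\<Omega> x y + C' * norm (x - y) powr (1 / m) \<and>
     dD x y \<le> (1 + C' * (min (\<delta> x) (\<delta> y) + norm (x - y) powr (1 / m))) * d\<Omega> x y"
    if x: "x \<in> D \<inter> ball \<xi> \<eta>" and y: "y \<in> D \<inter> ball \<xi> \<eta>" for x y
  proof (cases "x = y")
    case True
    have "dD y y = 0" "d\<Omega> y y = 0"
      using kdist_self[OF open_D, of y] kdist_self[OF open_\<Omega>, of y] y D_sub
      by (auto simp: dD_def d\<Omega>_def kobayashi_dist_eq)
    then show ?thesis using True by simp
  next
    case False
    define h where "h = norm (x - y)"
    have "h < 1"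
      using x y par dist_triangle_less_add[of x \<xi> \<eta> y \<eta>] by (simp add: h_def dist_norm norm_minus_commute)
    \<comment> \<open>As \<open>h < 1\<close>, errors linear in \<open>h\<close> are absorbed by
      \<open>h powr (1 / m)\<close>.\<close>
    then have h: "0 \<le> h" "h \<le> h powr (1 / m)" using powr_inverse_ge[of h] by (auto simp: h_def)
    have d0: "0 < \<delta> x" "0 < \<delta> y" using \<delta>_pos x y by auto
    have "dD x y \<le> d\<Omega> x y + C' * h powr (1 / m)"
    proof (cases "h \<le> min (\<delta> x) (\<delta> y)")
      case True
      have "dD x y \<le> d\<Omega> x y + 2 * B * C * h"
        using additive_far[OF ctl x y False] True by (simp add: h_def)
      moreover have "2 * B * C * h \<le> C' * h powr (1 / m)" using C' h par by (intro mult_mono) auto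
      ultimately show ?thesis by simp
    next
      case False': False
      then have "min (\<delta> x) (\<delta> y) \<le> norm (x - y)" unfolding h_def by linarith
      then have "dD x y \<le> d\<Omega> x y + 2 * B * (1 / (1 - 1 / m) + Cu + 1) / (1 - (1 / 2) powr (1 / m)) * (2 * C * h) powr (1 / m)"
        unfolding h_def by (rule additive_near[OF ctl x y False])
      also have "(2 * C * h) powr (1 / m) = (2 * C) powr (1 / m) * h powr (1 / m)"
        by (rule powr_mult)
      finally have "dD x y \<le> d\<Omega> x y + E * h powr (1 / m)" by (simp add: E_def mult.assoc)
      moreover have "E * h powr (1 / m) \<le> C' * h powr (1 / m)" using C' by (intro mult_right_mono) auto
      ultimately show ?thesis by simp
    qed
    moreover have "dD x y \<le> (1 + C' * (min (\<delta> x) (\<delta> y) + h powr (1 / m))) * d\<Omega> x y"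
    proof -
      have "dD x y \<le> (1 + B * (C * (h + min (\<delta> x) (\<delta> y)))) * d\<Omega> x y"
        unfolding h_def by (rule near_geodesic_dD_le[OF ctl x y False])
      also have "\<dots> \<le> (1 + C' * (min (\<delta> x) (\<delta> y) + h powr (1 / m))) * d\<Omega> x y"
      proof (intro mult_right_mono add_left_mono d\<Omega>_nonneg)
        have "B * C * (h + min (\<delta> x) (\<delta> y)) \<le> C' * (min (\<delta> x) (\<delta> y) + h powr (1 / m))"
          using C' h par d0 by (intro mult_mono) auto
        then show "B * (C * (h + min (\<delta> x) (\<delta> y))) \<le> C' * (min (\<delta> x) (\<delta> y) + h powr (1 / m))"
          by (simp add: mult.assoc)
      qed
      finally show ?thesis .
    qed
    ultimately show ?thesis by (simp add: h_def)
  qed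
  then show ?thesis using par C' by blast
qed

section \<open>The outer unit normal\<close>

text \<open>If \<open>\<nu>\<close> differed from the gradient direction \<open>a\<close>, the
  vector \<open>\<nu> - a\<close> would point into \<open>\<Omega>\<close>, since the defining
  function decreases along it, and at the same time across the supporting hyperplane.\<close>

lemma support_eq_outer_unit_normal:
  fixes \<Omega> :: "'a::euclidean_space set"
  assumes p: "C1_smooth_boundary_point \<Omega> p" and \<nu>: "norm \<nu> = 1" and e: "e > 0"
    and sup: "\<And>w. w \<in> \<Omega> \<Longrightarrow> w \<in> ball p e \<Longrightarrow> (w - p) \<bullet> \<nu> \<le> 0"
  shows "\<nu> = outer_unit_normal \<Omega> p"
proof (rule ccontr)
  assume neq: "\<nu> \<noteq> outer_unit_normal \<Omega> p"
  obtain W r g where W: "p \<in> W" "C1_defining_function \<Omega> W r g" and pf: "p \<in> frontier \<Omega>"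
    using p by (auto simp: C1_smooth_boundary_point_def)
  then have oW: "open W" and gd: "GDERIV r p :> g p" "g p \<noteq> 0" and eq: "\<Omega> \<inter> W = {x\<in>W. r x < 0}"
    by (auto simp: C1_defining_function_def)
  define a where "a = g p /\<^sub>R norm (g p)"
  have na: "norm a = 1" using gd by (simp add: a_def)
  have "\<nu> \<noteq> a" using neq outer_unit_normal_eq[OF W(2,1) pf] by (simp add: a_def)
  then have lt: "a \<bullet> \<nu> < 1"
    using norm_cauchy_schwarz[of a \<nu>] norm_cauchy_schwarz_eq[of a \<nu>] na \<nu>
    by (metis less_eq_real_def mult_1 scaleR_one)
  define h where "h = \<nu> - a"
  have hg: "h \<bullet> g p < 0"
  proof -
    have "h \<bullet> g p = norm (g p) * (h \<bullet> a)" using gd by (simp add: a_def)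
    moreover have "h \<bullet> a = a \<bullet> \<nu> - 1"
      using na by (simp add: h_def inner_diff_left inner_commute[of \<nu> a] norm_eq_1)
    ultimately show ?thesis using lt gd by (simp add: mult_less_0_iff)
  qed
  have h\<nu>: "h \<bullet> \<nu> > 0" using lt \<nu> by (simp add: h_def inner_diff_left norm_eq_1)
  have "((\<lambda>t. p + t *\<^sub>R h) has_derivative (\<lambda>t. t *\<^sub>R h)) (at (0::real))"
    by (auto intro!: derivative_eq_intros)
  moreover have "(r has_derivative (\<lambda>h. h \<bullet> g p)) (at (p + 0 *\<^sub>R h))"
    using gd by (simp add: gderiv_def)
  ultimately have "((\<lambda>t. r (p + t *\<^sub>R h)) has_derivative (\<lambda>t. (t *\<^sub>R h) \<bullet> g p)) (at (0::real))"
    using has_derivative_compose by blast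
  then have "((\<lambda>t. r (p + t *\<^sub>R h)) has_real_derivative h \<bullet> g p) (at 0)"
    by (simp add: has_field_derivative_def mult.commute[of _ "h \<bullet> g p"])
  from DERIV_neg_dec_right[OF this hg] C1_defining_function_frontier[OF W(2,1) pf]
  obtain d where d: "d > 0" "\<And>t. 0 < t \<Longrightarrow> t < d \<Longrightarrow> r (p + t *\<^sub>R h) < 0" by auto
  have "open (W \<inter> ball p e)" "p \<in> W \<inter> ball p e" using oW W e by auto
  moreover have "((\<lambda>t. p + t *\<^sub>R h) \<longlongrightarrow> p + 0 *\<^sub>R h) (at_right (0::real))"
    by (intro tendsto_intros)
  ultimately have "eventually (\<lambda>t. p + t *\<^sub>R h \<in> W \<inter> ball p e) (at_right (0::real))"
    by (intro topological_tendstoD) auto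
  moreover have "eventually (\<lambda>t. t \<in> {0<..<d}) (at_right (0::real))"
    using d by (intro eventually_at_right_real) auto
  ultimately have "eventually (\<lambda>t. p + t *\<^sub>R h \<in> W \<inter> ball p e \<and> t \<in> {0<..<d}) (at_right (0::real))"
    by (rule eventually_conj)
  then obtain t where t: "p + t *\<^sub>R h \<in> W" "p + t *\<^sub>R h \<in> ball p e" "t \<in> {0<..<d}"
    using eventually_happens trivial_limit_at_right_real by blast
  have "p + t *\<^sub>R h \<in> \<Omega>" using d(2)[of t] t eq by auto
  from sup[OF this t(2)] have "t * (h \<bullet> \<nu>) \<le> 0" by simp
  then show False using h\<nu> t(3) by (simp add: mult_le_0_iff)
qed

lemma norm_outer_unit_normal:
  assumes "C1_smooth_boundary_point \<Omega> p"
  shows "norm (outer_unit_normal \<Omega> p) = 1"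
proof -
  obtain W r g where W: "p \<in> W" "C1_defining_function \<Omega> W r g" "p \<in> frontier \<Omega>"
    using assms by (auto simp: C1_smooth_boundary_point_def)
  then show ?thesis using outer_unit_normal_eq[OF W(2,1,3)] by (auto simp: C1_defining_function_def)
qed

lemma frontier_local_eq:
  fixes \<Omega> D :: "'a::metric_space set"
  assumes "open \<Omega>" "open D" "D \<subseteq> \<Omega>" "\<Omega> \<inter> B \<subseteq> D" "open B" "p \<in> B"
  shows "p \<in> frontier D \<longleftrightarrow> p \<in> frontier \<Omega>"
proof -
  have "p \<in> closure D \<longleftrightarrow> p \<in> closure \<Omega>"
  proof
    assume "p \<in> closure \<Omega>"
    then have "p \<in> closure (B \<inter> \<Omega>)" using assms open_Int_closure_subset[of B \<Omega>] by blast
    then show "p \<in> closure D" using closure_mono[of "B \<inter> \<Omega>" D] assms by blast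
  qed (use assms closure_mono in blast)
  then show ?thesis using assms by (auto simp: frontier_def interior_open)
qed

text \<open>With \<open>K\<close> the metric at \<open>v\<close>, every boundary point
  \<open>q\<close> on the complex line through \<open>z\<close> in direction \<open>v\<close> gives
  \<open>norm v \<le> 2 * dist z q * K\<close>. The infimum over \<open>q\<close> is the directional
  boundary distance, which \<open>m\<close>-convexity bounds.\<close>

lemma m_convex_metric_lower:
  assumes D: "m_convex m D"
  shows "\<exists>C1>0. \<forall>z\<in>D. \<forall>v. norm v \<le> C1 * infdist z (frontier D) powr (1 / m) * kobayashi_metric D z v"
proof -
  obtain C where C: "C > 0" "\<And>z v. z \<in> D \<Longrightarrow> v \<noteq> 0 \<Longrightarrow> boundary_dist_dir D z v \<le> C * boundary_dist D z powr (1 / m)"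
    using D by (auto simp: m_convex_def)
  have oD: "open D" and cD: "convex D" and bD: "bounded D"
    using D by (auto simp: m_convex_def is_domain_def)
  have "norm v \<le> 2 * C * infdist z (frontier D) powr (1 / m) * kobayashi_metric D z v" if z: "z \<in> D" for z v
  proof (cases "v = 0")
    case True
    then show ?thesis using C kobayashi_metric_nonneg[OF oD z] by simp
  next
    case False
    let ?K = "kobayashi_metric D z v" and ?L = "frontier D \<inter> {z + c *s v | c. True}"
    have line: "norm v \<le> 2 * dist z q * ?K" if q: "q \<in> ?L" for q
    proof -
      obtain c where c: "q = z + c *s v" using q by auto
      have "q \<notin> D" using q oD by (auto simp: frontier_def interior_open)
      then show ?thesis by (rule kobayashi_metric_ge_complex_line[OF oD cD z _ c])
    qed
    \<comment> \<open>The default value of \<open>infdist\<close> at the empty set has to be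
      excluded: \<open>D\<close> is bounded, so the real ray in direction \<open>v\<close> meets the
      frontier.\<close>
    have ne: "?L \<noteq> {}"
    proof -
      obtain b where b: "b > 0" "\<And>w. w \<in> D \<Longrightarrow> norm w \<le> b" using bD by (auto simp: bounded_pos)
      define s where "s = (norm z + b + 1) / norm v"
      have "norm (s *\<^sub>R v) = norm z + b + 1" using False b by (simp add: s_def)
      then have "b < norm (z + s *\<^sub>R v)" using norm_triangle_ineq2[of "s *\<^sub>R v" "- z"] by (simp add: add.commute)
      then have "z + s *\<^sub>R v \<notin> D" using b(2) by force
      then have "closed_segment z (z + s *\<^sub>R v) \<inter> frontier D \<noteq> {}"
        using z by (intro connected_Int_frontier) auto
      then obtain q where q: "q \<in> frontier D" "q \<in> closed_segment z (z + s *\<^sub>R v)" by blast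
      then obtain u where "q = (1 - u) *\<^sub>R z + u *\<^sub>R (z + s *\<^sub>R v)" by (auto simp: in_segment)
      then have "q = z + of_real (u * s) *s v" unfolding of_real_vector_scalar_mult by (simp add: algebra_simps)
      then show ?thesis using q(1) by blast
    qed
    have K0: "0 < ?K"
    proof -
      obtain q where "q \<in> ?L" using ne by blast
      from line[OF this] have "norm v \<le> 2 * dist z q * ?K" .
      moreover have "0 < norm v" using False by simp
      ultimately have "0 < 2 * dist z q * ?K" by linarith
      then show ?thesis by (simp add: zero_less_mult_iff)
    qed
    have "norm v / (2 * ?K) \<le> infdist z ?L"
      unfolding infdist_notempty[OF ne] using line K0
      by (intro cINF_greatest[OF ne]) (simp add: divide_le_eq mult_ac)
    also have "\<dots> \<le> C * infdist z (frontier D) powr (1 / m)"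
      using C(2)[OF z False] by (simp add: boundary_dist_dir_def boundary_dist_def)
    finally show ?thesis using K0 by (simp add: divide_le_eq mult_ac)
  qed
  then show ?thesis using C by (intro exI[of _ "2 * C"]) auto
qed

theorem theorem1p9:
  fixes \<Omega> U :: "(complex ^ 'n) set" and \<xi> :: "complex ^ 'n" and m :: real
  assumes "CARD('n) \<ge> 2"
    and "is_domain \<Omega>" and "bounded \<Omega>"
    and "\<xi> \<in> frontier \<Omega>"
    and "\<xi> \<in> interior U"
    and "m_convex m (\<Omega> \<inter> U)"
    and "\<forall>p \<in> frontier \<Omega> \<inter> U. Dini_smooth_boundary_point \<Omega> p"
  shows "\<exists>V. open V \<and> \<xi> \<in> V \<and> compact (closure V) \<and> closure V \<subseteq> U \<and>
    (\<exists>C>0.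
      (\<forall>x \<in> \<Omega> \<inter> V. \<forall>y \<in> \<Omega> \<inter> V.
         kobayashi_dist \<Omega> x y \<le> kobayashi_dist (\<Omega> \<inter> U) x y \<and>
         kobayashi_dist (\<Omega> \<inter> U) x y \<le> kobayashi_dist \<Omega> x y + C * norm (x - y) powr (1 / m)) \<and>
      (\<forall>x \<in> \<Omega> \<inter> V. \<forall>y \<in> \<Omega> \<inter> V. x \<noteq> y \<longrightarrow>
         1 \<le> kobayashi_dist (\<Omega> \<inter> U) x y / kobayashi_dist \<Omega> x y \<and>
         kobayashi_dist (\<Omega> \<inter> U) x y / kobayashi_dist \<Omega> x y
           \<le> 1 + C * (min (boundary_dist \<Omega> x) (boundary_dist \<Omega> y) + norm (x - y) powr (1 / m))))"
proof -
  define D where "D = \<Omega> \<inter> U"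
  have o\<Omega>: "open \<Omega>" using assms(2) by (simp add: is_domain_def)
  have mc: "m_convex m D" using assms(6) by (simp add: D_def)
  then have oD: "open D" and cD: "convex D" and m: "m > 1" by (auto simp: m_convex_def is_domain_def)
  have "\<xi> \<in> U" using assms(5) interior_subset by blast
  then have "Dini_smooth_boundary_point \<Omega> \<xi>" using assms(4,7) by blast
  then obtain W where W: "open W" "\<xi> \<in> W" "\<And>x. x \<in> frontier \<Omega> \<Longrightarrow> x \<in> W \<Longrightarrow> C1_smooth_boundary_point \<Omega> x"
    "(\<integral>\<^sup>+ t \<in> {0<..<1}. ennreal (normal_modulus \<Omega> W t / t) \<partial>lborel) < \<infinity>"
    unfolding Dini_smooth_boundary_point_def by blast
  have "open (interior U \<inter> W)" "\<xi> \<in> interior U \<inter> W" using W assms(5) by auto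
  \<comment> \<open>Within this radius \<open>D\<close> coincides with \<open>\<Omega>\<close>, and
    the oscillation of the normals is governed by the integrable modulus of
    \<open>W\<close>.\<close>
  then obtain R where R: "R > 0" "ball \<xi> R \<subseteq> interior U \<inter> W" by (rule openE)
  have RU: "ball \<xi> R \<subseteq> U" "ball \<xi> R \<subseteq> W" using R interior_subset by blast+
  have near: "\<Omega> \<inter> ball \<xi> R \<subseteq> D" using RU by (auto simp: D_def)
  have fr: "p \<in> frontier D \<longleftrightarrow> p \<in> frontier \<Omega>" if "p \<in> ball \<xi> R" for p
    by (rule frontier_local_eq[OF o\<Omega> oD _ near open_ball that]) (simp add: D_def)
  define M where "M = diameter \<Omega> + 1"
  have M: "0 < M" using diameter_ge_0[OF assms(3)] by (simp add: M_def)
  have diam: "\<Omega> \<subseteq> ball z M" if "z \<in> \<Omega>" for z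
  proof
    fix w assume "w \<in> \<Omega>"
    then show "w \<in> ball z M" using diameter_bounded_bound[OF assms(3) \<open>z \<in> \<Omega>\<close>, of w] by (simp add: M_def)
  qed
  obtain C1 where C1: "C1 > 0" "\<And>z v. z \<in> D \<Longrightarrow> norm v \<le> C1 * infdist z (frontier D) powr (1 / m) * kobayashi_metric D z v"
    using m_convex_metric_lower[OF mc] by blast
  let ?n = "outer_unit_normal \<Omega>"
  let ?A = "\<lambda>t. {norm (?n x - ?n y) | x y. norm (x - y) < t \<and> x \<in> frontier \<Omega> \<inter> W \<and> y \<in> frontier \<Omega> \<inter> W}"
  \<comment> \<open>For \<open>t \<le> 0\<close> the modulus is a supremum over the empty set; the
    value 0 keeps \<open>\<omega>\<close> monotone.\<close>
  define \<omega> where "\<omega> t = (if t > 0 then normal_modulus \<Omega> W t else 0)" for t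
  have bdd: "bdd_above (?A t)" for t
  proof (rule bdd_aboveI[of _ 2])
    fix a assume "a \<in> ?A t"
    then obtain x y where "a = norm (?n x - ?n y)" "norm (?n x) = 1" "norm (?n y) = 1"
      using W(3) norm_outer_unit_normal by blast
    then show "a \<le> 2" using norm_triangle_ineq4[of "?n x" "?n y"] by simp
  qed
  \<comment> \<open>The pair \<open>(\<xi>, \<xi>)\<close> makes the set nonempty and its supremum
    nonnegative.\<close>
  have zero: "0 \<in> ?A t" if "t > 0" for t
    using that assms(4) W(2) by (intro CollectI exI[of _ \<xi>]) auto
  interpret dini_model \<Omega> D \<xi> m C1 R M ?n \<omega>
  proof
    show "\<xi> \<in> frontier D" using fr[of \<xi>] assms(4) R by simp
    show "\<nu> = ?n p" if pn: "p \<in> frontier D" "p \<in> ball \<xi> R" "norm \<nu> = 1" "\<And>w. w \<in> D \<Longrightarrow> (w - p) \<bullet> \<nu> < 0" for p \<nu>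
    proof -
      obtain e where e: "e > 0" "ball p e \<subseteq> ball \<xi> R" using openE[OF open_ball pn(2)] by blast
      show ?thesis
      proof (rule support_eq_outer_unit_normal[OF _ pn(3) e(1)])
        show "C1_smooth_boundary_point \<Omega> p" using pn(1,2) fr RU W(3) by blast
        show "(w - p) \<bullet> \<nu> \<le> 0" if "w \<in> \<Omega>" "w \<in> ball p e" for w
        proof -
          have "w \<in> D" using that e near by blast
          then show ?thesis using pn(4) by (simp add: less_imp_le)
        qed
      qed
    qed
    show "norm (?n p - ?n q) \<le> \<omega> t"
      if "p \<in> frontier D" "p \<in> ball \<xi> R" "q \<in> frontier D" "q \<in> ball \<xi> R" "norm (p - q) < t" for p q t
    proof -
      have "t > 0" using that(5) by (meson le_less_trans norm_ge_zero)
      moreover have "norm (?n p - ?n q) \<in> ?A t" using that fr RU by blast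
      then have "norm (?n p - ?n q) \<le> Sup (?A t)" using bdd by (rule cSup_upper)
      ultimately show ?thesis by (simp add: \<omega>_def normal_modulus_def)
    qed
    show nn: "0 \<le> \<omega> t" for t
      using cSup_upper[OF zero bdd, of t] by (simp add: \<omega>_def normal_modulus_def)
    show "mono \<omega>"
    proof (rule monoI)
      fix s t :: real assume st: "s \<le> t"
      show "\<omega> s \<le> \<omega> t"
      proof (cases "s > 0")
        case True
        have "Sup (?A s) \<le> Sup (?A t)"
        proof (rule cSup_subset_mono[OF _ bdd])
          show "?A s \<noteq> {}" using zero[OF True] by blast
          show "?A s \<subseteq> ?A t" using st less_le_trans by blast
        qed
        then show ?thesis using True st by (simp add: \<omega>_def normal_modulus_def)
      next
        case False
        then show ?thesis using nn[of t] by (simp add: \<omega>_def)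
      qed
    qed
    have "(\<integral>\<^sup>+ t \<in> {0<..<1}. ennreal (\<omega> t / t) \<partial>lborel) = (\<integral>\<^sup>+ t \<in> {0<..<1}. ennreal (normal_modulus \<Omega> W t / t) \<partial>lborel)"
      by (rule nn_integral_cong) (auto simp: \<omega>_def split: split_indicator)
    then show "(\<integral>\<^sup>+ t \<in> {0<..<1}. ennreal (\<omega> t / t) \<partial>lborel) < \<infinity>" using W(4) by simp
  qed (use o\<Omega> oD cD near R M diam m C1 in \<open>auto simp: D_def\<close>)
  obtain \<eta> C where \<eta>: "\<eta> > 0" and C: "C > 0" and est: "\<And>x y. x \<in> D \<inter> ball \<xi> \<eta> \<Longrightarrow> y \<in> D \<inter> ball \<xi> \<eta> \<Longrightarrow>
     dD x y \<le> d\<Omega> x y + C * norm (x - y) powr (1 / m) \<and>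
     dD x y \<le> (1 + C * (min (\<delta> x) (\<delta> y) + norm (x - y) powr (1 / m))) * d\<Omega> x y"
    using distance_localization by blast
  define V where "V = ball \<xi> (min \<eta> (R / 2))"
  have VD: "x \<in> D \<inter> ball \<xi> \<eta>" if "x \<in> \<Omega> \<inter> V" for x
    using that near R by (auto simp: V_def)
  \<comment> \<open>The locale measures the depth with respect to \<open>frontier D\<close>. Since
    \<open>V\<close> has radius at most \<open>R / 2\<close>, the nearest point of
    \<open>frontier \<Omega>\<close> lies in \<open>ball \<xi> R\<close>, where it also belongs to
    \<open>frontier D\<close>.\<close>
  have \<delta>_le_boundary_dist: "\<delta> x \<le> boundary_dist \<Omega> x" if "x \<in> V" for x
  proof -
    obtain q where q: "q \<in> frontier \<Omega>" "infdist x (frontier \<Omega>) = dist x q"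
      using infdist_attains_inf[of "frontier \<Omega>" x] assms(4) by auto
    have "dist x q \<le> dist x \<xi>" using infdist_le[OF assms(4), of x] q by simp
    then have "q \<in> ball \<xi> R"
      using that dist_triangle[of \<xi> q x] by (simp add: V_def dist_commute)
    then have "\<delta> x \<le> dist x q" unfolding \<delta>_def using fr q by (intro infdist_le) auto
    then show ?thesis by (simp add: boundary_dist_def q)
  qed
  show ?thesis
    unfolding D_def[symmetric]
  proof (intro exI[of _ V] exI[of _ C] conjI ballI impI C)
    show "open V" "\<xi> \<in> V" using \<eta> R by (auto simp: V_def)
    have cV: "closure V = cball \<xi> (min \<eta> (R / 2))" using \<eta> R by (simp add: V_def)
    then show "compact (closure V)" by simp
    have "cball \<xi> (min \<eta> (R / 2)) \<subseteq> ball \<xi> R" using R by auto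
    then show "closure V \<subseteq> U" using cV RU by blast
    fix x y assume xy: "x \<in> \<Omega> \<inter> V" "y \<in> \<Omega> \<inter> V"
    note e = est[OF VD[OF xy(1)] VD[OF xy(2)], unfolded dD_def d\<Omega>_def]
    have le: "kobayashi_dist \<Omega> x y \<le> kobayashi_dist D x y"
      using d\<Omega>_le_dD[of x y] VD[OF xy(1)] VD[OF xy(2)] unfolding dD_def d\<Omega>_def by blast
    then show "kobayashi_dist \<Omega> x y \<le> kobayashi_dist D x y" .
    show "kobayashi_dist D x y \<le> kobayashi_dist \<Omega> x y + C * norm (x - y) powr (1 / m)"
      using e by blast
    assume "x \<noteq> y"
    then have pos: "0 < kobayashi_dist \<Omega> x y"
      using d\<Omega>_pos[of x y] VD[OF xy(1)] VD[OF xy(2)] unfolding d\<Omega>_def by blast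
    then show "1 \<le> kobayashi_dist D x y / kobayashi_dist \<Omega> x y" using le by simp
    have "kobayashi_dist D x y / kobayashi_dist \<Omega> x y \<le> 1 + C * (min (\<delta> x) (\<delta> y) + norm (x - y) powr (1 / m))"
      using e pos by (simp add: divide_le_eq)
    also have "\<dots> \<le> 1 + C * (min (boundary_dist \<Omega> x) (boundary_dist \<Omega> y) + norm (x - y) powr (1 / m))"
      using C \<delta>_le_boundary_dist[of x] \<delta>_le_boundary_dist[of y] xy
      by (intro add_left_mono mult_left_mono add_right_mono min.mono) auto
    finally show "kobayashi_dist D x y / kobayashi_dist \<Omega> x y
        \<le> 1 + C * (min (boundary_dist \<Omega> x) (boundary_dist \<Omega> y) + norm (x - y) powr (1 / m))" .
  qed
qed

end
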